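(* Suppose the Markov chain $\Xi$ on $\mathbb X\subseteq\mathbb R_+$ satisfies $(\mathrm T_{\alpha,\beta,c})$ and $(\mathrm D_{\gamma,b})$, and let $q>0$. Then for all $a$ sufficiently large and all $x>a$: (i) if $\gamma>\alpha-1$, then $\mathbb E_x[\tau_a^q]<\infty$ for $q<1/\alpha$ and $\mathbb E_x[\tau_a^q]=\infty$ for $q>1/\alpha$; (ii) if $\gamma=\alpha-1$ and $b<c\pi|\csc(\pi\alpha)|$, then $\mathbb E_x[\tau_a^q]<\infty$ for $q<\nu^\star/\alpha$ and $\mathbb E_x[\tau_a^q]=\infty$ for $q>\nu^\star/\alpha$, where $\nu^\star=\nu^\star(\alpha,b,c)$ is the unique solution in $(0,\alpha)$ of $$\frac bc=(\nu^\star-1)\frac{\Gamma(1-\alpha)\Gamma(\alpha-\nu^\star)}{\Gamma(2-\nu^\star)};$$ (iii) if $\gamma<\alpha-1$ and $b<0$, then $\mathbb E_x[\tau_a^q]<\infty$ for $q<\frac{\alpha}{\gamma+1}$ and $\mathbb E_x[\tau_a^q]=\infty$ for $q\ge\frac{\alpha}{\gamma+1}$.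
   Context: $\Xi=(\xi_n)_{n\ge0}$ is a time-homogeneous Markov chain on an infinite, unbounded, measurable $\mathbb X\subseteq\mathbb R_+$. $\mathbb P_x,\mathbb E_x$ refer to the chain started at $x$; $\theta:=\xi_1-\xi_0$; $y_+:=y\mathbf 1\{y\ge0\}$, $y_-:=-y\mathbf 1\{y<0\}$; $\mu(x):=\mathbb E_x[\theta]$; $\tau_a:=\min\{n\ge0:\xi_n\le a\}$. $\Gamma$ is the Euler gamma function. Condition $(\mathrm T_{\alpha,\beta,c})$: there exist constants $\alpha\in(1,2)$, $\beta>\alpha$, $c>0$, $x_0\in\mathbb R_+$ with $\lim_{y\to\infty}\sup_{x\ge x_0}|y^\alpha\mathbb P_x[\theta_+>y]-c|=0$ and $\sup_{x\ge x_0}\mathbb E_x[\theta_-^\beta]<\infty$. Condition $(\mathrm D_{\gamma,b})$: there exist constants $\gamma\ge0$, $b\in\mathbb R$ with $\lim_{x\to\infty}x^\gamma\mu(x)=b$. *)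

theory Defs
  imports "HOL-Probability.Probability"
begin

definition pospart :: "real \<Rightarrow> real" where
  "pospart y = (if y \<ge> 0 then y else 0)"

definition negpart :: "real \<Rightarrow> real" where
  "negpart y = (if y < 0 then - y else 0)"

definition nat_filtration :: "'w measure \<Rightarrow> (nat \<Rightarrow> 'w \<Rightarrow> real) \<Rightarrow> nat \<Rightarrow> 'w measure" where
  "nat_filtration M X n =
     sigma (space M) (\<Union>i\<in>{..n}. {X i -` A \<inter> space M | A. A \<in> sets borel})"

definition transition_kernel_on :: "real set \<Rightarrow> (real \<Rightarrow> real measure) \<Rightarrow> bool" where
  "transition_kernel_on S K \<longleftrightarrow>
     (\<forall>x. prob_space (K x) \<and> sets (K x) = sets borel) \<and>
     (\<forall>x\<in>S. emeasure (K x) S = 1) \<and>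
     (\<forall>B\<in>sets borel. (\<lambda>x. measure (K x) B) \<in> borel_measurable borel)"

definition markov_chain_from ::
  "real set \<Rightarrow> (real \<Rightarrow> real measure) \<Rightarrow> 'w measure \<Rightarrow> (nat \<Rightarrow> 'w \<Rightarrow> real) \<Rightarrow> real \<Rightarrow> bool" where
  "markov_chain_from S K M X x \<longleftrightarrow>
     prob_space M \<and>
     (\<forall>n. X n \<in> borel_measurable M) \<and>
     (\<forall>n. \<forall>\<omega>\<in>space M. X n \<omega> \<in> S) \<and>
     (AE \<omega> in M. X 0 \<omega> = x) \<and>
     (\<forall>n. \<forall>B\<in>sets borel. AE \<omega> in M.
        real_cond_exp M (nat_filtration M X n) (\<lambda>\<omega>. indicator B (X (Suc n) \<omega>)) \<omega>
          = measure (K (X n \<omega>)) B)"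

definition hitting_time :: "(nat \<Rightarrow> 'w \<Rightarrow> real) \<Rightarrow> real \<Rightarrow> 'w \<Rightarrow> enat" where
  "hitting_time X a \<omega> = (if \<exists>n. X n \<omega> \<le> a then enat (LEAST n. X n \<omega> \<le> a) else \<infinity>)"

definition tau_moment :: "'w measure \<Rightarrow> (nat \<Rightarrow> 'w \<Rightarrow> real) \<Rightarrow> real \<Rightarrow> real \<Rightarrow> ennreal" where
  "tau_moment M X a q =
     (\<integral>\<^sup>+ \<omega>. (case hitting_time X a \<omega> of enat n \<Rightarrow> ennreal (real n powr q) | \<infinity> \<Rightarrow> top) \<partial>M)"

definition cond_T :: "real set \<Rightarrow> (real \<Rightarrow> 'w measure) \<Rightarrow> (nat \<Rightarrow> 'w \<Rightarrow> real)
                       \<Rightarrow> real \<Rightarrow> real \<Rightarrow> real \<Rightarrow> bool" where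
  "cond_T S M X \<alpha> \<beta> c \<longleftrightarrow>
     1 < \<alpha> \<and> \<alpha> < 2 \<and> \<beta> > \<alpha> \<and> c > 0 \<and>
     (\<exists>x0 \<ge> 0.
        (\<forall>\<epsilon>>0. \<exists>Y. \<forall>y\<ge>Y. \<forall>x\<in>S. x \<ge> x0 \<longrightarrow>
           \<bar>y powr \<alpha> * measure (M x) {\<omega>\<in>space (M x). pospart (X 1 \<omega> - X 0 \<omega>) > y} - c\<bar> \<le> \<epsilon>) \<and>
        (\<exists>C::real. \<forall>x\<in>S. x \<ge> x0 \<longrightarrow>
           (\<integral>\<^sup>+ \<omega>. ennreal (negpart (X 1 \<omega> - X 0 \<omega>) powr \<beta>) \<partial>M x) \<le> ennreal C))"

definition drift :: "(real \<Rightarrow> 'w measure) \<Rightarrow> (nat \<Rightarrow> 'w \<Rightarrow> real) \<Rightarrow> real \<Rightarrow> real" where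
  "drift M X x = (\<integral>\<omega>. (X 1 \<omega> - X 0 \<omega>) \<partial>M x)"

definition cond_D :: "real set \<Rightarrow> (real \<Rightarrow> 'w measure) \<Rightarrow> (nat \<Rightarrow> 'w \<Rightarrow> real)
                       \<Rightarrow> real \<Rightarrow> real \<Rightarrow> bool" where
  "cond_D S M X \<gamma> b \<longleftrightarrow>
     \<gamma> \<ge> 0 \<and> ((\<lambda>x. x powr \<gamma> * drift M X x) \<longlongrightarrow> b) (inf at_top (principal S))"

definition nu_star_eq :: "real \<Rightarrow> real \<Rightarrow> real \<Rightarrow> real \<Rightarrow> bool" where
  "nu_star_eq \<alpha> b c \<nu> \<longleftrightarrow>
     0 < \<nu> \<and> \<nu> < \<alpha> \<and>
     b / c = (\<nu> - 1) * Gamma (1 - \<alpha>) * Gamma (\<alpha> - \<nu>) / Gamma (2 - \<nu>)"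

end

theory Submission
  imports Defs
begin

text \<open>
  Let \<open>\<tau>\<close> be the entrance time into \<open>[0, a]\<close>. The tail probabilities \<open>P(\<tau> > n)\<close> are the iterates of
  the kernel killed at \<open>[0, a]\<close>, and \<open>\<tau>\<close> has a finite \<open>q\<close>-th moment iff
  \<open>\<Sum>n. (n + 1) powr (q - 1) * P(\<tau> > n)\<close> converges.

  The Lyapunov functions are powers \<open>x powr \<nu>\<close> with \<open>0 < \<nu> < \<alpha>\<close>. In the critical case \<open>\<gamma> = \<alpha> - 1\<close> the
  drift of \<open>x powr \<nu>\<close> is \<open>x powr (\<nu> - \<alpha>)\<close> times a constant with the sign of \<open>\<nu> - \<nu>\<^sup>\<star>\<close>, by a Beta
  integral; the case \<open>\<gamma> > \<alpha> - 1\<close> is the critical case with \<open>b = 0\<close>, where \<open>\<nu>\<^sup>\<star> = 1\<close>. For \<open>\<gamma> < \<alpha> - 1\<close> and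
  \<open>b < 0\<close> the drift is at most \<open>- \<epsilon> x powr (\<nu> - \<rho>)\<close> with \<open>\<rho> = \<gamma> + 1\<close>.

  A drift of at most \<open>- \<epsilon> x powr (\<nu> - \<rho>)\<close> with \<open>\<nu> \<le> \<rho>\<close> gives \<open>P(\<tau> > n) \<le> C x powr \<nu> * n powr (- \<nu> / \<rho>)\<close>,
  and moments of order above 1 follow by applying this bound along the path.
  In the other direction, from height \<open>y\<close> the chain needs time of order \<open>y powr \<rho>\<close> to come down, by the
  Lyapunov function \<open>1 / x\<close>. If \<open>x powr \<nu>\<close> is a submartingale and \<open>\<nu> = \<rho> q\<close>, then
  \<open>E((\<tau> - n) powr q; \<tau> > n)\<close> stays bounded away from 0, so that \<open>E(\<tau> powr q)\<close> is infinite. For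
  \<open>\<gamma> < \<alpha> - 1\<close> a single jump above \<open>n powr (1 / \<rho>)\<close> already has the critical probability.
\<close>

section \<open>Iterates of a killed kernel\<close>

text \<open>The hypotheses give one path measure \<open>M x\<close> per starting point and the
  Markov property only one step ahead, as a conditional expectation. Paths therefore enter only
  where survival probabilities are identified with iterates of the killed kernel. The martingale
  arguments after that are inductions on these iterates in \<open>ennreal\<close>, and inequalities
  are stated additively so that nothing infinite is subtracted.

  The obstacle is the right tail: increments have uniform moments only below order \<alpha>. The
  bound for \<open>1 / x\<close> and the coarse drift bound for powers each cost one such moment, so
  the former is confined to time scales \<rho> < \<alpha>, while the critical case lives at scale
  \<alpha>. Upper bounds there need the exact tail constant, through the Beta integral. Lower bounds
  manage with some \<rho> < \<alpha>, because \<nu> can be taken strictly between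
  \<open>\<nu>\<^sup>\<star>\<close> and q \<alpha>. This slack leaves the endpoint undecided in the
  critical case; in the subcritical case a single jump decides it.\<close>

definition killed :: "(real \<Rightarrow> real measure) \<Rightarrow> real set \<Rightarrow> (real \<Rightarrow> ennreal) \<Rightarrow> real \<Rightarrow> ennreal" where
  "killed K E h x = indicator E x * (\<integral>\<^sup>+y. h y \<partial>K x)"

definition stay :: "(real \<Rightarrow> real measure) \<Rightarrow> real set \<Rightarrow> nat \<Rightarrow> real \<Rightarrow> ennreal" where
  "stay K E n = (killed K E ^^ n) (indicator E)"

text \<open>The weights with exponent q - 1 are the discrete derivative of the q-th power, so for q
  > 0 this is the q-th moment of the exit time up to constants. They are taken at n + 1 because
  \<open>0 powr (q - 1)\<close> is 0, which would drop the term n = 0.\<close>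

definition stay_series :: "(real \<Rightarrow> real measure) \<Rightarrow> real set \<Rightarrow> real \<Rightarrow> real \<Rightarrow> ennreal" where
  "stay_series K E q x = (\<Sum>n. ennreal (real (Suc n) powr (q - 1)) * stay K E n x)"

lemma killed_notin [simp]: "x \<notin> E \<Longrightarrow> killed K E h x = 0"
  by (simp add: killed_def)

lemma killed_in: "x \<in> E \<Longrightarrow> killed K E h x = (\<integral>\<^sup>+y. h y \<partial>K x)"
  by (simp add: killed_def)

lemma killed_mono: "(\<And>y. h y \<le> h' y) \<Longrightarrow> killed K E h x \<le> killed K E h' x"
  by (auto simp: killed_def intro!: mult_left_mono nn_integral_mono)

lemma killed_funpow_mono:
  "(\<And>y. h y \<le> h' y) \<Longrightarrow> (killed K E ^^ n) h x \<le> (killed K E ^^ n) h' x"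
  by (induction n arbitrary: x) (auto intro: killed_mono)

lemma stay_0: "stay K E 0 = indicator E"
  by (simp add: stay_def)

lemma stay_Suc: "stay K E (Suc n) = killed K E (stay K E n)"
  by (simp add: stay_def)

lemma stay_add: "stay K E (m + n) = (killed K E ^^ m) (stay K E n)"
  by (simp add: stay_def funpow_add)

lemma stay_notin: "x \<notin> E \<Longrightarrow> stay K E n x = 0"
  by (cases n) (auto simp: stay_0 stay_Suc)

lemma sum_weights_diverge:
  assumes "q > 0"
  shows "(\<Sum>n. ennreal (real (Suc n) powr (q - 1))) = top"
proof (rule ccontr)
  assume "(\<Sum>n. ennreal (real (Suc n) powr (q - 1))) \<noteq> top"
  hence "summable (\<lambda>n. real (Suc n) powr (q - 1))"
    by (intro summable_suminf_not_top) auto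
  hence "summable (\<lambda>n. real n powr (q - 1))"
    by (subst (asm) summable_Suc_iff)
  thus False using assms by (simp add: summable_real_powr_iff)
qed

section \<open>Measurability, linearity and monotonicity of the killed iterates\<close>

locale borel_kernel =
  fixes K :: "real \<Rightarrow> real measure"
  assumes prob_K: "prob_space (K x)"
    and sets_K [measurable_cong, simp]: "sets (K x) = sets borel"
    and measurable_measure_K: "B \<in> sets borel \<Longrightarrow> (\<lambda>x. measure (K x) B) \<in> borel_measurable borel"
begin

sublocale KP: prob_space "K x" for x by (rule prob_K)

lemma space_K [simp]: "space (K x) = UNIV"
  using sets_eq_imp_space_eq[OF sets_K[of x]] by simp

lemma emeasure_K_UNIV [simp]: "emeasure (K x) UNIV = 1"
  using KP.emeasure_space_1[of x] by simp

abbreviation nn_moment :: "real \<Rightarrow> real \<Rightarrow> ennreal" where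
  "nn_moment \<nu> x \<equiv> \<integral>\<^sup>+y. ennreal (y powr \<nu>) \<partial>K x"

lemma measurable_K [measurable]: "K \<in> borel \<rightarrow>\<^sub>M subprob_algebra borel"
proof (rule measurable_subprob_algebra)
  fix B :: "real set" assume B: "B \<in> sets borel"
  have "(\<lambda>x. emeasure (K x) B) = (\<lambda>x. ennreal (measure (K x) B))"
    by (simp add: KP.emeasure_eq_measure)
  thus "(\<lambda>x. emeasure (K x) B) \<in> borel_measurable borel"
    using measurable_measure_K[OF B] by simp
qed (auto intro: prob_space_imp_subprob_space prob_K)

lemma measurable_nn_integral_K [measurable]:
  assumes [measurable]: "h \<in> borel_measurable borel"
  shows "(\<lambda>x. \<integral>\<^sup>+y. h y \<partial>K x) \<in> borel_measurable borel"
  by measurable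

lemma measurable_killed [measurable]:
  assumes [measurable]: "h \<in> borel_measurable borel" "E \<in> sets borel"
  shows "killed K E h \<in> borel_measurable borel"
  unfolding killed_def by measurable

lemma measurable_killed_funpow [measurable]:
  assumes [measurable]: "h \<in> borel_measurable borel" "E \<in> sets borel"
  shows "(killed K E ^^ n) h \<in> borel_measurable borel"
  by (induction n) auto

lemma measurable_stay [measurable]:
  assumes [measurable]: "E \<in> sets borel"
  shows "stay K E n \<in> borel_measurable borel"
  unfolding stay_def by measurable

lemma measurable_stay_series [measurable]:
  assumes [measurable]: "E \<in> sets borel"
  shows "stay_series K E q \<in> borel_measurable borel"
  unfolding stay_series_def by measurable

lemma killed_cmult:
  assumes [measurable]: "h \<in> borel_measurable borel"
  shows "killed K E (\<lambda>y. c * h y) x = c * killed K E h x"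
  unfolding killed_def by (subst nn_integral_cmult) (auto simp: ac_simps)

lemma killed_suminf:
  assumes [measurable]: "\<And>j. h j \<in> borel_measurable borel"
  shows "killed K E (\<lambda>y. \<Sum>j::nat. h j y) x = (\<Sum>j. killed K E (h j) x)"
  unfolding killed_def by (subst nn_integral_suminf) auto

lemma killed_sum:
  assumes "\<And>j. j \<in> A \<Longrightarrow> h j \<in> borel_measurable borel"
  shows "killed K E (\<lambda>y. \<Sum>j\<in>A. h j y) x = (\<Sum>j\<in>A. killed K E (h j) x)"
  unfolding killed_def using assms by (subst nn_integral_sum) (auto simp: sum_distrib_left)

lemma killed_funpow_cmult:
  assumes [measurable]: "h \<in> borel_measurable borel" "E \<in> sets borel"
  shows "(killed K E ^^ n) (\<lambda>y. c * h y) x = c * (killed K E ^^ n) h x"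
proof (induction n arbitrary: x)
  case (Suc n)
  have "(killed K E ^^ n) (\<lambda>y. c * h y) = (\<lambda>y. c * (killed K E ^^ n) h y)"
    using Suc by auto
  thus ?case by (simp add: killed_cmult)
qed simp

lemma killed_funpow_suminf:
  assumes [measurable]: "\<And>j. h j \<in> borel_measurable borel" "E \<in> sets borel"
  shows "(killed K E ^^ n) (\<lambda>y. \<Sum>j::nat. h j y) x = (\<Sum>j. (killed K E ^^ n) (h j) x)"
proof (induction n arbitrary: x)
  case (Suc n)
  have "(killed K E ^^ n) (\<lambda>y. \<Sum>j. h j y) = (\<lambda>y. \<Sum>j. (killed K E ^^ n) (h j) y)"
    using Suc by auto
  thus ?case by (simp add: killed_suminf)
qed simp

lemma stay_le_1: "stay K E n x \<le> 1"
proof (induction n arbitrary: x)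
  case (Suc n)
  have "(\<integral>\<^sup>+y. stay K E n y \<partial>K x) \<le> (\<integral>\<^sup>+y. 1 \<partial>K x)"
    by (intro nn_integral_mono Suc)
  thus ?case by (cases "x \<in> E") (auto simp: stay_Suc killed_in)
qed (auto simp: stay_0 indicator_def)

lemma stay_Suc_le: "stay K E (Suc n) x \<le> stay K E n x"
proof (induction n arbitrary: x)
  case 0
  then show ?case using stay_le_1[of E 1 x]
    by (cases "x \<in> E") (auto simp: stay_0 stay_Suc)
next
  case (Suc n)
  then show ?case by (metis stay_Suc killed_mono)
qed

lemma stay_antimono: "m \<le> n \<Longrightarrow> stay K E n x \<le> stay K E m x"
  by (rule lift_Suc_antimono_le[of "\<lambda>n. stay K E n x"]) (rule stay_Suc_le)

text \<open>The left side is the mean of the minimum of \<tau> and n. Above level h the trivial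
  bound n is at most \<open>n * x powr \<nu> / h powr \<nu>\<close>. Below h, where \<nu> \<le>
  \<rho> makes the drift at least \<open>e * h powr (\<nu> - \<rho>)\<close>, the other term pays
  one unit of time per step. The level h stays free so that it can be balanced against n.\<close>

lemma sum_stay_le:
  assumes E [measurable]: "E \<in> sets borel" and Epos: "\<And>x. x \<in> E \<Longrightarrow> 0 < x"
    and \<nu>: "0 < \<nu>" "\<nu> \<le> \<rho>" and e: "e > 0" and h: "h > 0"
    and drift: "\<And>x. x \<in> E \<Longrightarrow>
      nn_moment \<nu> x + ennreal (e * x powr (\<nu> - \<rho>)) \<le> ennreal (x powr \<nu>)"
  shows "(\<Sum>k<n. stay K E k x) \<le> ennreal (x powr \<nu> * (h powr (\<rho> - \<nu>) / e + real n / h powr \<nu>))"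
proof (induction n arbitrary: x)
  case 0
  show ?case by simp
next
  case (Suc n)
  define c where "c = (h powr (\<rho> - \<nu>) / e + real n / h powr \<nu>)"
  have c: "c \<ge> 0" using e by (simp add: c_def)
  show ?case
  proof (cases "x \<in> E")
    case False
    thus ?thesis by (simp add: stay_notin del: sum.lessThan_Suc)
  next
    case True
    hence x: "x > 0" using Epos by auto
    show ?thesis
    proof (cases "x > h")
      case True
      have "(\<Sum>k<Suc n. stay K E k x) \<le> (\<Sum>k<Suc n. 1)"
        by (intro sum_mono stay_le_1)
      also have "\<dots> = ennreal (real (Suc n))"
        by (simp add: ennreal_of_nat_eq_real_of_nat del: of_nat_Suc)
      also have "real (Suc n) \<le> x powr \<nu> * (h powr (\<rho> - \<nu>) / e + real (Suc n) / h powr \<nu>)"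
      proof -
        have "real (Suc n) * h powr \<nu> \<le> real (Suc n) * x powr \<nu>"
          using True h \<nu> by (intro mult_left_mono powr_mono2) auto
        hence "real (Suc n) \<le> x powr \<nu> * (real (Suc n) / h powr \<nu>)"
          using h by (simp add: field_simps)
        also have "\<dots> \<le> x powr \<nu> * (h powr (\<rho> - \<nu>) / e + real (Suc n) / h powr \<nu>)"
          using e by (intro mult_left_mono) auto
        finally show ?thesis .
      qed
      finally show ?thesis by (simp add: ennreal_leI)
    next
      case False
      obtain i where i: "nn_moment \<nu> x = ennreal i" "i \<ge> 0"
        using drift[OF \<open>x \<in> E\<close>]
        by (cases "nn_moment \<nu> x") (auto simp: top_unique)
      have i2: "i + e * x powr (\<nu> - \<rho>) \<le> x powr \<nu>"
        using drift[OF \<open>x \<in> E\<close>] i e by (simp add: ennreal_plus[symmetric] del: ennreal_plus)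
      have "(\<Sum>k<Suc n. stay K E k x) = 1 + killed K E (\<lambda>y. \<Sum>k<n. stay K E k y) x"
        using \<open>x \<in> E\<close> by (subst sum.lessThan_Suc_shift, subst killed_sum) (auto simp: stay_0 stay_Suc)
      also have "\<dots> \<le> 1 + killed K E (\<lambda>y. ennreal c * ennreal (y powr \<nu>)) x"
        using Suc c unfolding c_def
        by (intro add_left_mono killed_mono) (simp add: ennreal_mult'[symmetric] mult_ac)
      also have "\<dots> = 1 + ennreal c * ennreal i"
        using \<open>x \<in> E\<close> i by (subst killed_cmult) (auto simp: killed_in)
      also have "\<dots> = ennreal (1 + c * i)"
        using c i by (subst ennreal_plus) (auto simp: ennreal_mult)
      also have "1 + c * i \<le> x powr \<nu> * (h powr (\<rho> - \<nu>) / e + real (Suc n) / h powr \<nu>)"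
      proof -
        have *: "c * i \<le> c * (x powr \<nu> - e * x powr (\<nu> - \<rho>))"
          using c i2 by (intro mult_left_mono) auto
        \<comment> \<open>Here x \<le> h and \<nu> \<le> \<rho> enter: c times the drift is at least
          1, which covers the current step.\<close>
        have "h powr (\<rho> - \<nu>) / e * (e * x powr (\<nu> - \<rho>)) \<le> c * (e * x powr (\<nu> - \<rho>))"
          using e by (intro mult_right_mono) (auto simp: c_def)
        moreover have "h powr (\<rho> - \<nu>) / e * (e * x powr (\<nu> - \<rho>)) = (h / x) powr (\<rho> - \<nu>)"
          using e x h by (simp add: powr_divide powr_minus_divide[of x "\<rho> - \<nu>", simplified])
        moreover have "1 \<le> (h / x) powr (\<rho> - \<nu>)"
          using False x \<nu> by (intro ge_one_powr_ge_zero) auto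
        ultimately have "1 + c * i \<le> c * x powr \<nu>"
          using * by (simp add: algebra_simps)
        also have "\<dots> \<le> (h powr (\<rho> - \<nu>) / e + real (Suc n) / h powr \<nu>) * x powr \<nu>"
          unfolding c_def by (intro mult_right_mono add_left_mono divide_right_mono) auto
        finally show ?thesis by (simp add: mult_ac)
      qed
      finally show ?thesis by (simp add: ennreal_leI)
    qed
  qed
qed

text \<open>Survival probabilities decrease in time, so n + 1 times the last one is at most their
  sum. With h = \<open>N powr (1 / \<rho>)\<close> both terms of the bound for that sum have the
  same order.\<close>

lemma stay_le_powr:
  assumes E [measurable]: "E \<in> sets borel" and Epos: "\<And>x. x \<in> E \<Longrightarrow> 0 < x"
    and \<nu>: "0 < \<nu>" "\<nu> \<le> \<rho>" and e: "e > 0"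
    and drift: "\<And>x. x \<in> E \<Longrightarrow>
      nn_moment \<nu> x + ennreal (e * x powr (\<nu> - \<rho>)) \<le> ennreal (x powr \<nu>)"
  shows "stay K E n x \<le> ennreal ((1 + 1 / e) * x powr \<nu> * real (Suc n) powr (- \<nu> / \<rho>))"
proof -
  define N where "N = real (Suc n)"
  define h where "h = N powr (1 / \<rho>)"
  have N: "N > 0" by (simp add: N_def)
  have h: "h > 0" using N by (simp add: h_def)
  have \<rho>: "\<rho> > 0" using \<nu> by simp
  have "ennreal N * stay K E n x = (\<Sum>k<Suc n. stay K E n x)"
    by (simp add: N_def ennreal_of_nat_eq_real_of_nat del: of_nat_Suc sum.lessThan_Suc)
  also have "\<dots> \<le> (\<Sum>k<Suc n. stay K E k x)"
    by (intro sum_mono stay_antimono) auto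
  also have "\<dots> \<le> ennreal (x powr \<nu> * (h powr (\<rho> - \<nu>) / e + real (Suc n) / h powr \<nu>))"
    by (rule sum_stay_le[OF E Epos \<nu> e h drift])
  also have "x powr \<nu> * (h powr (\<rho> - \<nu>) / e + real (Suc n) / h powr \<nu>)
      = N * ((1 + 1 / e) * x powr \<nu> * N powr (- \<nu> / \<rho>))"
  proof -
    have 1: "h powr (\<rho> - \<nu>) = N * N powr (- \<nu> / \<rho>)"
      using N \<rho> by (simp add: h_def powr_powr powr_add[symmetric] powr_mult_base diff_divide_distrib)
    have 2: "N / h powr \<nu> = N * N powr (- \<nu> / \<rho>)"
      using N \<rho> by (simp add: h_def powr_powr powr_minus_divide)
    show ?thesis using 1 2 unfolding N_def by (simp add: algebra_simps)
  qed
  also have "ennreal \<dots> = ennreal N * ennreal ((1 + 1 / e) * x powr \<nu> * N powr (- \<nu> / \<rho>))"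
    using N by (simp add: ennreal_mult')
  finally show ?thesis unfolding N_def[symmetric]
    using N by (subst (asm) ennreal_mult_le_mult_iff) (auto simp: ennreal_eq_0_iff)
qed

text \<open>The tail exponent \<nu> / \<rho> exceeds q, so the weighted sum converges. The exponent
  q is not restricted to positive values: moments of order at least 1 are later reduced to q - 1,
  which may be 0.\<close>

lemma stay_series_le_powr:
  assumes E [measurable]: "E \<in> sets borel" and Epos: "\<And>x. x \<in> E \<Longrightarrow> 0 < x"
    and \<nu>: "0 < \<nu>" "\<nu> \<le> \<rho>" and e: "e > 0"
    and drift: "\<And>x. x \<in> E \<Longrightarrow>
      nn_moment \<nu> x + ennreal (e * x powr (\<nu> - \<rho>)) \<le> ennreal (x powr \<nu>)"
    and q: "q < \<nu> / \<rho>"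
  shows "\<exists>C\<ge>0. \<forall>x. stay_series K E q x \<le> ennreal (C * x powr \<nu>)"
proof -
  define s where "s = (\<Sum>n. real (Suc n) powr (q - 1 - \<nu> / \<rho>))"
  have "summable (\<lambda>n. real n powr (q - 1 - \<nu> / \<rho>))"
    using q by (simp add: summable_real_powr_iff)
  hence summ: "summable (\<lambda>n. real (Suc n) powr (q - 1 - \<nu> / \<rho>))"
    by (subst summable_Suc_iff)
  have s: "(\<Sum>n. ennreal (real (Suc n) powr (q - 1 - \<nu> / \<rho>))) = ennreal s" "s \<ge> 0"
    unfolding s_def using summ by (auto intro!: suminf_ennreal2 suminf_nonneg)
  show ?thesis
  proof (intro exI[of _ "(1 + 1 / e) * s"] conjI allI)
    fix x
    have "stay_series K E q x \<le> (\<Sum>n. ennreal ((1 + 1 / e) * x powr \<nu>) * ennreal (real (Suc n) powr (q - 1 - \<nu> / \<rho>)))"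
      unfolding stay_series_def
    proof (intro suminf_le allI)
      fix n
      have "ennreal (real (Suc n) powr (q - 1)) * stay K E n x
        \<le> ennreal (real (Suc n) powr (q - 1)) * ennreal ((1 + 1 / e) * x powr \<nu> * real (Suc n) powr (- \<nu> / \<rho>))"
        by (intro mult_left_mono stay_le_powr[OF E Epos \<nu> e drift]) auto
      also have "\<dots> = ennreal ((1 + 1 / e) * x powr \<nu> * (real (Suc n) powr (q - 1) * real (Suc n) powr (- \<nu> / \<rho>)))"
        using e by (subst ennreal_mult[symmetric]) (auto simp: mult_ac)
      also have "real (Suc n) powr (q - 1) * real (Suc n) powr (- \<nu> / \<rho>) = real (Suc n) powr (q - 1 - \<nu> / \<rho>)"
        by (simp add: powr_add[symmetric])
      finally show "ennreal (real (Suc n) powr (q - 1)) * stay K E n x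
        \<le> ennreal ((1 + 1 / e) * x powr \<nu>) * ennreal (real (Suc n) powr (q - 1 - \<nu> / \<rho>))"
        using e by (subst ennreal_mult[symmetric]) auto
    qed auto
    also have "\<dots> = ennreal ((1 + 1 / e) * x powr \<nu>) * ennreal s"
      by (simp only: ennreal_suminf_cmult s)
    also have "\<dots> = ennreal ((1 + 1 / e) * s * x powr \<nu>)"
      using e s by (subst ennreal_mult[symmetric]) (auto simp: mult_ac)
    finally show "stay_series K E q x \<le> \<dots>" .
  qed (use e s in auto)
qed


section \<open>Lower bounds and summation along the path\<close>

lemma le_killed_funpow:
  assumes "\<And>y. f y \<le> killed K E f y"
  shows "f x \<le> (killed K E ^^ n) f x"
proof (induction n arbitrary: x)
  case (Suc n)
  have "f x \<le> killed K E f x" by (rule assms)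
  also have "\<dots> \<le> killed K E ((killed K E ^^ n) f) x" by (intro killed_mono Suc)
  finally show ?case by simp
qed simp

text \<open>Applying the iterate restarts the clock at time n: for q > 0 the right side is
  comparable to the mean of \<open>(\<tau> - n) powr q\<close> on the event that \<tau> > n.\<close>

lemma killed_funpow_stay_series:
  assumes [measurable]: "E \<in> sets borel"
  shows "(killed K E ^^ n) (stay_series K E q) x
    = (\<Sum>j. ennreal (real (Suc j) powr (q - 1)) * stay K E (n + j) x)"
  unfolding stay_series_def
  by (subst killed_funpow_suminf) (auto simp: killed_funpow_cmult stay_add)

text \<open>The survival probabilities decrease to a limit \<open>L\<close>, and the series is at
  least \<open>L\<close> times the divergent sum of the weights. Finiteness forces \<open>L\<close>
  to vanish, so the exit time is almost surely finite.\<close>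

lemma stay_tendsto_0:
  assumes "stay_series K E q x \<noteq> top" "q > 0"
  shows "(\<lambda>n. stay K E n x) \<longlonglongrightarrow> 0"
proof -
  define L where "L = (INF n. stay K E n x)"
  have "(\<Sum>n. ennreal (real (Suc n) powr (q - 1)) * L) \<le> stay_series K E q x"
    unfolding stay_series_def L_def by (intro suminf_le mult_left_mono INF_lower) auto
  hence "top * L \<noteq> top"
    using assms sum_weights_diverge[OF \<open>q > 0\<close>] by (auto simp: ennreal_suminf_multc top_unique)
  hence "L = 0" by (auto simp: ennreal_top_mult split: if_splits)
  moreover have "(\<lambda>n. stay K E n x) \<longlonglongrightarrow> L"
    unfolding L_def by (intro LIMSEQ_INF decseq_SucI stay_Suc_le)
  ultimately show ?thesis by simp
qed

text \<open>If the series were finite at \<open>x\<close>, its shifts would tend to zero by dominated convergence;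
  but the shifts dominate the submartingale \<open>f\<close>.\<close>

lemma stay_series_eq_top:
  assumes E [measurable]: "E \<in> sets borel" and f [measurable]: "f \<in> borel_measurable borel"
    and sub: "\<And>y. f y \<le> killed K E f y"
    and le: "\<And>y. ennreal c * f y \<le> stay_series K E q y" and c: "c > 0" and q: "q > 0" and fx: "f x > 0"
  shows "stay_series K E q x = top"
proof (rule ccontr)
  assume fin: "stay_series K E q x \<noteq> top"
  let ?w = "\<lambda>j. ennreal (real (Suc j) powr (q - 1))"
  have "(\<lambda>n. \<integral>\<^sup>+j. ?w j * stay K E (n + j) x \<partial>count_space UNIV) \<longlonglongrightarrow>
        (\<integral>\<^sup>+j. 0 \<partial>(count_space UNIV :: nat measure))"
  \<comment> \<open>The unshifted summand dominates every shifted one, and its sum is the series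
    assumed finite.\<close>
  proof (rule nn_integral_dominated_convergence[where w = "\<lambda>j. ?w j * stay K E j x"])
    show "(\<integral>\<^sup>+j. ?w j * stay K E j x \<partial>count_space UNIV) < \<infinity>"
      using fin by (simp add: nn_integral_count_space_nat stay_series_def top.not_eq_extremum)
    show "AE j in count_space UNIV. (\<lambda>n. ?w j * stay K E (n + j) x) \<longlonglongrightarrow> 0"
    proof (rule AE_I2)
      fix j
      have "(\<lambda>n. stay K E (n + j) x) \<longlonglongrightarrow> 0"
        using LIMSEQ_ignore_initial_segment[OF stay_tendsto_0[OF fin q]] .
      hence "(\<lambda>n. ?w j * stay K E (n + j) x) \<longlonglongrightarrow> ?w j * 0"
        by (intro ennreal_tendsto_cmult) auto
      thus "(\<lambda>n. ?w j * stay K E (n + j) x) \<longlonglongrightarrow> 0" by simp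
    qed
  qed (auto intro!: AE_I2 mult_left_mono stay_antimono)
  hence lim: "(\<lambda>n. (killed K E ^^ n) (stay_series K E q) x) \<longlonglongrightarrow> 0"
    by (simp add: nn_integral_count_space_nat killed_funpow_stay_series)
  have "ennreal c * f x \<le> (killed K E ^^ n) (stay_series K E q) x" for n
  proof -
    have "ennreal c * f x \<le> ennreal c * (killed K E ^^ n) f x"
      by (intro mult_left_mono le_killed_funpow sub) auto
    also have "\<dots> = (killed K E ^^ n) (\<lambda>y. ennreal c * f y) x"
      by (subst killed_funpow_cmult) auto
    also have "\<dots> \<le> (killed K E ^^ n) (stay_series K E q) x"
      by (intro killed_funpow_mono le)
    finally show ?thesis .
  qed
  hence "ennreal c * f x \<le> 0"
    by (intro LIMSEQ_le_const[OF lim]) auto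
  thus False using c fx by (auto simp: ennreal_eq_0_iff)
qed

text \<open>A maximal inequality in disguise: F is at least 1 once E' has been left and gains at
  most d per step in mean before that, so leaving E' within n steps has probability at most F(x) + n
  d. The smaller set E' allows F to be controlled only well above the killing level.\<close>

lemma stay_ge:
  assumes F [measurable]: "F \<in> borel_measurable borel" and E [measurable]: "E \<in> sets borel"
    and sub: "E' \<subseteq> E" and off: "\<And>y. y \<notin> E' \<Longrightarrow> F y \<ge> 1"
    and on: "\<And>y. y \<in> E' \<Longrightarrow> (\<integral>\<^sup>+z. F z \<partial>K y) \<le> F y + d"
  shows "1 \<le> stay K E n x + F x + of_nat n * d"
proof (induction n arbitrary: x)
  case 0
  then show ?case using sub off[of x]
    by (cases "x \<in> E'") (auto simp: stay_0 indicator_def add_increasing add_increasing2)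
next
  case (Suc n)
  show ?case
  proof (cases "x \<in> E'")
    case False
    then show ?thesis using off[of x]
      by (meson add_increasing add_increasing2 zero_le)
  next
    case True
    hence "x \<in> E" using sub by auto
    have "1 = (\<integral>\<^sup>+y. 1 \<partial>K x)" by simp
    also have "\<dots> \<le> (\<integral>\<^sup>+y. stay K E n y + F y + of_nat n * d \<partial>K x)"
      by (intro nn_integral_mono Suc)
    also have "\<dots> = (\<integral>\<^sup>+y. stay K E n y \<partial>K x) + (\<integral>\<^sup>+y. F y \<partial>K x) + of_nat n * d"
      by (simp add: nn_integral_add)
    also have "\<dots> \<le> (\<integral>\<^sup>+y. stay K E n y \<partial>K x) + (F x + d) + of_nat n * d"
      by (intro add_mono on True) auto
    also have "\<dots> = stay K E (Suc n) x + F x + of_nat (Suc n) * d"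
      using \<open>x \<in> E\<close> by (simp add: stay_Suc killed_in algebra_simps)
    finally show ?thesis .
  qed
qed

text \<open>Dynkin's formula as an inequality: f loses at least r in mean at each step inside E, so
  the expected total of r before the exit cannot exceed the initial value of f.\<close>

lemma sum_killed_funpow_le:
  assumes [measurable]: "E \<in> sets borel" "r \<in> borel_measurable borel" "f \<in> borel_measurable borel"
    and off: "\<And>y. y \<notin> E \<Longrightarrow> r y = 0"
    and drift: "\<And>y. y \<in> E \<Longrightarrow> r y + (\<integral>\<^sup>+z. f z \<partial>K y) \<le> f y"
  shows "(\<Sum>m<n. (killed K E ^^ m) r x) \<le> f x"
proof (induction n arbitrary: x)
  case (Suc n)
  have "(\<Sum>m<Suc n. (killed K E ^^ m) r x) = r x + killed K E (\<lambda>y. \<Sum>m<n. (killed K E ^^ m) r y) x"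
    by (subst sum.lessThan_Suc_shift, subst killed_sum) auto
  also have "\<dots> \<le> r x + killed K E f x"
    by (intro add_left_mono killed_mono Suc)
  also have "\<dots> \<le> f x"
    using drift[of x] off[of x] by (cases "x \<in> E") (auto simp: killed_in)
  finally show ?case .
qed simp

text \<open>The semigroup property writes \<open>(n + 1) stay n\<close> as the sum of \<open>killed ^^ m\<close> applied to
  \<open>stay (n - m)\<close>; this trades one power of time for a sum over the path.\<close>

lemma stay_series_le_suminf:
  assumes E [measurable]: "E \<in> sets borel" and q: "q \<le> 2"
  shows "stay_series K E q x \<le> (\<Sum>m. (killed K E ^^ m) (stay_series K E (q - 1)) x)"
proof -
  let ?w = "\<lambda>j. ennreal (real (Suc j) powr (q - 2))"
  let ?a = "\<lambda>m j. ?w j * stay K E (m + j) x"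
  have termwise: "ennreal (real (Suc n) powr (q - 1)) * stay K E n x \<le> (\<Sum>m\<le>n. ?a m (n - m))" for n
  proof -
    have "real (Suc n) powr (q - 1) = real (Suc n) * real (Suc n) powr (q - 2)"
      by (subst powr_mult_base) auto
    hence "ennreal (real (Suc n) powr (q - 1)) * stay K E n x = of_nat (Suc n) * (?w n * stay K E n x)"
      by (simp add: ennreal_mult' ennreal_of_nat_eq_real_of_nat mult_ac del: of_nat_Suc)
    also have "\<dots> = (\<Sum>m\<le>n. ?w n * stay K E n x)" by simp
    also have "\<dots> \<le> (\<Sum>m\<le>n. ?a m (n - m))"
    proof (rule sum_mono)
      fix m assume "m \<in> {..n}"
      \<comment> \<open>For q \<le> 2 the weight does not increase in time, so evaluating it at n -
        m instead of n only enlarges it.\<close>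
      thus "?w n * stay K E n x \<le> ?a m (n - m)"
        using q by (auto intro!: mult_right_mono ennreal_leI powr_mono2')
    qed
    finally show ?thesis .
  qed
  show ?thesis unfolding stay_series_def
  proof (rule suminf_le_const)
    fix N
    have "(\<Sum>n<N. ennreal (real (Suc n) powr (q - 1)) * stay K E n x) \<le> (\<Sum>n<N. \<Sum>m\<le>n. ?a m (n - m))"
      by (intro sum_mono termwise)
    also have "\<dots> = (\<Sum>(m, j)\<in>{(m, j). m + j < N}. ?a m j)"
      by (rule sum.triangle_reindex[symmetric])
    also have "\<dots> \<le> (\<Sum>(m, j)\<in>{..<N} \<times> {..<N}. ?a m j)"
      by (intro sum_mono2) auto
    also have "\<dots> = (\<Sum>m<N. \<Sum>j<N. ?a m j)"
      by (simp add: sum.cartesian_product)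
    also have "\<dots> \<le> (\<Sum>m<N. \<Sum>j. ?a m j)"
      by (intro sum_mono sum_le_suminf) auto
    also have "\<dots> \<le> (\<Sum>m. \<Sum>j. ?a m j)"
      by (intro sum_le_suminf) auto
    also have "\<dots> = (\<Sum>m. (killed K E ^^ m) (\<lambda>x. \<Sum>n. ennreal (real (Suc n) powr (q - 1 - 1)) * stay K E n x) x)"
      using killed_funpow_stay_series[OF E, of _ "q - 1" x] unfolding stay_series_def[abs_def]
      by (simp add: algebra_simps)
    finally show "(\<Sum>n<N. ennreal (real (Suc n) powr (q - 1)) * stay K E n x) \<le> \<dots>" .
  qed auto
qed

text \<open>Summing the bound for exponent q - 1 along the path bounds the series for q. If the
  former is at most a multiple of the drift loss r of f, the whole sum is at most that multiple of
  f.\<close>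

lemma stay_series_le_drift:
  assumes E [measurable]: "E \<in> sets borel" and q: "q \<le> 2"
    and f [measurable]: "f \<in> borel_measurable borel"
    and r [measurable]: "r \<in> borel_measurable borel"
    and le: "\<And>y. y \<in> E \<Longrightarrow> stay_series K E (q - 1) y \<le> ennreal C * r y"
    and drift: "\<And>y. y \<in> E \<Longrightarrow> r y + (\<integral>\<^sup>+z. f z \<partial>K y) \<le> f y"
  shows "stay_series K E q x \<le> ennreal C * f x"
proof -
  \<comment> \<open>The path sum counts only positions inside E, so r is cut off outside; there the
    series vanishes as well.\<close>
  define r' where "r' y = indicator E y * r y" for y
  have [measurable]: "r' \<in> borel_measurable borel" unfolding r'_def by measurable
  have le': "stay_series K E (q - 1) y \<le> ennreal C * r' y" for y
    using le[of y] by (cases "y \<in> E") (auto simp: r'_def stay_series_def stay_notin)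
  have "(\<Sum>m. (killed K E ^^ m) r' x) \<le> f x"
    by (intro suminf_le_const sum_killed_funpow_le) (auto simp: r'_def drift)
  have "stay_series K E q x \<le> (\<Sum>m. (killed K E ^^ m) (stay_series K E (q - 1)) x)"
    by (rule stay_series_le_suminf[OF E q])
  also have "\<dots> \<le> (\<Sum>m. (killed K E ^^ m) (\<lambda>y. ennreal C * r' y) x)"
    by (intro suminf_le killed_funpow_mono le') auto
  also have "\<dots> = ennreal C * (\<Sum>m. (killed K E ^^ m) r' x)"
    by (simp add: killed_funpow_cmult)
  also have "\<dots> \<le> ennreal C * f x" by (intro mult_left_mono) (fact, simp)
  finally show ?thesis .
qed

end

section \<open>Markov chains and moments of the hitting time\<close>

text \<open>The inequalities with factor q come from the mean value theorem on [n, n + 1], the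
  others from writing \<open>n powr q\<close> as \<open>n * n powr (q - 1)\<close>. At n = 0 they
  use that \<open>0 powr q\<close> is 0. Telescoping them compares \<open>n powr q\<close> with the
  partial sums of the weights.\<close>

lemma weight_increment:
  fixes q :: real
  assumes "q > 0"
  shows "q \<ge> 1 \<Longrightarrow> real (Suc n) powr q - real n powr q \<le> q * real (Suc n) powr (q - 1)"
    and "q \<le> 1 \<Longrightarrow> q * real (Suc n) powr (q - 1) \<le> real (Suc n) powr q - real n powr q"
    and "q \<ge> 1 \<Longrightarrow> real (Suc n) powr (q - 1) \<le> real (Suc n) powr q - real n powr q"
    and "q \<le> 1 \<Longrightarrow> real (Suc n) powr q - real n powr q \<le> real (Suc n) powr (q - 1)"
proof -
  have "\<exists>t. t > real n \<and> t < real (Suc n) \<and>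
      real (Suc n) powr q - real n powr q = (real (Suc n) - real n) * (q * t powr (q - 1))" if "n > 0"
    using that by (intro MVT2) (auto intro!: derivative_eq_intros)
  then obtain t where t: "n > 0 \<Longrightarrow> t > real n \<and> t < real (Suc n) \<and>
      real (Suc n) powr q - real n powr q = q * t powr (q - 1)"
    by auto
  show "q \<ge> 1 \<Longrightarrow> real (Suc n) powr q - real n powr q \<le> q * real (Suc n) powr (q - 1)"
    using t assms by (cases "n = 0") (auto intro!: mult_left_mono powr_mono2)
  show "q \<le> 1 \<Longrightarrow> q * real (Suc n) powr (q - 1) \<le> real (Suc n) powr q - real n powr q"
    using t assms by (cases "n = 0") (auto intro!: mult_left_mono powr_mono2')
  have *: "real (Suc n) powr q - real n powr q = real (Suc n) * real (Suc n) powr (q - 1) - real n * real n powr (q - 1)"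
    by (cases "n = 0") (auto simp: powr_mult_base)
  show "q \<ge> 1 \<Longrightarrow> real (Suc n) powr (q - 1) \<le> real (Suc n) powr q - real n powr q"
  proof -
    assume "q \<ge> 1"
    hence "real n * real n powr (q - 1) \<le> real n * real (Suc n) powr (q - 1)"
      by (intro mult_left_mono powr_mono2) auto
    thus ?thesis unfolding * by (simp add: algebra_simps)
  qed
  show "q \<le> 1 \<Longrightarrow> real (Suc n) powr q - real n powr q \<le> real (Suc n) powr (q - 1)"
  proof -
    assume "q \<le> 1"
    hence "real n * real (Suc n) powr (q - 1) \<le> real n * real n powr (q - 1)"
      by (cases "n = 0") (auto intro!: mult_left_mono powr_mono2')
    thus ?thesis unfolding * by (simp add: algebra_simps)
  qed
qed

lemma powr_le_sum_weights:
  assumes "q > 0"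
  shows "real n powr q \<le> max 1 q * (\<Sum>k<n. real (Suc k) powr (q - 1))"
proof (induction n)
  case (Suc n)
  have "real (Suc n) powr q - real n powr q \<le> max 1 q * real (Suc n) powr (q - 1)"
    using weight_increment(1,4)[OF assms, of n] by (cases "q \<ge> 1") (auto simp: max_def)
  thus ?case using Suc by (simp add: algebra_simps)
qed simp

lemma sum_weights_le_powr:
  assumes "q > 0"
  shows "(\<Sum>k<n. real (Suc k) powr (q - 1)) \<le> max 1 (1 / q) * real n powr q"
proof (induction n)
  case (Suc n)
  have "real (Suc n) powr (q - 1) \<le> max 1 (1 / q) * (real (Suc n) powr q - real n powr q)"
  proof (cases "q \<ge> 1")
    case True
    then show ?thesis using weight_increment(3)[OF assms, of n] by (auto simp: max_def)
  next
    case False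
    then show ?thesis using weight_increment(2)[OF assms, of n] assms
      by (auto simp: max_def field_simps)
  qed
  thus ?case using Suc by (simp add: algebra_simps)
qed simp

context borel_kernel
begin

lemma subalgebra_nat_filtration:
  assumes "\<And>n. X n \<in> borel_measurable M"
  shows "subalgebra M (nat_filtration M X n)"
proof -
  have sub: "(\<Union>i\<in>{..n}. {X i -` A \<inter> space M | A. A \<in> sets borel}) \<subseteq> sets M"
    using assms by (auto intro: measurable_sets)
  hence "sigma_sets (space M) (\<Union>i\<in>{..n}. {X i -` A \<inter> space M | A. A \<in> sets borel}) \<subseteq> sets M"
    by (rule sets.sigma_sets_subset)
  moreover have "(\<Union>i\<in>{..n}. {X i -` A \<inter> space M | A. A \<in> sets borel}) \<subseteq> Pow (space M)"
    by auto
  ultimately show ?thesis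
    unfolding subalgebra_def nat_filtration_def by (simp add: space_measure_of sets_measure_of)
qed

lemma in_nat_filtration:
  assumes "B \<in> sets borel" "i \<le> n"
  shows "{w\<in>space M. X i w \<in> B} \<in> sets (nat_filtration M X n)"
proof -
  have eq: "{w\<in>space M. X i w \<in> B} = X i -` B \<inter> space M" by auto
  have "X i -` B \<inter> space M \<in> sigma_sets (space M) (\<Union>i\<in>{..n}. {X i -` A \<inter> space M | A. A \<in> sets borel})"
    using assms by (intro sigma_sets.Basic) auto
  moreover have "(\<Union>i\<in>{..n}. {X i -` A \<inter> space M | A. A \<in> sets borel}) \<subseteq> Pow (space M)"
    by auto
  ultimately show ?thesis
    unfolding nat_filtration_def eq by (simp add: sets_measure_of)
qed

text \<open>The chain is given through conditional probabilities of Borel sets. Integrating these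
  over a past event A settles indicators, and the induction on nonnegative Borel functions extends
  the identity to all h by linearity and monotone convergence.\<close>

lemma markov_property:
  assumes mc: "markov_chain_from S K M X x"
    and A: "A \<in> sets (nat_filtration M X n)" and h: "h \<in> borel_measurable borel"
  shows "(\<integral>\<^sup>+w. indicator A w * h (X (Suc n) w) \<partial>M)
       = (\<integral>\<^sup>+w. indicator A w * (\<integral>\<^sup>+y. h y \<partial>K (X n w)) \<partial>M)"
proof -
  interpret M: prob_space M using mc by (simp add: markov_chain_from_def)
  have X [measurable]: "X n \<in> borel_measurable M" for n
    using mc by (simp add: markov_chain_from_def)
  have F: "subalgebra M (nat_filtration M X n)"
    by (rule subalgebra_nat_filtration) (rule X)
  interpret F: finite_measure_subalgebra M "nat_filtration M X n"
    by unfold_locales (rule F)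
  have [measurable]: "A \<in> sets M" using A F by (auto simp: subalgebra_def)
  show ?thesis using h
  proof (induction rule: borel_measurable_induct)
    case (cong f g)
    then show ?case by (simp add: space_borel cong: nn_integral_cong)
  next
    case (set B)
    let ?ce = "real_cond_exp M (nat_filtration M X n) (\<lambda>w. indicator B (X (Suc n) w))"
    note [measurable] = set measurable_measure_K[OF set]
    have K_eq: "(\<integral>\<^sup>+y. indicator B y \<partial>K z) = ennreal (measure (K z) B)" for z
      using set by (simp add: KP.emeasure_eq_measure)
    have int: "integrable M (\<lambda>w. indicator B (X (Suc n) w) :: real)"
      by (rule M.integrable_const_bound[where B = 1]) (auto simp: indicator_def)
    have int2: "integrable M (\<lambda>w. indicator A w * measure (K (X n w)) B)"
      by (rule M.integrable_const_bound[where B = 1]) (auto simp: indicator_def)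
    have int3: "integrable M (\<lambda>w. indicator A w * indicator B (X (Suc n) w) :: real)"
      by (rule M.integrable_const_bound[where B = 1]) (auto simp: indicator_def)
    have "(\<integral>w. indicator A w * indicator B (X (Suc n) w) \<partial>M)
        = (\<integral>w. indicator A w * ?ce w \<partial>M)"
      using F.real_cond_exp_intA[OF int A] by (simp add: set_lebesgue_integral_def)
    also have "\<dots> = (\<integral>w. indicator A w * measure (K (X n w)) B \<partial>M)"
    proof (rule integral_cong_AE)
      have "AE w in M. ?ce w
          = measure (K (X n w)) B"
        using mc set by (auto simp: markov_chain_from_def)
      thus "AE w in M. indicator A w * ?ce w
          = indicator A w * measure (K (X n w)) B"
        by eventually_elim simp
    qed auto
    finally have eq: "(\<integral>w. indicator A w * indicator B (X (Suc n) w) \<partial>M)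
      = (\<integral>w. indicator A w * measure (K (X n w)) B \<partial>M)" .
    have "(\<integral>\<^sup>+w. indicator A w * indicator B (X (Suc n) w) \<partial>M)
        = (\<integral>\<^sup>+w. ennreal (indicator A w * indicator B (X (Suc n) w)) \<partial>M)"
      by (intro nn_integral_cong) (auto simp: indicator_def)
    also have "\<dots> = ennreal (\<integral>w. indicator A w * indicator B (X (Suc n) w) \<partial>M)"
      by (intro nn_integral_eq_integral int3) auto
    also have "\<dots> = (\<integral>\<^sup>+w. ennreal (indicator A w * measure (K (X n w)) B) \<partial>M)"
      unfolding eq by (intro nn_integral_eq_integral[symmetric] int2) auto
    also have "\<dots> = (\<integral>\<^sup>+w. indicator A w * (\<integral>\<^sup>+y. indicator B y \<partial>K (X n w)) \<partial>M)"
      unfolding K_eq by (intro nn_integral_cong) (auto simp: indicator_def)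
    finally show ?case .
  next
    case (mult u c)
    note [measurable] = mult(2)
    have "(\<integral>\<^sup>+w. indicator A w * (c * u (X (Suc n) w)) \<partial>M) = c * (\<integral>\<^sup>+w. indicator A w * u (X (Suc n) w) \<partial>M)"
      by (subst nn_integral_cmult[symmetric]) (auto simp: ac_simps)
    also have "\<dots> = c * (\<integral>\<^sup>+w. indicator A w * (\<integral>\<^sup>+y. u y \<partial>K (X n w)) \<partial>M)"
      using mult by simp
    also have "\<dots> = (\<integral>\<^sup>+w. indicator A w * (\<integral>\<^sup>+y. c * u y \<partial>K (X n w)) \<partial>M)"
      by (subst nn_integral_cmult[symmetric]) (auto simp: ac_simps nn_integral_cmult)
    finally show ?case .
  next
    case (add u v)
    note [measurable] = add(1,3)
    show ?case using add
      by (simp add: nn_integral_add distrib_left)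
  next
    case (seq U)
    note [measurable] = seq(1)
    have "(\<integral>\<^sup>+w. indicator A w * (SUP i. U i) (X (Suc n) w) \<partial>M)
        = (\<integral>\<^sup>+w. (SUP i. indicator A w * U i (X (Suc n) w)) \<partial>M)"
      by (intro nn_integral_cong) (auto simp: SUP_mult_left_ennreal image_comp)
    also have "\<dots> = (SUP i. \<integral>\<^sup>+w. indicator A w * U i (X (Suc n) w) \<partial>M)"
      using \<open>incseq U\<close> by (intro nn_integral_monotone_convergence_SUP)
        (auto simp: incseq_def le_fun_def intro!: mult_left_mono)
    also have "\<dots> = (SUP i. \<integral>\<^sup>+w. indicator A w * (\<integral>\<^sup>+y. U i y \<partial>K (X n w)) \<partial>M)"
      using seq by simp
    also have "\<dots> = (\<integral>\<^sup>+w. (SUP i. indicator A w * (\<integral>\<^sup>+y. U i y \<partial>K (X n w))) \<partial>M)"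
      using \<open>incseq U\<close> by (intro nn_integral_monotone_convergence_SUP[symmetric])
        (auto simp: incseq_def le_fun_def intro!: mult_left_mono nn_integral_mono)
    also have "\<dots> = (\<integral>\<^sup>+w. indicator A w * (\<integral>\<^sup>+y. (SUP i. U i) y \<partial>K (X n w)) \<partial>M)"
      using \<open>incseq U\<close> by (intro nn_integral_cong)
        (auto simp: SUP_mult_left_ennreal[symmetric] image_comp nn_integral_monotone_convergence_SUP incseq_def le_fun_def)
    finally show ?case .
  qed
qed

lemma nn_integral_start:
  assumes mc: "markov_chain_from S K M X x" and h [measurable]: "h \<in> borel_measurable borel"
  shows "(\<integral>\<^sup>+w. h (X 0 w) \<partial>M) = h x"
proof -
  interpret M: prob_space M using mc by (simp add: markov_chain_from_def)
  have "AE w in M. X 0 w = x" using mc by (simp add: markov_chain_from_def)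
  hence "(\<integral>\<^sup>+w. h (X 0 w) \<partial>M) = (\<integral>\<^sup>+w. h x \<partial>M)"
    by (intro nn_integral_cong_AE) auto
  thus ?thesis by (simp add: M.emeasure_space_1)
qed

lemma nn_integral_first_step:
  assumes mc: "markov_chain_from S K M X x" and h [measurable]: "h \<in> borel_measurable borel"
  shows "(\<integral>\<^sup>+w. h (X 1 w) \<partial>M) = (\<integral>\<^sup>+y. h y \<partial>K x)"
proof -
  have "space M \<in> sets (nat_filtration M X 0)"
    using in_nat_filtration[of UNIV 0 0 M X] by simp
  from markov_property[OF mc this h]
  have "(\<integral>\<^sup>+w. h (X 1 w) \<partial>M) = (\<integral>\<^sup>+w. (\<integral>\<^sup>+y. h y \<partial>K (X 0 w)) \<partial>M)"
    by (simp cong: nn_integral_cong)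
  thus ?thesis using nn_integral_start[OF mc, of "\<lambda>z. \<integral>\<^sup>+y. h y \<partial>K z"] by simp
qed

text \<open>The survival probability is computed by moving the present time m from 0 to n: the mean
  of \<open>stay K E (n - m)\<close> at \<open>X m\<close>, on the event that E has not been left
  before m, does not depend on m.\<close>

lemma emeasure_stay:
  assumes mc: "markov_chain_from S K M X x" and E [measurable]: "E \<in> sets borel"
  shows "emeasure M {w\<in>space M. \<forall>i\<le>n. X i w \<in> E} = stay K E n x"
proof -
  have X [measurable]: "X n \<in> borel_measurable M" for n
    using mc by (simp add: markov_chain_from_def)
  \<comment> \<open>Only times strictly before m are inspected, so \<open>A (Suc m)\<close> belongs
    to the history up to time m, as the Markov property requires.\<close>
  define A where "A m = {w\<in>space M. \<forall>i<m. X i w \<in> E}" for m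
  have A_filt: "A (Suc m) \<in> sets (nat_filtration M X m)" for m
  proof -
    have "A (Suc m) = (\<Inter>i\<in>{..m}. {w\<in>space M. X i w \<in> E})"
      by (auto simp: A_def less_Suc_eq_le)
    also have "\<dots> \<in> sets (nat_filtration M X m)"
      by (intro sets.finite_INT in_nat_filtration) auto
    finally show ?thesis .
  qed
  have "(\<integral>\<^sup>+w. indicator (A m) w * stay K E (n - m) (X m w) \<partial>M) = stay K E n x" if "m \<le> n" for m
    using that
  proof (induction m)
    case 0
    have "(\<integral>\<^sup>+w. indicator (A 0) w * stay K E n (X 0 w) \<partial>M) = (\<integral>\<^sup>+w. stay K E n (X 0 w) \<partial>M)"
      by (intro nn_integral_cong) (auto simp: A_def)
    then show ?case using nn_integral_start[OF mc, of "stay K E n"] by simp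
  next
    case (Suc m)
    have "n - m = Suc (n - Suc m)" using Suc by auto
    hence "stay K E n x = (\<integral>\<^sup>+w. indicator (A m) w * stay K E (Suc (n - Suc m)) (X m w) \<partial>M)"
      using Suc by simp
    also have "\<dots> = (\<integral>\<^sup>+w. indicator (A (Suc m)) w * (\<integral>\<^sup>+y. stay K E (n - Suc m) y \<partial>K (X m w)) \<partial>M)"
      by (intro nn_integral_cong) (auto simp: A_def stay_Suc killed_def indicator_def less_Suc_eq)
    also have "\<dots> = (\<integral>\<^sup>+w. indicator (A (Suc m)) w * stay K E (n - Suc m) (X (Suc m) w) \<partial>M)"
      by (intro markov_property[symmetric, OF mc A_filt]) measurable
    finally show ?case by simp
  qed
  from this[of n] have "stay K E n x = (\<integral>\<^sup>+w. indicator (A n) w * indicator E (X n w) \<partial>M)"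
    by (simp add: stay_0)
  also have "\<dots> = (\<integral>\<^sup>+w. indicator {w\<in>space M. \<forall>i\<le>n. X i w \<in> E} w \<partial>M)"
    by (intro nn_integral_cong) (auto simp: A_def indicator_def le_less)
  finally show ?thesis by simp
qed

text \<open>Both inequalities hold path by path. \<open>W\<close> adds the weights up to the hitting
  time, which gives its q-th power up to a constant; on a path that never hits, the divergent sum of
  weights matches the value \<open>top\<close> in the moment.\<close>

lemma tau_moment_bounds:
  assumes mc: "markov_chain_from S K M X x" and S [measurable]: "S \<in> sets borel" and q: "q > 0"
  shows "tau_moment M X a q \<le> ennreal (max 1 q) * stay_series K (S \<inter> {a<..}) q x"
    and "stay_series K (S \<inter> {a<..}) q x \<le> ennreal (max 1 (1 / q)) * tau_moment M X a q"
proof -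
  let ?w = "\<lambda>n. real (Suc n) powr (q - 1)"
  have X [measurable]: "X n \<in> borel_measurable M" for n
    using mc by (simp add: markov_chain_from_def)
  have XS: "X n w \<in> S" if "w \<in> space M" for n w
    using mc that by (simp add: markov_chain_from_def)
  define A where "A n = {w\<in>space M. \<forall>i\<le>n. X i w \<in> S \<inter> {a<..}}" for n
  have [measurable]: "A n \<in> sets M" for n unfolding A_def by measurable
  have emeasure_A: "emeasure M (A n) = stay K (S \<inter> {a<..}) n x" for n
    unfolding A_def by (rule emeasure_stay[OF mc]) measurable
  define W where "W w = (\<Sum>n. ennreal (?w n) * indicator (A n) w)" for w
  define T where "T w = (case hitting_time X a w of enat n \<Rightarrow> ennreal (real n powr q) | \<infinity> \<Rightarrow> top)" for w
  have WM [measurable]: "W \<in> borel_measurable M" unfolding W_def by measurable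
  have series: "stay_series K (S \<inter> {a<..}) q x = (\<integral>\<^sup>+w. W w \<partial>M)"
    unfolding W_def stay_series_def
    by (subst nn_integral_suminf) (auto simp: nn_integral_cmult emeasure_A)
  have *: "T w \<le> ennreal (max 1 q) * W w \<and> W w \<le> ennreal (max 1 (1 / q)) * T w"
    if w: "w \<in> space M" for w
  proof (cases "\<exists>n. X n w \<le> a")
    case False
    have "W w = top"
      unfolding W_def sum_weights_diverge[OF q, symmetric] using w False XS
      by (intro suminf_cong) (auto simp: A_def not_le)
    thus ?thesis using False q by (auto simp: T_def hitting_time_def ennreal_mult_top ennreal_eq_0_iff)
  next
    case True
    define N where "N = (LEAST n. X n w \<le> a)"
    have N: "X N w \<le> a" unfolding N_def using True by (rule LeastI_ex)
    have N_less: "X i w > a" if "i < N" for i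
      using not_less_Least[of i "\<lambda>n. X n w \<le> a"] that unfolding N_def by auto
    have A: "w \<in> A n \<longleftrightarrow> n < N" for n
    proof
      assume "w \<in> A n"
      hence "\<forall>i\<le>n. X i w > a" by (auto simp: A_def)
      thus "n < N" using N by (meson not_le)
    qed (use N_less XS w in \<open>auto simp: A_def\<close>)
    have "W w = (\<Sum>n<N. ennreal (?w n) * indicator (A n) w)"
      unfolding W_def by (intro suminf_finite) (auto simp: A)
    also have "\<dots> = (\<Sum>n<N. ennreal (?w n))"
      by (intro sum.cong) (auto simp: A)
    also have "\<dots> = ennreal (\<Sum>n<N. ?w n)" by (subst sum_ennreal) auto
    finally have W: "W w = ennreal (\<Sum>n<N. ?w n)" .
    have T: "T w = ennreal (real N powr q)"
      using True by (auto simp: T_def hitting_time_def N_def)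
    show ?thesis unfolding W T
      using powr_le_sum_weights[OF q, of N] sum_weights_le_powr[OF q, of N]
      by (auto simp: ennreal_mult'[symmetric] sum_nonneg intro!: ennreal_leI)
  qed
  have "tau_moment M X a q = (\<integral>\<^sup>+w. T w \<partial>M)" by (simp add: tau_moment_def T_def)
  also have "\<dots> \<le> (\<integral>\<^sup>+w. ennreal (max 1 q) * W w \<partial>M)"
    using * by (intro nn_integral_mono) auto
  also have "\<dots> = ennreal (max 1 q) * stay_series K (S \<inter> {a<..}) q x"
    unfolding series by (rule nn_integral_cmult) measurable
  finally show "tau_moment M X a q \<le> ennreal (max 1 q) * stay_series K (S \<inter> {a<..}) q x" .
  have TM [measurable]: "T \<in> borel_measurable M"
  proof -
    have "hitting_time X a \<in> measurable M (count_space UNIV)"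
      unfolding hitting_time_def by measurable
    thus ?thesis unfolding T_def by measurable
  qed
  have "stay_series K (S \<inter> {a<..}) q x \<le> (\<integral>\<^sup>+w. ennreal (max 1 (1 / q)) * T w \<partial>M)"
    unfolding series using * by (intro nn_integral_mono) auto
  also have "\<dots> = ennreal (max 1 (1 / q)) * tau_moment M X a q"
    unfolding tau_moment_def T_def[symmetric] by (rule nn_integral_cmult) measurable
  finally show "stay_series K (S \<inter> {a<..}) q x \<le> \<dots>" .
qed

end

section \<open>Power integrals and Taylor estimates\<close>

text \<open>Tonelli's theorem for the region 0 < s < u. The measure N stays general because it is
  Lebesgue measure in the Beta integral and the law of a scaled increment in the drift
  computations.\<close>

lemma layer_cake:
  assumes N: "sigma_finite_measure N" and sets [measurable_cong]: "sets N = sets borel"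
    and [measurable]: "g \<in> borel_measurable borel" "w \<in> borel_measurable borel"
  shows "(\<integral>\<^sup>+u. w u * (\<integral>\<^sup>+s. g s * indicator {0<..<u} s \<partial>lborel) \<partial>N)
       = (\<integral>\<^sup>+s. g s * indicator {0<..} s * (\<integral>\<^sup>+u. w u * indicator {s<..} u \<partial>N) \<partial>(lborel :: real measure))"
proof -
  interpret N: sigma_finite_measure N by (rule N)
  interpret P: pair_sigma_finite lborel N by unfold_locales
  have "(\<integral>\<^sup>+u. w u * (\<integral>\<^sup>+s. g s * indicator {0<..<u} s \<partial>lborel) \<partial>N)
      = (\<integral>\<^sup>+u. (\<integral>\<^sup>+s. w u * (g s * (if 0 < s \<and> s < u then 1 else 0)) \<partial>lborel) \<partial>N)"
    by (subst nn_integral_cmult) (auto simp: indicator_def of_bool_def intro!: nn_integral_cong)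
  also have "\<dots> = (\<integral>\<^sup>+s. (\<integral>\<^sup>+u. w u * (g s * (if 0 < s \<and> s < u then 1 else 0)) \<partial>N) \<partial>lborel)"
    by (rule P.Fubini') measurable
  also have "\<dots> = (\<integral>\<^sup>+s. g s * indicator {0<..} s * (\<integral>\<^sup>+u. w u * indicator {s<..} u \<partial>N) \<partial>lborel)"
    by (subst nn_integral_cmult[symmetric])
       (auto simp: indicator_def of_bool_def ac_simps intro!: nn_integral_cong)
  finally show ?thesis .
qed

lemma nn_integral_FTC_Ioo:
  fixes f F :: "real \<Rightarrow> real"
  assumes "a \<le> u" and "\<And>s. s \<in> {a..u} \<Longrightarrow> DERIV F s :> f s" and "\<And>s. s \<in> {a..u} \<Longrightarrow> 0 \<le> f s"
  shows "(\<integral>\<^sup>+s. ennreal (f s) * indicator {a<..<u} s \<partial>lborel) = ennreal (F u - F a)"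
proof (rule nn_integral_has_integral_lebesgue')
  have "(f has_integral (F u - F a)) {a..u}"
    using assms by (intro fundamental_theorem_of_calculus)
      (auto simp flip: has_real_derivative_iff_has_vector_derivative intro: DERIV_subset)
  thus "(f has_integral (F u - F a)) {a<..<u}"
    by (simp add: has_integral_Icc_iff_Ioo)
qed (use assms in auto)

lemma nn_integral_powr_Ioo:
  assumes "a > -1" "u \<ge> 0"
  shows "(\<integral>\<^sup>+s. ennreal (s powr a) * indicator {0<..<u} s \<partial>lborel) = ennreal (u powr (a + 1) / (a + 1))"
  by (rule nn_integral_has_integral_lebesgue')
     (use has_integral_powr_from_0[OF assms] in \<open>auto simp: has_integral_Icc_iff_Ioo\<close>)

lemma nn_integral_powr_Ioi:
  assumes "e < -1" "r > 0"
  shows "(\<integral>\<^sup>+s. ennreal (s powr e) * indicator {r<..} s \<partial>lborel) = ennreal (r powr (e + 1) / (- e - 1))"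
proof -
  have "(\<integral>\<^sup>+s. ennreal (s powr e) * indicator {r<..} s \<partial>lborel) = (\<integral>\<^sup>+s. ennreal (s powr e) * indicator {r..} s \<partial>lborel)"
    using AE_lborel_singleton[of r]
    by (intro nn_integral_cong_AE, eventually_elim) (auto simp: indicator_def)
  also have "\<dots> = ennreal (- (r powr (e + 1)) / (e + 1))"
    by (rule nn_integral_has_integral_lebesgue') (use has_integral_powr_to_inf[OF assms] in auto)
  also have "- (r powr (e + 1)) / (e + 1) = r powr (e + 1) / (- e - 1)"
    using assms by (simp add: field_simps)
  finally show ?thesis .
qed

text \<open>The substitution t = l u in Euler's integral. The rate l lets a negative power be
  represented as an integral of exponentials.\<close>

lemma nn_integral_Gamma_scaled:
  assumes m: "m > 0" and l: "l > 0"
  shows "(\<integral>\<^sup>+u. ennreal (u powr (m - 1) * exp (- l * u)) * indicator {0<..} u \<partial>lborel)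
       = ennreal (Gamma m * l powr (- m))"
proof -
  let ?f = "\<lambda>t. ennreal (indicator {0..} t * t powr (m - 1) / exp t)"
  let ?I = "\<integral>\<^sup>+u. ennreal (u powr (m - 1) * exp (- l * u)) * indicator {0<..} u \<partial>lborel"
  have "ennreal (Gamma m) = (\<integral>\<^sup>+t. ?f t \<partial>lborel)"
    by (rule Gamma_conv_nn_integral_real[OF m])
  also have "\<dots> = ennreal \<bar>l\<bar> * (\<integral>\<^sup>+u. ?f (0 + l * u) \<partial>lborel)"
    using l by (intro nn_integral_real_affine) auto
  also have "(\<integral>\<^sup>+u. ?f (0 + l * u) \<partial>lborel)
      = (\<integral>\<^sup>+u. ennreal (l powr (m - 1)) * (ennreal (u powr (m - 1) * exp (- l * u)) * indicator {0<..} u) \<partial>lborel)"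
    using AE_lborel_singleton[of 0]
    by (intro nn_integral_cong_AE, eventually_elim)
       (use l in \<open>auto simp: indicator_def powr_mult exp_minus divide_inverse ennreal_mult'[symmetric] zero_le_mult_iff mult_ac\<close>)
  also have "\<dots> = ennreal (l powr (m - 1)) * ?I"
    by (rule nn_integral_cmult) auto
  finally have "ennreal (Gamma m) = ennreal (l powr m) * ?I"
    using l by (simp add: mult.assoc[symmetric] ennreal_mult'[symmetric] powr_mult_base)
  hence "ennreal (l powr (- m)) * ennreal (Gamma m) = ennreal (l powr (- m) * l powr m) * ?I"
    by (simp add: ennreal_mult' mult.assoc)
  hence "?I = ennreal (l powr (- m)) * ennreal (Gamma m)"
    using l by (simp add: powr_add[symmetric])
  also have "\<dots> = ennreal (Gamma m * l powr (- m))"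
    using ennreal_mult'[of "l powr (- m)" "Gamma m"] by (simp add: mult.commute)
  finally show ?thesis .
qed

text \<open>Euler's Beta integral in its half-line form. Expressing
  \<open>(1 + r) powr (- (a + b))\<close> by the scaled Gamma integral and swapping the order leaves
  a Gamma integral in r and then one in u.\<close>

lemma nn_integral_Beta_halfline:
  assumes a: "a > 0" and b: "b > 0"
  shows "(\<integral>\<^sup>+r. ennreal (r powr (a - 1) * (1 + r) powr (- (a + b))) * indicator {0<..} r \<partial>lborel)
       = ennreal (Gamma a * Gamma b / Gamma (a + b))"
proof -
  define m where "m = a + b"
  have m: "m > 0" and Gm: "Gamma m > 0" using a b by (auto simp: m_def)
  let ?I = "\<integral>\<^sup>+r. ennreal (r powr (a - 1) * (1 + r) powr (- m)) * indicator {0<..} r \<partial>lborel"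
  have "ennreal (Gamma m) * ?I
      = (\<integral>\<^sup>+r. ennreal (r powr (a - 1)) * indicator {0<..} r * ennreal (Gamma m * (1 + r) powr (- m)) \<partial>lborel)"
    by (subst nn_integral_cmult[symmetric])
       (use Gm in \<open>auto simp: indicator_def ennreal_mult'[symmetric] mult_ac intro!: nn_integral_cong\<close>)
  also have "\<dots> = (\<integral>\<^sup>+r. ennreal (r powr (a - 1)) * indicator {0<..} r *
      (\<integral>\<^sup>+u. ennreal (u powr (m - 1) * exp (- (1 + r) * u)) * indicator {0<..} u \<partial>lborel) \<partial>lborel)"
  proof (intro nn_integral_cong)
    fix r :: real
    show "ennreal (r powr (a - 1)) * indicator {0<..} r * ennreal (Gamma m * (1 + r) powr (- m))
      = ennreal (r powr (a - 1)) * indicator {0<..} r *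
      (\<integral>\<^sup>+u. ennreal (u powr (m - 1) * exp (- (1 + r) * u)) * indicator {0<..} u \<partial>lborel)"
    proof (cases "r > 0")
      case True
      hence "1 + r > 0" by simp
      thus ?thesis by (simp only: nn_integral_Gamma_scaled[OF m])
    qed simp
  qed
  also have "\<dots> = (\<integral>\<^sup>+r. (\<integral>\<^sup>+u. ennreal (r powr (a - 1)) * indicator {0<..} r *
      (ennreal (u powr (m - 1) * exp (- (1 + r) * u)) * indicator {0<..} u) \<partial>lborel) \<partial>lborel)"
    by (subst nn_integral_cmult) auto
  also have "\<dots> = (\<integral>\<^sup>+u. (\<integral>\<^sup>+r. ennreal (r powr (a - 1)) * indicator {0<..} r *
      (ennreal (u powr (m - 1) * exp (- (1 + r) * u)) * indicator {0<..} u) \<partial>lborel) \<partial>lborel)"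
    by (rule lborel_pair.Fubini') measurable
  also have "\<dots> = (\<integral>\<^sup>+u. ennreal (u powr (m - 1) * exp (- u)) * indicator {0<..} u *
      (\<integral>\<^sup>+r. ennreal (r powr (a - 1) * exp (- u * r)) * indicator {0<..} r \<partial>lborel) \<partial>lborel)"
    by (subst nn_integral_cmult[symmetric])
       (auto simp: indicator_def ennreal_mult'[symmetric] exp_add[symmetric] algebra_simps
             intro!: nn_integral_cong arg_cong[of _ _ ennreal])
  also have "\<dots> = (\<integral>\<^sup>+u. ennreal (Gamma a) * (ennreal (u powr (b - 1) * exp (- 1 * u)) * indicator {0<..} u) \<partial>lborel)"
  proof (intro nn_integral_cong)
    fix u :: real
    show "ennreal (u powr (m - 1) * exp (- u)) * indicator {0<..} u *
      (\<integral>\<^sup>+r. ennreal (r powr (a - 1) * exp (- u * r)) * indicator {0<..} r \<partial>lborel)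
      = ennreal (Gamma a) * (ennreal (u powr (b - 1) * exp (- 1 * u)) * indicator {0<..} u)"
    proof (cases "u > 0")
      case True
      have "u powr (m - 1) * u powr (- a) = u powr (b - 1)"
        by (simp add: powr_add[symmetric] m_def)
      moreover note nn_integral_Gamma_scaled[OF a True]
      ultimately show ?thesis using True a
        by (simp only:) (simp add: ennreal_mult'[symmetric] mult_ac)
    qed simp
  qed
  also have "\<dots> = ennreal (Gamma a) * ennreal (Gamma b)"
    using nn_integral_Gamma_scaled[OF b, of 1] by (subst nn_integral_cmult) auto
  also have "\<dots> = ennreal (Gamma a * Gamma b)"
    using a b by (intro ennreal_mult[symmetric]) auto
  finally have "ennreal (Gamma m) * ?I = ennreal (Gamma a * Gamma b)" .
  hence "ennreal (1 / Gamma m) * (ennreal (Gamma m) * ?I) = ennreal (1 / Gamma m) * ennreal (Gamma a * Gamma b)"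
    by simp
  thus ?thesis using Gm a b unfolding m_def[symmetric]
    by (simp add: mult.assoc[symmetric] ennreal_mult'[symmetric])
qed

section \<open>Increments and Taylor remainders of powers\<close>

lemma abs_powr_increment:
  fixes p s :: real
  assumes "s \<ge> 0"
  shows "\<bar>(1 + s) powr p - 1\<bar> = sgn p * ((1 + s) powr p - 1)"
proof (cases "p \<ge> 0")
  case True
  hence "1 \<le> (1 + s) powr p" using assms by (intro ge_one_powr_ge_zero) auto
  thus ?thesis using True assms by (cases "p = 0") (auto simp: sgn_if)
next
  case False
  hence "(1 + s) powr p \<le> (1 + s) powr 0" using assms by (intro powr_mono) auto
  thus ?thesis using False assms by (auto simp: sgn_if)
qed

text \<open>Writing the increment as an integral of its derivative and swapping the order turns
  \<open>s powr (- \<alpha>)\<close> into its tail integral, of order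
  \<open>r powr (1 - \<alpha>)\<close>. What remains is a Beta integral; it converges at 0 because
  \<alpha> < 2 and at infinity because p < \<alpha> - 1.\<close>

lemma nn_integral_powr_increment_tail:
  fixes p \<alpha> :: real
  assumes \<alpha>: "1 < \<alpha>" "\<alpha> < 2" and p: "p < \<alpha> - 1"
  shows "(\<integral>\<^sup>+s. ennreal (\<bar>(1 + s) powr p - 1\<bar> * s powr (- \<alpha>)) * indicator {0<..} s \<partial>lborel)
       = ennreal (\<bar>p\<bar> / (\<alpha> - 1) * (Gamma (2 - \<alpha>) * Gamma (\<alpha> - 1 - p) / Gamma (1 - p)))"
proof -
  let ?g = "\<lambda>r. ennreal (\<bar>p\<bar> * (1 + r) powr (p - 1))"
  have inner: "(\<integral>\<^sup>+r. ?g r * indicator {0<..<s} r \<partial>lborel) = ennreal (\<bar>(1 + s) powr p - 1\<bar>)" if "s > 0" for s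
  proof -
    have "(\<integral>\<^sup>+r. ?g r * indicator {0<..<s} r \<partial>lborel) = ennreal (sgn p * (1 + s) powr p - sgn p * (1 + 0) powr p)"
      using that by (intro nn_integral_FTC_Ioo) (auto intro!: derivative_eq_intros simp: abs_if sgn_if)
    also have "sgn p * (1 + s) powr p - sgn p * (1 + 0) powr p = sgn p * ((1 + s) powr p - 1)"
      by (simp add: algebra_simps)
    also have "\<dots> = \<bar>(1 + s) powr p - 1\<bar>"
      using that by (intro abs_powr_increment[symmetric]) auto
    finally show ?thesis .
  qed
  have "(\<integral>\<^sup>+s. ennreal (\<bar>(1 + s) powr p - 1\<bar> * s powr (- \<alpha>)) * indicator {0<..} s \<partial>lborel)
      = (\<integral>\<^sup>+s. ennreal (s powr (- \<alpha>)) * indicator {0<..} s * (\<integral>\<^sup>+r. ?g r * indicator {0<..<s} r \<partial>lborel) \<partial>lborel)"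
  proof (intro nn_integral_cong)
    fix s :: real
    show "ennreal (\<bar>(1 + s) powr p - 1\<bar> * s powr (- \<alpha>)) * indicator {0<..} s
      = ennreal (s powr (- \<alpha>)) * indicator {0<..} s * (\<integral>\<^sup>+r. ?g r * indicator {0<..<s} r \<partial>lborel)"
      by (cases "s > 0") (simp_all only: inner, simp_all add: ennreal_mult'[symmetric] mult_ac)
  qed
  also have "\<dots> = (\<integral>\<^sup>+r. ?g r * indicator {0<..} r *
      (\<integral>\<^sup>+s. ennreal (s powr (- \<alpha>)) * indicator {0<..} s * indicator {r<..} s \<partial>lborel) \<partial>lborel)"
    by (rule layer_cake) (auto intro: sigma_finite_lborel)
  \<comment> \<open>The exponents are arranged to exhibit the Beta parameters 2 - \<alpha> and
    \<alpha> - 1 - p, whose sum is 1 - p.\<close>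
  also have "\<dots> = (\<integral>\<^sup>+r. ennreal (\<bar>p\<bar> / (\<alpha> - 1)) *
      (ennreal (r powr ((2 - \<alpha>) - 1) * (1 + r) powr (- ((2 - \<alpha>) + (\<alpha> - 1 - p)))) * indicator {0<..} r) \<partial>lborel)"
  proof (intro nn_integral_cong)
    fix r :: real
    show "?g r * indicator {0<..} r * (\<integral>\<^sup>+s. ennreal (s powr (- \<alpha>)) * indicator {0<..} s * indicator {r<..} s \<partial>lborel)
      = ennreal (\<bar>p\<bar> / (\<alpha> - 1)) *
      (ennreal (r powr ((2 - \<alpha>) - 1) * (1 + r) powr (- ((2 - \<alpha>) + (\<alpha> - 1 - p)))) * indicator {0<..} r)"
    proof (cases "r > 0")
      case True
      have "(\<integral>\<^sup>+s. ennreal (s powr (- \<alpha>)) * indicator {0<..} s * indicator {r<..} s \<partial>lborel)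
         = (\<integral>\<^sup>+s. ennreal (s powr (- \<alpha>)) * indicator {r<..} s \<partial>lborel)"
        using True by (intro nn_integral_cong) (auto simp: indicator_def)
      also have "\<dots> = ennreal (r powr (1 - \<alpha>) / (\<alpha> - 1))"
        using nn_integral_powr_Ioi[of "- \<alpha>" r] \<alpha> True by simp
      finally show ?thesis using True \<alpha> by (simp add: ennreal_mult'[symmetric] mult_ac)
    qed simp
  qed
  also have "\<dots> = ennreal (\<bar>p\<bar> / (\<alpha> - 1)) * ennreal (Gamma (2 - \<alpha>) * Gamma (\<alpha> - 1 - p) / Gamma ((2 - \<alpha>) + (\<alpha> - 1 - p)))"
    using \<alpha> p nn_integral_Beta_halfline[of "2 - \<alpha>" "\<alpha> - 1 - p"] by (subst nn_integral_cmult) auto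
  finally show ?thesis using \<alpha> by (simp add: ennreal_mult'[symmetric])
qed

text \<open>For \<bar>t\<bar> \<le> 1/2 the remainder is quadratic, and \<eta> \<le> 2 weakens it to
  order \<eta>. For larger \<bar>t\<bar> each of the three terms is at most a multiple of
  \<open>\<bar>t\<bar> powr \<eta>\<close>, since \<nu> \<le> \<eta> and 1 \<le> \<eta>. This allows
  a Taylor expansion although increments have no second moment.\<close>

lemma powr_first_order_remainder:
  fixes \<nu> \<eta> t :: real
  assumes \<nu>: "0 < \<nu>" "\<nu> \<le> \<eta>" and \<eta>: "1 \<le> \<eta>" "\<eta> \<le> 2" and t: "t \<ge> -1"
  shows "\<bar>(1 + t) powr \<nu> - 1 - \<nu> * t\<bar> \<le> 28 * \<bar>t\<bar> powr \<eta>"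
proof (cases "\<bar>t\<bar> \<le> 1 / 2")
  case True
  define B where "B = {-\<bar>t\<bar>..\<bar>t\<bar>}"
  have conv: "convex B" and mem: "t \<in> B" "0 \<in> B" and B: "s \<in> B \<Longrightarrow> \<bar>s\<bar> \<le> \<bar>t\<bar>" for s
    by (auto simp: B_def)
  \<comment> \<open>On B the argument 1 + s stays above 1/2, so the derivative of
    \<open>(1 + s) powr (\<nu> - 1)\<close> is at most 4 in size; the factor \<nu> \<le> 2 gives
    8.\<close>
  have slope: "\<bar>\<nu> * ((1 + s) powr (\<nu> - 1) - 1)\<bar> \<le> 8 * \<bar>t\<bar>" if s: "s \<in> B" for s
  proof -
    have "norm ((1 + s) powr (\<nu> - 1) - (1 + 0) powr (\<nu> - 1)) \<le> 4 * norm (s - 0)"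
    proof (rule field_differentiable_bound[OF conv _ _ s mem(2)])
      fix z assume z: "z \<in> B"
      hence z1: "1 / 2 \<le> 1 + z" using B[OF z] True by auto
      thus "((\<lambda>s. (1 + s) powr (\<nu> - 1)) has_field_derivative (\<nu> - 1) * (1 + z) powr (\<nu> - 2)) (at z within B)"
        by (auto intro!: derivative_eq_intros)
      have "\<bar>\<nu> - 1\<bar> * (1 + z) powr (\<nu> - 2) \<le> 1 * (1 / 2) powr (\<nu> - 2)"
        using z1 \<nu> \<eta> by (intro mult_mono powr_mono2') auto
      also have "(1 / 2) powr (\<nu> - 2) \<le> (1 / 2) powr (- 2 :: real)"
        using \<nu> by (intro powr_mono') auto
      also have "\<dots> = (4::real)" by (simp add: powr_minus powr_divide)
      finally show "norm ((\<nu> - 1) * (1 + z) powr (\<nu> - 2)) \<le> 4" by (simp add: abs_mult)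
    qed
    hence "\<bar>(1 + s) powr (\<nu> - 1) - 1\<bar> \<le> 4 * \<bar>t\<bar>" using B[OF s] by simp
    hence "\<bar>\<nu>\<bar> * \<bar>(1 + s) powr (\<nu> - 1) - 1\<bar> \<le> 2 * (4 * \<bar>t\<bar>)"
      using \<nu> \<eta> by (intro mult_mono) auto
    thus ?thesis by (simp add: abs_mult)
  qed
  have "norm (((1 + t) powr \<nu> - 1 - \<nu> * t) - ((1 + 0) powr \<nu> - 1 - \<nu> * 0)) \<le> 8 * \<bar>t\<bar> * norm (t - 0)"
  proof (rule field_differentiable_bound[OF conv _ _ mem])
    fix z assume z: "z \<in> B"
    hence "1 / 2 \<le> 1 + z" using B[OF z] True by auto
    thus "((\<lambda>t. (1 + t) powr \<nu> - 1 - \<nu> * t) has_field_derivative \<nu> * ((1 + z) powr (\<nu> - 1) - 1)) (at z within B)"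
      by (auto intro!: derivative_eq_intros simp: algebra_simps)
    show "norm (\<nu> * ((1 + z) powr (\<nu> - 1) - 1)) \<le> 8 * \<bar>t\<bar>" using slope[OF z] by simp
  qed
  hence "\<bar>(1 + t) powr \<nu> - 1 - \<nu> * t\<bar> \<le> 8 * \<bar>t\<bar> powr 2"
    by (simp add: power2_eq_square)
  also have "\<dots> \<le> 8 * \<bar>t\<bar> powr \<eta>"
    using True \<eta> by (intro mult_left_mono powr_mono') auto
  also have "\<dots> \<le> 28 * \<bar>t\<bar> powr \<eta>" by simp
  finally show ?thesis .
next
  case False
  \<comment> \<open>Doubling makes T at least 1, so lower powers of T are absorbed by
    \<open>T powr \<eta>\<close>. The three terms contribute 4 + 1 + 2 = 7, and undoing the doubling
    costs at most 4, whence 28.\<close>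
  define T where "T = 2 * \<bar>t\<bar>"
  have T: "T \<ge> 1" using False by (simp add: T_def)
  have "(1 + t) powr \<nu> \<le> (2 * T) powr \<nu>"
    using t \<nu> False by (intro powr_mono2) (auto simp: T_def)
  also have "\<dots> = 2 powr \<nu> * T powr \<nu>" using T by (simp add: powr_mult)
  also have "\<dots> \<le> 2 powr 2 * T powr \<eta>"
    using T \<nu> \<eta> by (intro mult_mono powr_mono) auto
  finally have 1: "(1 + t) powr \<nu> \<le> 4 * T powr \<eta>" by simp
  have 2: "1 \<le> T powr \<eta>" using T \<eta> by (intro ge_one_powr_ge_zero) auto
  have "T powr 1 \<le> T powr \<eta>" using T \<eta> by (intro powr_mono) auto
  hence "\<bar>\<nu> * t\<bar> \<le> 2 * T powr \<eta>"
    using T \<nu> \<eta> mult_mono[of \<nu> 2 "\<bar>t\<bar>" "T powr \<eta>"] by (auto simp: T_def abs_mult)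
  hence "\<bar>(1 + t) powr \<nu> - 1 - \<nu> * t\<bar> \<le> 7 * T powr \<eta>"
    using 1 2 powr_ge_zero[of "1 + t" \<nu>] by (simp only: abs_le_iff) linarith
  also have "T powr \<eta> = 2 powr \<eta> * \<bar>t\<bar> powr \<eta>" by (simp add: T_def powr_mult)
  also have "7 * (2 powr \<eta> * \<bar>t\<bar> powr \<eta>) \<le> 7 * (2 powr 2 * \<bar>t\<bar> powr \<eta>)"
    using \<eta> by (intro mult_left_mono mult_right_mono powr_mono) auto
  finally show ?thesis by simp
qed

lemma powr_le_one_plus_powr:
  fixes u \<eta> \<beta> :: real
  assumes "0 \<le> u" "0 \<le> \<eta>" "\<eta> \<le> \<beta>"
  shows "u powr \<eta> \<le> 1 + u powr \<beta>"
proof (cases "u \<le> 1")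
  case True
  hence "u powr \<eta> \<le> 1 powr \<eta>" using assms by (intro powr_mono2) auto
  moreover have "0 \<le> u powr \<beta>" by (rule powr_ge_zero)
  ultimately show ?thesis unfolding powr_one_eq_one by linarith
next
  case False
  hence "u powr \<eta> \<le> u powr \<beta>" using assms by (intro powr_mono) auto
  thus ?thesis by simp
qed

text \<open>The function z / y is capped at 1 so that it can serve as a bound for the probability of
  falling to z. As long as y has not dropped below x / 2 this is Taylor's formula for 1 / y; after a
  larger drop the left side is still at most 1, which the error term exceeds because
  \<open>4 * (1/2) powr 2\<close> is 1.\<close>

lemma inverse_first_order_upper:
  fixes x y z \<eta> :: real
  assumes z: "0 < z" "z < x" and y: "y \<ge> 0" and \<eta>: "1 \<le> \<eta>" "\<eta> \<le> 2"
  shows "(if y > z then z / y else 1) \<le> z / x - z / x * ((y - x) / x) + 4 * \<bar>(y - x) / x\<bar> powr \<eta>"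
proof -
  define t u where "t = (y - x) / x" and "u = z / x"
  have x: "x > 0" using z by simp
  have u: "0 < u" "u < 1" using z by (auto simp: u_def)
  have t1: "1 + t = y / x" using x by (simp add: t_def field_simps)
  have "(if y > z then z / y else 1) \<le> u - u * t + 4 * \<bar>t\<bar> powr \<eta>"
  proof (cases "t \<ge> -1/2")
    case True
    hence y0: "y > 0" using t1 x by (auto simp: t_def field_simps)
    have "(if y > z then z / y else 1) \<le> z / y" using y0 by auto
    also have "z / y = u / (1 + t)" using x y0 t1 by (simp add: u_def)
    also have "u / (1 + t) = u - u * t + u * (t\<^sup>2 / (1 + t))"
      using True by (simp add: field_simps power2_eq_square)
    also have "t\<^sup>2 / (1 + t) \<le> 4 * \<bar>t\<bar> powr \<eta>"
    proof (cases "\<bar>t\<bar> \<le> 1")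
      case t: True
      have "t\<^sup>2 / (1 + t) \<le> t\<^sup>2 / (1 / 2)" using True by (intro divide_left_mono) auto
      also have "\<dots> = 2 * \<bar>t\<bar> powr 2" by simp
      also have "\<dots> \<le> 2 * \<bar>t\<bar> powr \<eta>" using t \<eta> by (intro mult_left_mono powr_mono') auto
      also have "\<dots> \<le> 4 * \<bar>t\<bar> powr \<eta>" by simp
      finally show ?thesis .
    next
      case t: False
      hence "t > 1" using True by auto
      hence "t\<^sup>2 / (1 + t) \<le> t" by (simp add: field_simps power2_eq_square)
      also have "t = \<bar>t\<bar> powr 1" using \<open>t > 1\<close> by simp
      also have "\<dots> \<le> \<bar>t\<bar> powr \<eta>" using \<open>t > 1\<close> \<eta> by (intro powr_mono) auto
      also have "\<dots> \<le> 4 * \<bar>t\<bar> powr \<eta>" by simp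
      finally show ?thesis .
    qed
    hence "u * (t\<^sup>2 / (1 + t)) \<le> 1 * (4 * \<bar>t\<bar> powr \<eta>)"
      using u True by (intro mult_mono) auto
    finally show ?thesis by simp
  next
    case False
    have "1 = 4 * (1 / 2) powr (2::real)" by (simp add: power2_eq_square)
    also have "\<dots> \<le> 4 * \<bar>t\<bar> powr 2" using False by (intro mult_left_mono powr_mono2) auto
    also have "\<bar>t\<bar> powr 2 \<le> \<bar>t\<bar> powr \<eta>"
    proof (rule powr_mono')
      show "\<bar>t\<bar> \<le> 1" using t1 divide_nonneg_nonneg[of y x] y x False by linarith
    qed (use \<eta> in auto)
    finally have "1 \<le> 4 * \<bar>t\<bar> powr \<eta>" by simp
    moreover have "u - u * t \<ge> 0" using u False by (simp add: mult_pos_neg less_imp_le)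
    moreover have "(if y > z then z / y else 1) \<le> 1" using z by auto
    ultimately show ?thesis by linarith
  qed
  thus ?thesis by (simp add: t_def u_def)
qed

lemma power_expansion:
  fixes x y \<nu> :: real
  assumes "x > 0" "y \<ge> 0"
  shows "y powr \<nu> - x powr \<nu> - \<nu> * x powr (\<nu> - 1) * (y - x)
    = x powr \<nu> * ((1 + (y - x) / x) powr \<nu> - 1 - \<nu> * ((y - x) / x))"
proof -
  have "y = x * (1 + (y - x) / x)" using assms by (simp add: field_simps)
  moreover have "1 + (y - x) / x \<ge> 0" using assms by (simp add: field_simps)
  ultimately have "y powr \<nu> = x powr \<nu> * (1 + (y - x) / x) powr \<nu>"
    using assms by (metis less_imp_le powr_mult)
  moreover have "x powr (\<nu> - 1) = x powr \<nu> / x"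
    using assms by (simp add: powr_diff)
  ultimately show ?thesis by (simp add: algebra_simps)
qed

lemma abs_powr_increment_le:
  fixes p s :: real
  assumes "-1 \<le> p" "p \<le> 1" "s \<ge> 0"
  shows "\<bar>(1 + s) powr p - 1\<bar> \<le> s"
proof (cases "p \<ge> 0")
  case True
  have "(1 + s) powr p \<le> (1 + s) powr 1" using assms by (intro powr_mono) auto
  moreover have "1 \<le> (1 + s) powr p" using True assms by (intro ge_one_powr_ge_zero) auto
  ultimately show ?thesis using assms by simp
next
  case False
  have "(1 + s) powr p \<le> (1 + s) powr 0" using False assms by (intro powr_mono) auto
  moreover have "(1 + s) powr (-1) \<le> (1 + s) powr p" using assms by (intro powr_mono) auto
  moreover have "(1 + s) powr (-1) = 1 / (1 + s)" using assms by (simp add: powr_minus_divide)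
  moreover have "1 - 1 / (1 + s) \<le> s" using assms by (simp add: field_simps)
  ultimately show ?thesis using assms by simp
qed

text \<open>By Bernoulli's inequality the remainder has the constant sign of \<nu> - 1 for u \<ge>
  0. Factoring that sign out leaves a nonnegative function with an explicit nonnegative derivative,
  to which Tonelli applies without integrability. At \<nu> = 1 both sides vanish.\<close>

lemma power_remainder_nonneg:
  fixes \<nu> u :: real
  assumes \<nu>: "0 < \<nu>" and u: "u \<ge> 0"
  defines "F \<equiv> \<lambda>u. sgn (\<nu> - 1) * ((1 + u) powr \<nu> - 1 - \<nu> * u)"
  shows "F u \<ge> 0"
    and "(\<integral>\<^sup>+s. ennreal (\<nu> * \<bar>(1 + s) powr (\<nu> - 1) - 1\<bar>) * indicator {0<..<u} s \<partial>lborel) = ennreal (F u)"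
    and "(1 + u) powr \<nu> - 1 - \<nu> * u = sgn (\<nu> - 1) * F u"
proof -
  have deriv: "(F has_real_derivative \<nu> * \<bar>(1 + s) powr (\<nu> - 1) - 1\<bar>) (at s)" if "s \<ge> 0" for s
    unfolding abs_powr_increment[OF that] F_def using that
    by (auto intro!: derivative_eq_intros simp: algebra_simps)
  have F0: "F 0 = 0" by (simp add: F_def)
  have "F 0 \<le> F u"
    using deriv \<nu> by (intro DERIV_nonneg_imp_nondecreasing[OF u]) (meson abs_ge_zero less_imp_le mult_nonneg_nonneg)
  thus "F u \<ge> 0" by (simp add: F0)
  show "(\<integral>\<^sup>+s. ennreal (\<nu> * \<bar>(1 + s) powr (\<nu> - 1) - 1\<bar>) * indicator {0<..<u} s \<partial>lborel) = ennreal (F u)"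
    using nn_integral_FTC_Ioo[OF u, of F "\<lambda>s. \<nu> * \<bar>(1 + s) powr (\<nu> - 1) - 1\<bar>"] deriv \<nu> by (simp add: F0)
  show "(1 + u) powr \<nu> - 1 - \<nu> * u = sgn (\<nu> - 1) * F u"
    using u by (cases "\<nu> = 1") (auto simp: F_def sgn_if)
qed

lemma powr_small:
  fixes s C \<epsilon> :: real
  assumes "s > 0" "\<epsilon> > 0"
  shows "\<exists>X>0. \<forall>x\<ge>X. C * x powr (- s) \<le> \<epsilon>"
proof -
  have "((\<lambda>x. C * x powr (- s)) \<longlongrightarrow> C * 0) at_top"
    using assms by (intro tendsto_mult tendsto_const tendsto_neg_powr filterlim_ident) auto
  hence "eventually (\<lambda>x. C * x powr (- s) < \<epsilon>) at_top"
    using assms by (intro order_tendstoD(2)) auto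
  then obtain X where "\<And>x. x \<ge> X \<Longrightarrow> C * x powr (- s) < \<epsilon>"
    unfolding eventually_at_top_linorder by blast
  thus ?thesis by (intro exI[of _ "max 1 X"]) (auto intro: less_imp_le)
qed

section \<open>The critical exponent\<close>

text \<open>The right side of the equation for \<open>\<nu>\<^sup>\<star>\<close> without the factor
  Gamma (1 - \<alpha>), which is a negative constant. The remaining function is increasing in
  \<nu>.\<close>

definition nu_gamma :: "real \<Rightarrow> real \<Rightarrow> real" where
  "nu_gamma \<alpha> \<nu> = (\<nu> - 1) * (Gamma (\<alpha> - \<nu>) / Gamma (2 - \<nu>))"

text \<open>The logarithmic derivative of the ratio in \<nu> is a difference of two Digamma values
  at positive arguments, and Digamma is increasing there.\<close>

lemma Gamma_ratio_strict_mono: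
  fixes p q u v :: real
  assumes "u < v" "v < p" "p < q"
  shows "Gamma (p - u) / Gamma (q - u) < Gamma (p - v) / Gamma (q - v)"
proof -
  let ?f = "\<lambda>\<nu>. ln_Gamma (p - \<nu>) - ln_Gamma (q - \<nu>) :: real"
  have "?f u < ?f v"
  proof (rule DERIV_pos_imp_increasing[OF \<open>u < v\<close>])
    fix x assume x: "u \<le> x" "x \<le> v"
    have "(?f has_field_derivative (Digamma (p - x) * (0 - 1) - Digamma (q - x) * (0 - 1))) (at x)"
      using x assms by (auto intro!: derivative_eq_intros)
    moreover have "Digamma (p - x) < Digamma (q - x)"
      using x assms by (intro Digamma_real_strict_mono) auto
    ultimately show "\<exists>y. (?f has_real_derivative y) (at x) \<and> 0 < y"
      by (intro exI[of _ "Digamma (p - x) * (0 - 1) - Digamma (q - x) * (0 - 1)"]) auto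
  qed
  hence "exp (?f u) < exp (?f v)" by simp
  moreover have "exp (?f x) = Gamma (p - x) / Gamma (q - x)" if "x \<le> v" for x
    using that assms by (simp add: exp_diff ln_Gamma_real_pos)
  ultimately show ?thesis using assms by simp
qed

text \<open>For \<nu> < 1 the product in the definition has a negative increasing and a positive
  increasing factor, so its monotonicity is not visible. The recursion for Gamma absorbs the first
  factor and leaves minus the reciprocal of an increasing Gamma ratio.\<close>

lemma nu_gamma_less_1:
  assumes "\<nu> < 1"
  shows "nu_gamma \<alpha> \<nu> = - (Gamma (\<alpha> - \<nu>) / Gamma (1 - \<nu>))"
proof -
  have "Gamma (2 - \<nu>) = (1 - \<nu>) * Gamma (1 - \<nu>)"
    using Gamma_plus1[of "1 - \<nu>"] assms nonpos_Ints_nonpos[of "1 - \<nu>"] by fastforce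
  hence eq: "nu_gamma \<alpha> \<nu> = - (1 - \<nu>) * (Gamma (\<alpha> - \<nu>) / ((1 - \<nu>) * Gamma (1 - \<nu>)))"
    by (simp add: nu_gamma_def)
  note eq
  also have "- (1 - \<nu>) * (Gamma (\<alpha> - \<nu>) / ((1 - \<nu>) * Gamma (1 - \<nu>))) = - (Gamma (\<alpha> - \<nu>) / Gamma (1 - \<nu>))"
    using assms by (subst times_divide_eq_right, subst minus_mult_left[symmetric]) simp
  finally show ?thesis .
qed

text \<open>The function is negative below 1, zero at 1 and positive above, so points on different
  sides compare at once. Below 1 the form without the factor \<nu> - 1 is used; above 1 both factors
  are positive and increasing.\<close>

lemma nu_gamma_strict_mono:
  assumes \<alpha>: "1 < \<alpha>" "\<alpha> < 2" and uv: "u < v" "v < \<alpha>"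
  shows "nu_gamma \<alpha> u < nu_gamma \<alpha> v"
proof -
  have neg: "nu_gamma \<alpha> x < 0" if "x < 1" for x
    using that \<alpha> by (simp add: nu_gamma_less_1)
  have pos: "nu_gamma \<alpha> x > 0" if "x > 1" "x < \<alpha>" for x
    using that \<alpha> by (simp add: nu_gamma_def)
  have one: "nu_gamma \<alpha> 1 = 0" by (simp add: nu_gamma_def)
  consider "v < 1" | "u < 1" "v \<ge> 1" | "u = 1" | "u > 1" by linarith
  thus ?thesis
  proof cases
    case 1
    have "Gamma (1 - u) / Gamma (\<alpha> - u) < Gamma (1 - v) / Gamma (\<alpha> - v)"
      using 1 uv \<alpha> by (intro Gamma_ratio_strict_mono) auto
    moreover have "Gamma (1 - u) > 0" "Gamma (1 - v) > 0" "Gamma (\<alpha> - u) > 0" "Gamma (\<alpha> - v) > 0"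
      using 1 uv \<alpha> by auto
    ultimately have "Gamma (\<alpha> - v) / Gamma (1 - v) < Gamma (\<alpha> - u) / Gamma (1 - u)"
      by (simp add: field_simps)
    thus ?thesis using 1 uv by (simp add: nu_gamma_less_1)
  next
    case 2
    thus ?thesis using neg[of u] pos[of v] one uv by (cases "v = 1") auto
  next
    case 3
    thus ?thesis using pos[of v] one uv by auto
  next
    case 4
    have "Gamma (\<alpha> - u) / Gamma (2 - u) < Gamma (\<alpha> - v) / Gamma (2 - v)"
      using uv \<alpha> by (intro Gamma_ratio_strict_mono) auto
    moreover have "Gamma (\<alpha> - u) / Gamma (2 - u) > 0" using uv \<alpha> by auto
    ultimately show ?thesis unfolding nu_gamma_def
      using 4 uv by (intro mult_strict_mono) auto
  qed
qed

lemma Gamma_one_minus_neg: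
  assumes "1 < \<alpha>" "\<alpha> < (2::real)"
  shows "Gamma (1 - \<alpha>) < 0" and "Gamma (2 - \<alpha>) = (1 - \<alpha>) * Gamma (1 - \<alpha>)"
proof -
  have "1 - \<alpha> \<notin> \<int>\<^sub>\<le>\<^sub>0"
  proof
    assume "1 - \<alpha> \<in> \<int>\<^sub>\<le>\<^sub>0"
    then obtain n where n: "1 - \<alpha> = real_of_int n" by (auto elim!: nonpos_Ints_cases)
    hence "-1 < n" "n < 0" using assms by linarith+
    thus False by simp
  qed
  from Gamma_plus1[OF this] show *: "Gamma (2 - \<alpha>) = (1 - \<alpha>) * Gamma (1 - \<alpha>)" by simp
  have "Gamma (2 - \<alpha>) > 0" using assms by simp
  thus "Gamma (1 - \<alpha>) < 0" using assms unfolding * by (simp add: zero_less_mult_iff)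
qed

lemma Gamma_reflection_real: "Gamma (x::real) * Gamma (1 - x) = pi / sin (pi * x)"
proof -
  have "complex_of_real (Gamma x * Gamma (1 - x)) = Gamma (of_real x) * Gamma (of_real (1 - x))"
    by (simp only: Gamma_complex_of_real of_real_mult)
  also have "\<dots> = Gamma (of_real x) * Gamma (1 - of_real x)"
    by (simp only: of_real_diff of_real_1)
  also have "\<dots> = of_real pi / sin (of_real pi * of_real x)"
    by (rule Gamma_reflection_complex)
  also have "\<dots> = of_real (pi / sin (pi * x))"
    by (simp only: of_real_divide sin_of_real[symmetric] of_real_mult)
  finally show ?thesis by (simp only: of_real_eq_iff)
qed

text \<open>Identifies the threshold for b / c in the critical case: it is the value at \<nu> = 0 of
  the right side of the equation for \<open>\<nu>\<^sup>\<star>\<close>. The absolute value enters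
  because sin (pi \<alpha>) is negative for 1 < \<alpha> < 2.\<close>

lemma Gamma_reflection_csc:
  assumes "1 < \<alpha>" "\<alpha> < (2::real)"
  shows "Gamma (1 - \<alpha>) * nu_gamma \<alpha> 0 = pi * \<bar>1 / sin (pi * \<alpha>)\<bar>"
proof -
  have eq: "Gamma \<alpha> * Gamma (1 - \<alpha>) = pi / sin (pi * \<alpha>)" by (rule Gamma_reflection_real)
  have "Gamma \<alpha> * Gamma (1 - \<alpha>) < 0"
    using Gamma_one_minus_neg[OF assms] assms by (intro mult_pos_neg) auto
  hence "sin (pi * \<alpha>) < 0" unfolding eq by (simp add: divide_less_0_iff)
  thus ?thesis using eq by (simp add: nu_gamma_def mult.commute abs_of_neg Gamma_numeral)
qed

lemma nu_star_eq_iff: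
  "nu_star_eq \<alpha> b c \<nu> \<longleftrightarrow> 0 < \<nu> \<and> \<nu> < \<alpha> \<and> b / c = Gamma (1 - \<alpha>) * nu_gamma \<alpha> \<nu>"
  by (simp add: nu_star_eq_def nu_gamma_def mult_ac)

lemma isCont_nu_gamma:
  assumes "\<nu> < \<alpha>" "\<nu> < 2"
  shows "isCont (nu_gamma \<alpha>) \<nu>"
proof -
  have "Gamma (2 - \<nu>) \<noteq> 0" using assms Gamma_real_pos[of "2 - \<nu>"] by linarith
  moreover have "2 - \<nu> \<notin> \<int>\<^sub>\<le>\<^sub>0" "\<alpha> - \<nu> \<notin> \<int>\<^sub>\<le>\<^sub>0"
    using assms nonpos_Ints_nonpos[of "2 - \<nu>"] nonpos_Ints_nonpos[of "\<alpha> - \<nu>"] by linarith+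
  ultimately show ?thesis unfolding nu_gamma_def[abs_def] isCont_def
    by (intro tendsto_intros)
qed

text \<open>Dividing by the negative Gamma (1 - \<alpha>) reverses the order, so the threshold
  condition says that \<open>nu_gamma \<alpha>\<close> starts below the target at 0. It increases to
  infinity at \<alpha>, so the target is attained exactly once.\<close>

lemma ex1_nu_star:
  assumes \<alpha>: "1 < \<alpha>" "\<alpha> < 2" and c: "c > 0" and b: "b < c * pi * \<bar>1 / sin (pi * \<alpha>)\<bar>"
  shows "\<exists>!\<nu>. nu_star_eq \<alpha> b c \<nu>"
proof -
  define r where "r = b / c"
  define y where "y = r / Gamma (1 - \<alpha>)"
  note G = Gamma_one_minus_neg[OF \<alpha>]
  have iff: "nu_star_eq \<alpha> b c \<nu> \<longleftrightarrow> 0 < \<nu> \<and> \<nu> < \<alpha> \<and> nu_gamma \<alpha> \<nu> = y" for \<nu>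
    using G(1) by (auto simp: nu_star_eq_iff y_def r_def[symmetric])
  have "r < pi * \<bar>1 / sin (pi * \<alpha>)\<bar>"
    using b c by (simp add: r_def pos_divide_less_eq mult_ac)
  hence "r < nu_gamma \<alpha> 0 * Gamma (1 - \<alpha>)"
    using Gamma_reflection_csc[OF \<alpha>] by (simp add: mult.commute)
  hence y0: "nu_gamma \<alpha> 0 < y" using neg_less_divide_eq[OF G(1)] by (simp add: y_def)
  have cont: "isCont (nu_gamma \<alpha>) \<nu>" if "\<nu> < \<alpha>" for \<nu>
    by (rule isCont_nu_gamma) (use that \<alpha> in auto)
  have "filterlim (nu_gamma \<alpha>) at_top (at_left \<alpha>)"
  proof -
    \<comment> \<open>The pole at \<nu> = \<alpha> is isolated by Gamma (\<alpha> - \<nu> + 1) =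
      (\<alpha> - \<nu>) Gamma (\<alpha> - \<nu>); the factor left over has a positive
      limit.\<close>
    have lim1: "((\<lambda>\<nu>. (\<nu> - 1) * (Gamma (\<alpha> - \<nu> + 1) / Gamma (2 - \<nu>))) \<longlongrightarrow> (\<alpha> - 1) * (Gamma (\<alpha> - \<alpha> + 1) / Gamma (2 - \<alpha>))) (at_left \<alpha>)"
      using \<alpha> by (intro tendsto_intros) (auto dest: nonpos_Ints_nonpos simp: Gamma_eq_zero_iff)
    have "filterlim (\<lambda>\<nu>. \<alpha> - \<nu>) (at_right 0) (at_left \<alpha>)"
      unfolding filterlim_at
      by (auto intro!: tendsto_eq_intros eventually_at_leftI[of "\<alpha> - 1"])
    hence lim2: "filterlim (\<lambda>\<nu>. inverse (\<alpha> - \<nu>)) at_top (at_left \<alpha>)"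
      by (intro filterlim_compose[OF filterlim_inverse_at_top_right])
    have "filterlim (\<lambda>\<nu>. (\<nu> - 1) * (Gamma (\<alpha> - \<nu> + 1) / Gamma (2 - \<nu>)) * inverse (\<alpha> - \<nu>)) at_top (at_left \<alpha>)"
      using \<alpha> by (intro filterlim_tendsto_pos_mult_at_top[OF lim1 _ lim2]) auto
    moreover have "eventually (\<lambda>\<nu>. (\<nu> - 1) * (Gamma (\<alpha> - \<nu> + 1) / Gamma (2 - \<nu>)) * inverse (\<alpha> - \<nu>) = nu_gamma \<alpha> \<nu>) (at_left \<alpha>)"
    proof (rule eventually_at_leftI[of "\<alpha> - 1"])
      fix \<nu> assume "\<nu> \<in> {\<alpha> - 1<..<\<alpha>}"
      hence "\<alpha> - \<nu> > 0" by simp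
      hence "Gamma (\<alpha> - \<nu> + 1) = (\<alpha> - \<nu>) * Gamma (\<alpha> - \<nu>)"
        by (intro Gamma_plus1) (auto dest: nonpos_Ints_nonpos)
      thus "(\<nu> - 1) * (Gamma (\<alpha> - \<nu> + 1) / Gamma (2 - \<nu>)) * inverse (\<alpha> - \<nu>) = nu_gamma \<alpha> \<nu>"
        using \<open>\<alpha> - \<nu> > 0\<close> by (simp add: nu_gamma_def)
    qed simp
    ultimately show ?thesis by (rule filterlim_cong[OF refl refl, THEN iffD1, rotated])
  qed
  hence "eventually (\<lambda>\<nu>. nu_gamma \<alpha> \<nu> > y) (at_left \<alpha>)"
    unfolding filterlim_at_top_dense by (rule spec)
  moreover have "eventually (\<lambda>\<nu>. \<nu> \<in> {0<..<\<alpha>}) (at_left \<alpha>)"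
    using \<alpha> by (intro eventually_at_leftI[of 0]) auto
  ultimately have "eventually (\<lambda>\<nu>. nu_gamma \<alpha> \<nu> > y \<and> \<nu> \<in> {0<..<\<alpha>}) (at_left \<alpha>)"
    by eventually_elim auto
  then obtain w where w: "nu_gamma \<alpha> w > y" "0 < w" "w < \<alpha>"
    using eventually_happens'[OF trivial_limit_at_left_real] unfolding greaterThanLessThan_iff by blast
  obtain \<nu> where \<nu>: "0 \<le> \<nu>" "\<nu> \<le> w" "nu_gamma \<alpha> \<nu> = y"
  proof -
    have "\<exists>x. 0 \<le> x \<and> x \<le> w \<and> nu_gamma \<alpha> x = y"
      by (rule IVT) (use y0 w cont in auto)
    thus ?thesis using that by blast
  qed
  have "\<nu> \<noteq> 0" using \<nu> y0 by auto
  hence ex: "nu_star_eq \<alpha> b c \<nu>" using \<nu> w unfolding iff by auto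
  show ?thesis
  proof (rule ex1I[of _ \<nu>], rule ex)
    fix \<nu>' assume "nu_star_eq \<alpha> b c \<nu>'"
    hence "\<nu>' < \<alpha>" "nu_gamma \<alpha> \<nu>' = nu_gamma \<alpha> \<nu>" "\<nu> < \<alpha>"
      using ex unfolding iff by auto
    thus "\<nu>' = \<nu>" using nu_gamma_strict_mono[OF \<alpha>, of \<nu> \<nu>'] nu_gamma_strict_mono[OF \<alpha>, of \<nu>' \<nu>]
      by (cases \<nu> \<nu>' rule: linorder_cases) auto
  qed
qed

section \<open>Drift of power functions under a heavy-tailed kernel\<close>

text \<open>The tail and moment conditions, expressed by the one-step law alone. The drift condition
  is kept apart because the cases use it at different scales.\<close>

locale heavy_kernel = borel_kernel K for K :: "real \<Rightarrow> real measure" +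
  fixes S :: "real set" and \<alpha> \<beta> c x0 :: real
  assumes S_nonneg: "S \<subseteq> {0..}" and S_borel [measurable]: "S \<in> sets borel"
    and K_S: "x \<in> S \<Longrightarrow> emeasure (K x) S = 1"
    and \<alpha>: "1 < \<alpha>" "\<alpha> < 2" and \<beta>: "\<alpha> < \<beta>" and c: "0 < c"
    and tail: "\<epsilon> > 0 \<Longrightarrow> \<exists>Y. \<forall>y\<ge>Y. \<forall>x\<in>S. x \<ge> x0 \<longrightarrow> \<bar>y powr \<alpha> * measure (K x) {x + y<..} - c\<bar> \<le> \<epsilon>"
    and left: "\<exists>C. \<forall>x\<in>S. x \<ge> x0 \<longrightarrow> (\<integral>\<^sup>+y. ennreal (negpart (y - x) powr \<beta>) \<partial>K x) \<le> ennreal C"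
begin

definition mean :: "real \<Rightarrow> real" where
  "mean x = (\<integral>y. (y - x) \<partial>K x)"

abbreviation moment :: "real \<Rightarrow> real \<Rightarrow> real" where
  "moment \<nu> x \<equiv> \<integral>y. y powr \<nu> \<partial>K x"

abbreviation series :: "real \<Rightarrow> real \<Rightarrow> real \<Rightarrow> ennreal" where
  "series a q \<equiv> stay_series K (S \<inter> {a<..}) q"

abbreviation upper :: "real \<Rightarrow> real \<Rightarrow> real" where
  "upper x y \<equiv> measure (K x) {x + y<..}"

abbreviation left_moment :: "real \<Rightarrow> ennreal" where
  "left_moment x \<equiv> \<integral>\<^sup>+y. ennreal (negpart (y - x) powr \<beta>) \<partial>K x"

abbreviation finite_moment :: "real \<Rightarrow> real \<Rightarrow> bool" where
  "finite_moment \<nu> x \<equiv> integrable (K x) (\<lambda>y. y powr \<nu>)"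

section \<open>Uniform moments of the increments\<close>

lemma AE_K: "x \<in> S \<Longrightarrow> AE y in K x. y \<in> S"
  using K_S by (intro KP.AE_prob_1) (auto simp: measure_def)

text \<open>The layer cake formula for the law of the increment divided by r. Moments of increments
  use r = 1; the relative increments in the drift of a power use r = x.\<close>

lemma nn_integral_layer_K:
  assumes r: "r > 0" and g [measurable]: "g \<in> borel_measurable borel"
  shows "(\<integral>\<^sup>+y. (\<integral>\<^sup>+s. g s * indicator {0<..<(y - x) / r} s \<partial>lborel) \<partial>K x)
       = (\<integral>\<^sup>+s. g s * indicator {0<..} s * ennreal (measure (K x) {x + r * s<..}) \<partial>lborel)"
proof -
  define N where "N = distr (K x) borel (\<lambda>y. (y - x) / r)"
  have N: "prob_space N" unfolding N_def by (intro KP.prob_space_distr) auto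
  have setsN [measurable_cong]: "sets N = sets borel" by (simp add: N_def)
  have meas: "(\<lambda>u. \<integral>\<^sup>+s. g s * indicator {0<..<u} s \<partial>lborel) \<in> borel_measurable borel"
  proof -
    have "(\<lambda>u. \<integral>\<^sup>+s. g s * (if 0 < s \<and> s < u then 1 else 0) \<partial>lborel) \<in> borel_measurable borel"
      by measurable
    thus ?thesis by (simp add: indicator_def of_bool_def)
  qed
  have em: "emeasure N {s<..} = ennreal (measure (K x) {x + r * s<..})" for s
  proof -
    have "emeasure N {s<..} = emeasure (K x) ((\<lambda>y. (y - x) / r) -` {s<..} \<inter> space (K x))"
      unfolding N_def by (subst emeasure_distr) auto
    also have "(\<lambda>y. (y - x) / r) -` {s<..} \<inter> space (K x) = {x + r * s<..}"
      using r by (auto simp: field_simps)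
    finally show ?thesis by (simp add: KP.emeasure_eq_measure)
  qed
  have "(\<integral>\<^sup>+y. (\<integral>\<^sup>+s. g s * indicator {0<..<(y - x) / r} s \<partial>lborel) \<partial>K x)
      = (\<integral>\<^sup>+u. 1 * (\<integral>\<^sup>+s. g s * indicator {0<..<u} s \<partial>lborel) \<partial>N)"
    unfolding N_def using meas by (subst nn_integral_distr) auto
  also have "\<dots> = (\<integral>\<^sup>+s. g s * indicator {0<..} s * (\<integral>\<^sup>+u. 1 * indicator {s<..} u \<partial>N) \<partial>lborel)"
    using N by (intro layer_cake prob_space_imp_sigma_finite setsN) auto
  also have "\<dots> = (\<integral>\<^sup>+s. g s * indicator {0<..} s * ennreal (measure (K x) {x + r * s<..}) \<partial>lborel)"
    by (simp add: em)
  finally show ?thesis .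
qed

lemma tail_bounds:
  assumes "\<epsilon> > 0"
  obtains Y where "Y > 0"
    and "\<And>y x. y \<ge> Y \<Longrightarrow> x \<in> S \<Longrightarrow> x \<ge> x0 \<Longrightarrow> upper x y \<le> (c + \<epsilon>) * y powr (- \<alpha>)"
    and "\<And>y x. y \<ge> Y \<Longrightarrow> x \<in> S \<Longrightarrow> x \<ge> x0 \<Longrightarrow> (c - \<epsilon>) * y powr (- \<alpha>) \<le> upper x y"
proof -
  obtain Y where Y: "\<And>y x. y \<ge> Y \<Longrightarrow> x \<in> S \<Longrightarrow> x \<ge> x0 \<Longrightarrow> \<bar>y powr \<alpha> * upper x y - c\<bar> \<le> \<epsilon>"
    using tail[OF assms] by blast
  show ?thesis
  proof (rule that[of "max Y 1"])
    fix x y assume *: "y \<ge> max Y 1" "x \<in> S" "x \<ge> x0"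
    hence "\<bar>y powr \<alpha> * upper x y - c\<bar> \<le> \<epsilon>" by (intro Y) auto
    hence "y powr \<alpha> * upper x y \<le> c + \<epsilon>" "c - \<epsilon> \<le> y powr \<alpha> * upper x y"
      by linarith+
    moreover have "y powr (- \<alpha>) * (y powr \<alpha> * upper x y) = upper x y"
      using * by (simp add: powr_minus field_simps)
    ultimately show "upper x y \<le> (c + \<epsilon>) * y powr (- \<alpha>)"
      "(c - \<epsilon>) * y powr (- \<alpha>) \<le> upper x y"
      using mult_left_mono[of _ _ "y powr (- \<alpha>)"] by (metis mult.commute powr_ge_zero)+
  qed auto
qed

lemma moment_bound:
  assumes \<eta>: "0 < \<eta>" "\<eta> < \<alpha>"
  shows "\<exists>C\<ge>0. \<forall>x\<in>S. x \<ge> x0 \<longrightarrow> (\<integral>\<^sup>+y. ennreal (\<bar>y - x\<bar> powr \<eta>) \<partial>K x) \<le> ennreal C"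
proof -
  obtain Y where Y: "Y > 0" "\<And>y x. y \<ge> Y \<Longrightarrow> x \<in> S \<Longrightarrow> x \<ge> x0 \<Longrightarrow> upper x y \<le> (c + 1) * y powr (- \<alpha>)"
    using tail_bounds[of 1] by (metis zero_less_one)
  obtain CL where CL: "\<And>x. x \<in> S \<Longrightarrow> x \<ge> x0 \<Longrightarrow> left_moment x \<le> ennreal CL"
    using left by blast
  define c1 where "c1 = c + 1"
  have c1: "c1 > 0" using c by (simp add: c1_def)
  \<comment> \<open>Before the factor \<eta>, A bounds the part below Y, where the tail probability
    is at most 1, and B the part above Y, where the power tail bound holds.\<close>
  define A where "A = Y powr \<eta> / \<eta>"
  define B where "B = c1 * (Y powr (\<eta> - \<alpha>) / (\<alpha> - \<eta>))"
  have AB: "A \<ge> 0" "B \<ge> 0" using \<eta> c1 by (auto simp: A_def B_def)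
  show ?thesis
  proof (intro exI[of _ "\<eta> * (A + B) + (1 + \<bar>CL\<bar>)"] conjI ballI impI)
    fix x assume x: "x \<in> S" "x \<ge> x0"
    let ?g = "\<lambda>s. ennreal (s powr (\<eta> - 1))"
    have pos: "ennreal (max 0 (y - x) powr \<eta>) = ennreal \<eta> * (\<integral>\<^sup>+s. ?g s * indicator {0<..<(y - x) / 1} s \<partial>lborel)" for y
    proof (cases "y \<ge> x")
      case True
      thus ?thesis using \<eta> nn_integral_powr_Ioo[of "\<eta> - 1" "y - x"]
        by (simp add: ennreal_mult'[symmetric])
    qed (use \<eta> in \<open>auto simp: max_def\<close>)
    have "(\<integral>\<^sup>+y. (\<integral>\<^sup>+s. ?g s * indicator {0<..<(y - x) / 1} s \<partial>lborel) \<partial>K x)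
        = (\<integral>\<^sup>+s. ?g s * indicator {0<..} s * ennreal (measure (K x) {x + 1 * s<..}) \<partial>lborel)"
      by (rule nn_integral_layer_K) auto
    also have "\<dots> \<le> (\<integral>\<^sup>+s. ?g s * indicator {0<..<Y} s + ennreal c1 * (ennreal (s powr (\<eta> - 1 - \<alpha>)) * indicator {Y<..} s) \<partial>lborel)"
    proof (intro nn_integral_mono_AE)
      show "AE s in lborel. ?g s * indicator {0<..} s * ennreal (measure (K x) {x + 1 * s<..})
        \<le> ?g s * indicator {0<..<Y} s + ennreal c1 * (ennreal (s powr (\<eta> - 1 - \<alpha>)) * indicator {Y<..} s)"
        using AE_lborel_singleton[of Y]
      proof eventually_elim
        case (elim s)
        consider "s \<le> 0" | "0 < s" "s < Y" | "s > Y" using elim by linarith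
        thus ?case
        proof cases
          case 2
          have "?g s * ennreal (measure (K x) {x + 1 * s<..}) \<le> ?g s * 1"
            by (intro mult_left_mono) auto
          thus ?thesis using 2 by simp
        next
          case 3
          have "s powr (\<eta> - 1) * measure (K x) {x + s<..} \<le> s powr (\<eta> - 1) * (c1 * s powr (- \<alpha>))"
            using 3 Y x unfolding c1_def by (intro mult_left_mono) auto
          also have "\<dots> = c1 * s powr (\<eta> - 1 - \<alpha>)"
            by (simp add: powr_diff powr_minus divide_inverse)
          finally show ?thesis using 3 Y c1
            by (simp add: ennreal_mult'[symmetric] ennreal_leI)
        qed auto
      qed
    qed
    also have "\<dots> = ennreal A + ennreal c1 * ennreal (Y powr (\<eta> - \<alpha>) / (\<alpha> - \<eta>))"
      using nn_integral_powr_Ioo[of "\<eta> - 1" Y] nn_integral_powr_Ioi[of "\<eta> - 1 - \<alpha>" Y] \<eta> Y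
      by (subst nn_integral_add) (auto simp: nn_integral_cmult A_def)
    also have "\<dots> = ennreal (A + B)"
      using c1 \<eta> AB unfolding B_def by (subst ennreal_mult[symmetric]) auto
    finally have "ennreal \<eta> * (\<integral>\<^sup>+y. (\<integral>\<^sup>+s. ?g s * indicator {0<..<(y - x) / 1} s \<partial>lborel) \<partial>K x) \<le> ennreal \<eta> * ennreal (A + B)"
      by (intro mult_left_mono) auto
    also have "ennreal \<eta> * (\<integral>\<^sup>+y. (\<integral>\<^sup>+s. ?g s * indicator {0<..<(y - x) / 1} s \<partial>lborel) \<partial>K x)
      = (\<integral>\<^sup>+y. ennreal (max 0 (y - x) powr \<eta>) \<partial>K x)"
    proof (subst nn_integral_cmult[symmetric])
      have "(\<lambda>y. \<integral>\<^sup>+s. ?g s * (if 0 < s \<and> s < (y - x) / 1 then 1 else 0) \<partial>lborel) \<in> borel_measurable borel"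
        by measurable
      thus "(\<lambda>y. \<integral>\<^sup>+s. ?g s * indicator {0<..<(y - x) / 1} s \<partial>lborel) \<in> borel_measurable (K x)"
        by (simp add: indicator_def of_bool_def)
    qed (simp only: pos)
    finally have P: "(\<integral>\<^sup>+y. ennreal (max 0 (y - x) powr \<eta>) \<partial>K x) \<le> ennreal (\<eta> * (A + B))"
      using \<eta> by (simp add: ennreal_mult')
    have "(\<integral>\<^sup>+y. ennreal (\<bar>y - x\<bar> powr \<eta>) \<partial>K x)
        \<le> (\<integral>\<^sup>+y. ennreal (max 0 (y - x) powr \<eta>) + (1 + ennreal (negpart (y - x) powr \<beta>)) \<partial>K x)"
    proof (intro nn_integral_mono)
      fix y
      show "ennreal (\<bar>y - x\<bar> powr \<eta>) \<le> ennreal (max 0 (y - x) powr \<eta>) + (1 + ennreal (negpart (y - x) powr \<beta>))"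
      proof (cases "y \<ge> x")
        case False
        define u where "u = x - y"
        have u: "u > 0" using False by (simp add: u_def)
        have "u powr \<eta> \<le> 1 + u powr \<beta>"
          using u \<eta> \<beta> by (intro powr_le_one_plus_powr) auto
        moreover have "\<bar>y - x\<bar> = u" "negpart (y - x) = u" "max 0 (y - x) = 0"
          using False by (auto simp: u_def negpart_def)
        ultimately have "ennreal (\<bar>y - x\<bar> powr \<eta>) \<le> ennreal (1 + negpart (y - x) powr \<beta>)"
          by (intro ennreal_leI) simp
        also have "\<dots> = 1 + ennreal (negpart (y - x) powr \<beta>)" by simp
        finally show ?thesis by (simp add: add_increasing)
      qed (auto simp: max_def)
    qed
    also have "\<dots> = (\<integral>\<^sup>+y. ennreal (max 0 (y - x) powr \<eta>) \<partial>K x) + (1 + left_moment x)"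
      unfolding negpart_def by (simp add: nn_integral_add)
    also have "\<dots> \<le> ennreal (\<eta> * (A + B)) + (1 + ennreal \<bar>CL\<bar>)"
      using P CL[OF x] by (intro add_mono) (auto elim!: order_trans intro!: ennreal_leI)
    also have "\<dots> = ennreal (\<eta> * (A + B) + (1 + \<bar>CL\<bar>))"
      using \<eta> AB by simp
    finally show "(\<integral>\<^sup>+y. ennreal (\<bar>y - x\<bar> powr \<eta>) \<partial>K x) \<le> ennreal (\<eta> * (A + B) + (1 + \<bar>CL\<bar>))" .
  qed (use \<eta> AB in auto)
qed

lemma integrable_moment:
  assumes \<eta>: "0 < \<eta>" "\<eta> < \<alpha>"
  shows "\<exists>C\<ge>0. \<forall>x\<in>S. x \<ge> x0 \<longrightarrow> integrable (K x) (\<lambda>y. \<bar>y - x\<bar> powr \<eta>) \<and> (\<integral>y. \<bar>y - x\<bar> powr \<eta> \<partial>K x) \<le> C"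
proof -
  obtain C where C: "C \<ge> 0" "\<And>x. x \<in> S \<Longrightarrow> x \<ge> x0 \<Longrightarrow> (\<integral>\<^sup>+y. ennreal (\<bar>y - x\<bar> powr \<eta>) \<partial>K x) \<le> ennreal C"
    using moment_bound[OF \<eta>] by blast
  show ?thesis
  proof (intro exI[of _ C] conjI ballI impI)
    fix x assume x: "x \<in> S" "x \<ge> x0"
    show int: "integrable (K x) (\<lambda>y. \<bar>y - x\<bar> powr \<eta>)"
      using C(2)[OF x] by (intro integrableI_bounded) (auto simp: le_less_trans)
    have "ennreal (\<integral>y. \<bar>y - x\<bar> powr \<eta> \<partial>K x) \<le> ennreal C"
      using C(2)[OF x] by (subst nn_integral_eq_integral[symmetric]) (use int in auto)
    thus "(\<integral>y. \<bar>y - x\<bar> powr \<eta> \<partial>K x) \<le> C" using C(1) by simp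
  qed (rule C)
qed

lemma integrable_increment:
  assumes "x \<in> S" "x \<ge> x0"
  shows "integrable (K x) (\<lambda>y. y - x)"
proof -
  have "integrable (K x) (\<lambda>y. \<bar>y - x\<bar> powr 1)"
    using integrable_moment[of 1] \<alpha> assms by auto
  hence "integrable (K x) (\<lambda>y. \<bar>y - x\<bar>)" by simp
  thus ?thesis by (subst (asm) integrable_abs_iff) auto
qed


section \<open>Coarse drift estimates and the time spent at a height\<close>

lemma integral_power_remainder:
  assumes "x \<in> S" "x \<ge> x0" and int: "finite_moment \<nu> x"
  shows "(\<integral>y. y powr \<nu> - x powr \<nu> - \<nu> * x powr (\<nu> - 1) * (y - x) \<partial>K x)
    = moment \<nu> x - x powr \<nu> - \<nu> * x powr (\<nu> - 1) * mean x"
proof -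
  note int1 = integrable_increment[OF assms(1,2)]
  have "(\<integral>y. y powr \<nu> - x powr \<nu> - \<nu> * x powr (\<nu> - 1) * (y - x) \<partial>K x)
      = (\<integral>y. y powr \<nu> - x powr \<nu> \<partial>K x) - (\<integral>y. \<nu> * x powr (\<nu> - 1) * (y - x) \<partial>K x)"
    using int int1 by (intro Bochner_Integration.integral_diff) auto
  also have "(\<integral>y. y powr \<nu> - x powr \<nu> \<partial>K x) = moment \<nu> x - (\<integral>y. x powr \<nu> \<partial>K x)"
    using int by (intro Bochner_Integration.integral_diff) auto
  finally show ?thesis
    by (simp only: integral_mult_right_zero mean_def lebesgue_integral_const KP.prob_space scaleR_one)
qed

text \<open>The first-order remainder at scale x, times the uniform \<eta>-th moment of increments.
  It determines the drift when the mean increment is of larger order than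
  \<open>x powr (1 - \<alpha>)\<close>, because \<eta> can then be placed between \<rho> and
  \<alpha>.\<close>

lemma drift_power_coarse:
  assumes \<nu>: "0 < \<nu>" "\<nu> \<le> \<eta>" and \<eta>: "1 \<le> \<eta>" "\<eta> < \<alpha>"
  shows "\<exists>C\<ge>0. \<forall>x\<in>S. x \<ge> x0 \<longrightarrow> x > 0 \<longrightarrow> finite_moment \<nu> x \<and>
    \<bar>moment \<nu> x - x powr \<nu> - \<nu> * x powr (\<nu> - 1) * mean x\<bar> \<le> C * x powr (\<nu> - \<eta>)"
proof -
  obtain C where C: "C \<ge> 0" "\<And>x. x \<in> S \<Longrightarrow> x \<ge> x0 \<Longrightarrow>
      integrable (K x) (\<lambda>y. \<bar>y - x\<bar> powr \<eta>) \<and> (\<integral>y. \<bar>y - x\<bar> powr \<eta> \<partial>K x) \<le> C"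
    using integrable_moment[of \<eta>] \<eta> by auto
  show ?thesis
  proof (intro exI[of _ "28 * C"] conjI[of "28 * C \<ge> 0"] ballI impI)
    fix x assume x: "x \<in> S" "x \<ge> x0" "x > 0"
    define R where "R y = y powr \<nu> - x powr \<nu> - \<nu> * x powr (\<nu> - 1) * (y - x)" for y
    have [measurable]: "R \<in> borel_measurable borel" unfolding R_def by measurable
    have int_\<eta>: "integrable (K x) (\<lambda>y. 28 * x powr (\<nu> - \<eta>) * \<bar>y - x\<bar> powr \<eta>)"
      using C(2)[OF x(1,2)] by simp
    have bound: "AE y in K x. \<bar>R y\<bar> \<le> 28 * x powr (\<nu> - \<eta>) * \<bar>y - x\<bar> powr \<eta>"
      using AE_K[OF x(1)]
    proof eventually_elim
      case (elim y)
      define t where "t = (y - x) / x"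
      have y: "y \<ge> 0" using elim S_nonneg by auto
      hence t: "t \<ge> -1" using x by (simp add: t_def field_simps)
      have "\<bar>R y\<bar> = x powr \<nu> * \<bar>(1 + t) powr \<nu> - 1 - \<nu> * t\<bar>"
        unfolding R_def t_def power_expansion[OF x(3) y] by (simp add: abs_mult)
      also have "\<dots> \<le> x powr \<nu> * (28 * \<bar>t\<bar> powr \<eta>)"
        using \<nu> \<eta> \<alpha> t by (intro mult_left_mono powr_first_order_remainder) auto
      also have "\<bar>t\<bar> powr \<eta> = \<bar>y - x\<bar> powr \<eta> / x powr \<eta>"
        using x by (simp add: t_def powr_divide)
      also have "x powr \<nu> * (28 * (\<bar>y - x\<bar> powr \<eta> / x powr \<eta>)) = 28 * x powr (\<nu> - \<eta>) * \<bar>y - x\<bar> powr \<eta>"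
        by (simp add: powr_diff)
      finally show ?case .
    qed
    have int_R: "integrable (K x) R"
      by (rule Bochner_Integration.integrable_bound[OF int_\<eta>]) (use bound in auto)
    have "integrable (K x) (\<lambda>y. R y + x powr \<nu> + \<nu> * x powr (\<nu> - 1) * (y - x))"
      using int_R integrable_increment[OF x(1,2)] by auto
    moreover have "(\<lambda>y. R y + x powr \<nu> + \<nu> * x powr (\<nu> - 1) * (y - x)) = (\<lambda>y. y powr \<nu>)"
      by (auto simp: R_def)
    ultimately have int: "finite_moment \<nu> x" by simp
    have "\<bar>\<integral>y. R y \<partial>K x\<bar> \<le> (\<integral>y. \<bar>R y\<bar> \<partial>K x)" by (rule integral_abs_bound)
    also have "\<dots> \<le> (\<integral>y. 28 * x powr (\<nu> - \<eta>) * \<bar>y - x\<bar> powr \<eta> \<partial>K x)"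
      using int_R int_\<eta> bound by (intro integral_mono_AE) auto
    also have "\<dots> = 28 * x powr (\<nu> - \<eta>) * (\<integral>y. \<bar>y - x\<bar> powr \<eta> \<partial>K x)" by simp
    also have "\<dots> \<le> 28 * x powr (\<nu> - \<eta>) * C"
      using C(2)[OF x(1,2)] by (intro mult_left_mono) auto
    finally show "finite_moment \<nu> x \<and>
      \<bar>moment \<nu> x - x powr \<nu> - \<nu> * x powr (\<nu> - 1) * mean x\<bar> \<le> 28 * C * x powr (\<nu> - \<eta>)"
      using int unfolding R_def integral_power_remainder[OF x(1,2) int] by (simp add: mult_ac)
  qed (use C in auto)
qed

text \<open>For x > z one step raises the mean of the capped z / y by at most order
  \<open>z powr (- \<rho>)\<close>: the linear term costs \<bar>mean x\<bar> / x, and the Taylor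
  remainder costs a \<rho>-th moment. Since the gain per step is uniform above z, it can be summed
  over time.\<close>

lemma drift_inverse:
  assumes \<rho>: "1 \<le> \<rho>" "\<rho> < \<alpha>" and mean: "\<And>x. x \<in> S \<Longrightarrow> x \<ge> x1 \<Longrightarrow> \<bar>mean x\<bar> \<le> B * x powr (1 - \<rho>)"
  shows "\<exists>D>0. \<forall>z>0. \<forall>x\<in>S. x > z \<longrightarrow> x \<ge> x0 \<longrightarrow> x \<ge> x1 \<longrightarrow>
     (\<integral>\<^sup>+y. ennreal (if y \<in> S \<inter> {z<..} then z / y else 1) \<partial>K x) \<le> ennreal (z / x + D * z powr (- \<rho>))"
proof -
  obtain C where C: "C \<ge> 0" "\<And>x. x \<in> S \<Longrightarrow> x \<ge> x0 \<Longrightarrow>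
      integrable (K x) (\<lambda>y. \<bar>y - x\<bar> powr \<rho>) \<and> (\<integral>y. \<bar>y - x\<bar> powr \<rho> \<partial>K x) \<le> C"
    using integrable_moment[of \<rho>] \<rho> by auto
  \<comment> \<open>In the constant, \<bar>B\<bar> comes from the mean, 4 C from the Taylor
    remainder, and 1 ensures positivity.\<close>
  show ?thesis
  proof (intro exI[of _ "\<bar>B\<bar> + 4 * C + 1"] conjI allI ballI impI)
    fix z x assume z: "z > 0" and x: "x \<in> S" "x > z" "x \<ge> x0" "x \<ge> x1"
    define F where "F y = (if y \<in> S \<inter> {z<..} then z / y else 1)" for y
    define G where "G y = z / x - z / x\<^sup>2 * (y - x) + 4 * x powr (- \<rho>) * \<bar>y - x\<bar> powr \<rho>" for y
    have x0: "x > 0" using z x by simp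
    have FG: "AE y in K x. F y \<le> G y"
      using AE_K[OF x(1)]
    proof eventually_elim
      case (elim y)
      hence y: "y \<ge> 0" using S_nonneg by auto
      have "F y = (if y > z then z / y else 1)" using elim by (simp add: F_def)
      also have "\<dots> \<le> z / x - z / x * ((y - x) / x) + 4 * \<bar>(y - x) / x\<bar> powr \<rho>"
        using z x y \<rho> \<alpha> by (intro inverse_first_order_upper) auto
      also have "\<dots> = G y"
        using x0 by (simp add: G_def power2_eq_square powr_divide powr_minus_divide)
      finally show ?case .
    qed
    have F_bounds: "0 \<le> F y" "F y \<le> 1" for y using z by (auto simp: F_def field_simps)
    have [measurable]: "F \<in> borel_measurable borel" unfolding F_def by measurable
    have intF: "integrable (K x) F"
      by (rule KP.integrable_const_bound[where B = 1]) (use F_bounds in auto)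
    note int1 = integrable_increment[OF x(1,3)]
    have int\<rho>: "integrable (K x) (\<lambda>y. \<bar>y - x\<bar> powr \<rho>)" using C(2)[OF x(1,3)] by simp
    have intG: "integrable (K x) G" unfolding G_def using int1 int\<rho> by auto
    have "(\<integral>\<^sup>+y. ennreal (F y) \<partial>K x) = ennreal (\<integral>y. F y \<partial>K x)"
      using intF F_bounds by (intro nn_integral_eq_integral) auto
    also have "(\<integral>y. F y \<partial>K x) \<le> (\<integral>y. G y \<partial>K x)"
      by (intro integral_mono_AE intF intG FG)
    also have "(\<integral>y. G y \<partial>K x) = z / x - z / x\<^sup>2 * mean x + 4 * x powr (- \<rho>) * (\<integral>y. \<bar>y - x\<bar> powr \<rho> \<partial>K x)"
    proof -
      have "(\<integral>y. G y \<partial>K x) = (\<integral>y. z / x - z / x\<^sup>2 * (y - x) \<partial>K x) + (\<integral>y. 4 * x powr (- \<rho>) * \<bar>y - x\<bar> powr \<rho> \<partial>K x)"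
        unfolding G_def using int1 int\<rho> by (intro Bochner_Integration.integral_add) auto
      also have "(\<integral>y. z / x - z / x\<^sup>2 * (y - x) \<partial>K x) = (\<integral>y. z / x \<partial>K x) - (\<integral>y. z / x\<^sup>2 * (y - x) \<partial>K x)"
        using int1 by (intro Bochner_Integration.integral_diff) auto
      finally show ?thesis
        by (simp only: integral_mult_right_zero mean_def lebesgue_integral_const KP.prob_space scaleR_one)
    qed
    also have "\<dots> \<le> z / x + (\<bar>B\<bar> + 4 * C + 1) * z powr (- \<rho>)"
    proof -
      have "z / x\<^sup>2 \<le> x / x\<^sup>2" using x by (intro divide_right_mono) auto
      also have "\<dots> = 1 / x" by (simp add: power2_eq_square)
      finally have "\<bar>z / x\<^sup>2\<bar> * \<bar>mean x\<bar> \<le> 1 / x * \<bar>mean x\<bar>"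
        using z by (intro mult_right_mono) auto
      hence "\<bar>z / x\<^sup>2 * mean x\<bar> \<le> 1 / x * \<bar>mean x\<bar>" by (simp only: abs_mult)
      also have "\<dots> \<le> 1 / x * (\<bar>B\<bar> * x powr (1 - \<rho>))"
        using mean[OF x(1,4)] x0
        by (intro mult_left_mono order.trans[OF mean[OF x(1,4)]] mult_right_mono) auto
      also have "\<dots> = \<bar>B\<bar> * x powr (- \<rho>)"
        using x0 by (simp add: powr_diff powr_minus_divide)
      finally have 1: "- (z / x\<^sup>2 * mean x) \<le> \<bar>B\<bar> * x powr (- \<rho>)" by linarith
      have 2: "4 * x powr (- \<rho>) * (\<integral>y. \<bar>y - x\<bar> powr \<rho> \<partial>K x) \<le> 4 * x powr (- \<rho>) * C"
        using C(2)[OF x(1,3)] by (intro mult_left_mono) auto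
      have "(\<bar>B\<bar> + 4 * C) * x powr (- \<rho>) \<le> (\<bar>B\<bar> + 4 * C + 1) * z powr (- \<rho>)"
        using C z x \<rho> by (intro mult_mono powr_mono2') auto
      thus ?thesis using 1 2 by (simp add: algebra_simps)
    qed
    finally show "(\<integral>\<^sup>+y. ennreal (if y \<in> S \<inter> {z<..} then z / y else 1) \<partial>K x) \<le> ennreal (z / x + (\<bar>B\<bar> + 4 * C + 1) * z powr (- \<rho>))"
      by (simp add: F_def ennreal_leI)
  qed (use C in auto)
qed

text \<open>From y, falling below z = y / 2 within n steps has probability at most 1/2, the initial
  value of the capped z / y, plus the accumulated gain. The latter is at most 1/4 for n up to
  \<delta> \<open>y powr \<rho>\<close>. Neither \<delta> nor the threshold depends on a.\<close>

lemma stay_ge_quarter: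
  assumes \<rho>: "1 \<le> \<rho>" "\<rho> < \<alpha>" and mean: "\<And>x. x \<in> S \<Longrightarrow> x \<ge> x1 \<Longrightarrow> \<bar>mean x\<bar> \<le> B * x powr (1 - \<rho>)"
  shows "\<exists>\<delta>>0. \<exists>z0>0. \<forall>a y n. y \<in> S \<longrightarrow> y \<ge> 2 * a \<longrightarrow> y \<ge> z0 \<longrightarrow> real n \<le> \<delta> * y powr \<rho> \<longrightarrow>
     ennreal (1 / 4) \<le> stay K (S \<inter> {a<..}) n y"
proof -
  obtain D where D: "D > 0" "\<And>z x. z > 0 \<Longrightarrow> x \<in> S \<Longrightarrow> x > z \<Longrightarrow> x \<ge> x0 \<Longrightarrow> x \<ge> x1 \<Longrightarrow>
     (\<integral>\<^sup>+y. ennreal (if y \<in> S \<inter> {z<..} then z / y else 1) \<partial>K x) \<le> ennreal (z / x + D * z powr (- \<rho>))"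
    using drift_inverse[OF \<rho> mean] by blast
  \<comment> \<open>The factor \<open>2 powr (- \<rho>)\<close> compensates for y = 2 z, and 4 D
    limits the total gain to 1/4.\<close>
  define \<delta> where "\<delta> = 2 powr (- \<rho>) / (4 * D)"
  have \<delta>: "\<delta> > 0" using D by (simp add: \<delta>_def)
  show ?thesis
  proof (rule exI[of _ \<delta>], rule conjI[OF \<delta>], rule exI[of _ "2 * max 1 (max x0 x1)"], intro conjI allI impI)
    fix a y n assume y: "y \<in> S" "y \<ge> 2 * a" "y \<ge> 2 * max 1 (max x0 x1)" and n: "real n \<le> \<delta> * y powr \<rho>"
    define z where "z = y / 2"
    have z: "z \<ge> 1" "z \<ge> x0" "z \<ge> x1" "z \<ge> a" using y by (auto simp: z_def)
    define F where "F y = ennreal (if y \<in> S \<inter> {z<..} then z / y else 1)" for y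
    have "1 \<le> stay K (S \<inter> {a<..}) n y + F y + of_nat n * ennreal (D * z powr (- \<rho>))"
    proof (rule stay_ge[where E' = "S \<inter> {z<..}"])
      show "F \<in> borel_measurable borel" unfolding F_def by measurable
      fix x assume x: "x \<in> S \<inter> {z<..}"
      have "(\<integral>\<^sup>+y. F y \<partial>K x) \<le> ennreal (z / x + D * z powr (- \<rho>))"
        unfolding F_def using x z by (intro D) auto
      also have "\<dots> = F x + ennreal (D * z powr (- \<rho>))"
        using x z D by (simp add: F_def)
      finally show "(\<integral>\<^sup>+y. F y \<partial>K x) \<le> F x + ennreal (D * z powr (- \<rho>))" .
    qed (use z in \<open>auto simp: F_def\<close>)
    also have "F y = ennreal (1 / 2)" using y z by (auto simp: F_def z_def)
    also have "of_nat n * ennreal (D * z powr (- \<rho>)) \<le> ennreal (1 / 4)"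
    proof -
      have "real n * (D * z powr (- \<rho>)) \<le> \<delta> * y powr \<rho> * (D * z powr (- \<rho>))"
        using n D by (intro mult_right_mono) auto
      also have "y powr \<rho> = 2 powr \<rho> * z powr \<rho>" using z by (simp add: z_def powr_mult[symmetric])
      also have "\<delta> * (2 powr \<rho> * z powr \<rho>) * (D * z powr (- \<rho>)) = 1 / 4"
        using D z by (simp add: \<delta>_def powr_minus field_simps)
      finally show ?thesis
        by (simp add: ennreal_of_nat_eq_real_of_nat ennreal_mult'[symmetric] ennreal_leI del: ennreal_divide_numeral)
    qed
    finally have "ennreal 1 \<le> stay K (S \<inter> {a<..}) n y + ennreal (1 / 2) + ennreal (1 / 4)"
      by (simp add: add_left_mono del: ennreal_divide_numeral)
    note le = this
    show "ennreal (1 / 4) \<le> stay K (S \<inter> {a<..}) n y"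
    proof (cases "stay K (S \<inter> {a<..}) n y")
      case (real r)
      have e1: "ennreal (r + 1 / 2 + 1 / 4) = ennreal (r + 1 / 2) + ennreal (1 / 4)"
        using real by (intro ennreal_plus) auto
      have e2: "ennreal (r + 1 / 2) = ennreal r + ennreal (1 / 2)"
        using real by (intro ennreal_plus) auto
      have "ennreal 1 \<le> ennreal (r + 1 / 2 + 1 / 4)"
        using le unfolding e1 e2 real(2) .
      hence "1 \<le> r + 1 / 2 + 1 / 4"
        using real(1) by (subst (asm) ennreal_le_iff) auto
      thus ?thesis using real by (simp del: ennreal_divide_numeral)
    qed simp
  qed auto
qed

text \<open>For high y the weights up to time \<delta> \<open>y powr \<rho>\<close> are each met by
  a survival probability of at least 1/4, and they sum to order
  \<open>y powr (\<rho> * q)\<close>.\<close>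

lemma stay_series_ge_powr:
  assumes \<rho>: "1 \<le> \<rho>" "\<rho> < \<alpha>" and mean: "\<And>x. x \<in> S \<Longrightarrow> x \<ge> x1 \<Longrightarrow> \<bar>mean x\<bar> \<le> B * x powr (1 - \<rho>)"
    and q: "q > 0" and a: "a > 0"
  shows "\<exists>d>0. \<forall>y\<in>S \<inter> {a<..}. ennreal (d * y powr (\<rho> * q)) \<le> series a q y"
proof -
  obtain \<delta> z0 where \<delta>: "\<delta> > 0" and z0: "z0 > 0" and
    stay: "\<And>a y n. y \<in> S \<Longrightarrow> y \<ge> 2 * a \<Longrightarrow> y \<ge> z0 \<Longrightarrow> real n \<le> \<delta> * y powr \<rho> \<Longrightarrow>
      ennreal (1 / 4) \<le> stay K (S \<inter> {a<..}) n y"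
    using stay_ge_quarter[OF \<rho> mean] by metis
  define h where "h = max (2 * a) z0"
  define d1 where "d1 = \<delta> powr q / (4 * max 1 q)"
  define d2 where "d2 = h powr (- (\<rho> * q))"
  have h: "h > 0" using z0 by (auto simp: h_def)
  show ?thesis
  proof (intro exI[of _ "min d1 d2"] conjI ballI)
    show "min d1 d2 > 0" using \<delta> h by (auto simp: d1_def d2_def)
    fix y assume y: "y \<in> S \<inter> {a<..}"
    let ?E = "S \<inter> {a<..}"
    show "ennreal (min d1 d2 * y powr (\<rho> * q)) \<le> series a q y"
    proof (cases "y \<ge> h")
      \<comment> \<open>Between a and h the term n = 0 alone suffices: it equals 1, and d2 is chosen
        so that the target is at most 1.\<close>
      case False
      have "min d1 d2 * y powr (\<rho> * q) \<le> d2 * h powr (\<rho> * q)"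
        using False y a q \<rho> h by (intro mult_mono powr_mono2) (auto simp: d2_def)
      also have "\<dots> = 1" using h by (simp add: d2_def powr_minus)
      finally have "ennreal (min d1 d2 * y powr (\<rho> * q)) \<le> 1"
        by (simp add: ennreal_le_1)
      also have "1 = (\<Sum>n<1. ennreal (real (Suc n) powr (q - 1)) * stay K ?E n y)"
        using y by (simp add: stay_0)
      also have "\<dots> \<le> series a q y"
        unfolding stay_series_def by (intro sum_le_suminf) auto
      finally show ?thesis .
    next
      case True
      define N where "N = Suc (nat \<lfloor>\<delta> * y powr \<rho>\<rfloor>)"
      have ypos: "y > 0" using True h by simp
      have N: "\<delta> * y powr \<rho> \<le> real N" unfolding N_def by linarith
      have less_N: "real n \<le> \<delta> * y powr \<rho>" if "n < N" for n
      proof -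
        have "int n \<le> \<lfloor>\<delta> * y powr \<rho>\<rfloor>" using that \<delta> by (simp add: N_def less_Suc_eq_le le_nat_iff)
        thus ?thesis by (simp add: le_floor_iff)
      qed
      have "min d1 d2 * y powr (\<rho> * q) \<le> d1 * y powr (\<rho> * q)"
        by (intro mult_right_mono) auto
      also have "\<dots> = (\<delta> * y powr \<rho>) powr q / (4 * max 1 q)"
        using \<delta> by (simp add: d1_def powr_mult powr_powr)
      also have "\<dots> \<le> real N powr q / (4 * max 1 q)"
        using N \<delta> q by (intro divide_right_mono powr_mono2) auto
      also have "\<dots> \<le> (max 1 q * (\<Sum>k<N. real (Suc k) powr (q - 1))) / (4 * max 1 q)"
        using powr_le_sum_weights[OF q, of N] by (intro divide_right_mono) auto
      also have "\<dots> = (\<Sum>k<N. real (Suc k) powr (q - 1) * (1 / 4))"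
        by (simp add: sum_divide_distrib max_def)
      finally have "ennreal (min d1 d2 * y powr (\<rho> * q)) \<le> ennreal (\<Sum>k<N. real (Suc k) powr (q - 1) * (1 / 4))"
        by (rule ennreal_leI)
      also have "\<dots> = (\<Sum>k<N. ennreal (real (Suc k) powr (q - 1)) * ennreal (1 / 4))"
        by (subst sum_ennreal[symmetric]) (auto simp: ennreal_mult'[symmetric] simp del: ennreal_divide_numeral)
      also have "\<dots> \<le> (\<Sum>k<N. ennreal (real (Suc k) powr (q - 1)) * stay K ?E k y)"
        using y True less_N by (intro sum_mono mult_left_mono stay) (auto simp: h_def)
      also have "\<dots> \<le> series a q y"
        unfolding stay_series_def by (intro sum_le_suminf) auto
      finally show ?thesis .
    qed
  qed
qed


section \<open>Exact asymptotics of the drift of a power\<close>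

definition incr_int :: "real \<Rightarrow> real" where
  "incr_int \<nu> = \<nu> * \<bar>\<nu> - 1\<bar> / (\<alpha> - 1) * (Gamma (2 - \<alpha>) * Gamma (\<alpha> - \<nu>) / Gamma (2 - \<nu>))"

lemma incr_int_nonneg: "0 < \<nu> \<Longrightarrow> \<nu> < \<alpha> \<Longrightarrow> incr_int \<nu> \<ge> 0"
  using \<alpha> by (auto simp: incr_int_def)

text \<open>This integral is the mean of the absolute first-order remainder of
  \<open>(1 + u) powr \<nu>\<close> under the limiting jump measure with tail
  \<open>s powr (- \<alpha>)\<close>, after integration by parts; the increment integral supplies
  its closed form.\<close>

lemma nn_integral_incr:
  assumes "0 < \<nu>" "\<nu> < \<alpha>"
  shows "(\<integral>\<^sup>+s. ennreal (\<nu> * \<bar>(1 + s) powr (\<nu> - 1) - 1\<bar> * s powr (- \<alpha>)) * indicator {0<..} s \<partial>lborel) = ennreal (incr_int \<nu>)"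
proof -
  have "(\<integral>\<^sup>+s. ennreal (\<nu> * \<bar>(1 + s) powr (\<nu> - 1) - 1\<bar> * s powr (- \<alpha>)) * indicator {0<..} s \<partial>lborel)
    = (\<integral>\<^sup>+s. ennreal \<nu> * (ennreal (\<bar>(1 + s) powr (\<nu> - 1) - 1\<bar> * s powr (- \<alpha>)) * indicator {0<..} s) \<partial>lborel)"
    using assms by (intro nn_integral_cong) (auto simp: indicator_def ennreal_mult' mult_ac)
  also have "\<dots> = ennreal \<nu> * ennreal (\<bar>\<nu> - 1\<bar> / (\<alpha> - 1) * (Gamma (2 - \<alpha>) * Gamma (\<alpha> - 1 - (\<nu> - 1)) / Gamma (1 - (\<nu> - 1))))"
    using assms \<alpha> nn_integral_powr_increment_tail[of \<alpha> "\<nu> - 1"] by (subst nn_integral_cmult) auto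
  also have "\<dots> = ennreal (\<nu> * (\<bar>\<nu> - 1\<bar> / (\<alpha> - 1) * (Gamma (2 - \<alpha>) * Gamma (\<alpha> - 1 - (\<nu> - 1)) / Gamma (1 - (\<nu> - 1)))))"
    using assms by (subst ennreal_mult') auto
  finally show ?thesis by (simp add: incr_int_def mult.assoc)
qed

text \<open>The contribution of upward jumps to the drift of the \<nu>-th power, without its sign
  and divided by \<open>x powr \<nu>\<close>. It is kept in \<open>ennreal\<close>, so it can be
  estimated before its finiteness is known.\<close>

definition pos_int :: "real \<Rightarrow> real \<Rightarrow> ennreal" where
  "pos_int \<nu> x = (\<integral>\<^sup>+s. ennreal (\<nu> * \<bar>(1 + s) powr (\<nu> - 1) - 1\<bar>) * indicator {0<..} s *
     ennreal (measure (K x) {x + x * s<..}) \<partial>lborel)"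

text \<open>The tail comparison is available only for x s \<ge> Y. The part s < Y / x has small
  mass, bounded through r, because the integrand there is at most 2
  \<open>s powr (1 - \<alpha>)\<close>. In the lower bound the missing part is added on the right
  instead of being subtracted.\<close>

lemma pos_int_bounds:
  assumes \<nu>: "0 < \<nu>" "\<nu> < \<alpha>" and e: "0 < e" "e \<le> c"
    and Y: "Y > 0" "\<And>y. y \<ge> Y \<Longrightarrow> upper x y \<le> (c + e) * y powr (- \<alpha>)"
      "\<And>y. y \<ge> Y \<Longrightarrow> (c - e) * y powr (- \<alpha>) \<le> upper x y"
    and x: "x > 0"
  defines "r \<equiv> 2 * ((Y / x) powr (2 - \<alpha>) / (2 - \<alpha>))"
  shows "pos_int \<nu> x \<le> ennreal (x powr (- \<alpha>) * ((c + e) * incr_int \<nu> + Y powr \<alpha> * r))"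
    and "ennreal (x powr (- \<alpha>) * ((c - e) * incr_int \<nu>)) \<le> pos_int \<nu> x + ennreal (x powr (- \<alpha>) * (c * r))"
proof -
  define \<psi> where "\<psi> s = \<nu> * \<bar>(1 + s) powr (\<nu> - 1) - 1\<bar>" for s
  have \<psi>: "\<psi> s \<ge> 0" for s using \<nu> by (simp add: \<psi>_def)
  have [measurable]: "\<psi> \<in> borel_measurable borel" unfolding \<psi>_def by measurable
  let ?m = "\<lambda>s. measure (K x) {x + x * s<..}" and ?p = "x powr (- \<alpha>)" and ?J = "incr_int \<nu>"
  let ?u = "\<lambda>s. \<psi> s * s powr (- \<alpha>)"
  let ?w = "\<lambda>s. ennreal (?u s) * indicator {0<..} s" and ?v = "\<lambda>s. ennreal (?u s) * indicator {0<..<Y / x} s"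
  note J0 = incr_int_nonneg[OF \<nu>]
  have J: "(\<integral>\<^sup>+s. ?w s \<partial>lborel) = ennreal ?J"
    using nn_integral_incr[OF \<nu>] by (simp add: \<psi>_def)
  have r: "r \<ge> 0" using \<alpha> by (simp add: r_def)
  have "(\<integral>\<^sup>+s. ?v s \<partial>lborel)
    \<le> (\<integral>\<^sup>+s. ennreal 2 * (ennreal (s powr (1 - \<alpha>)) * indicator {0<..<Y / x} s) \<partial>lborel)"
  proof (intro nn_integral_mono)
    fix s :: real
    have "?u s \<le> 2 * s powr (1 - \<alpha>)" if "s > 0"
    proof -
      have "\<psi> s \<le> 2 * s"
        unfolding \<psi>_def using \<nu> \<alpha> that by (intro mult_mono abs_powr_increment_le) auto
      hence "?u s \<le> 2 * s * s powr (- \<alpha>)" by (intro mult_right_mono) auto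
      also have "\<dots> = 2 * s powr (1 - \<alpha>)" using that by (simp add: powr_diff powr_minus divide_inverse)
      finally show ?thesis .
    qed
    thus "?v s \<le> ennreal 2 * (ennreal (s powr (1 - \<alpha>)) * indicator {0<..<Y / x} s)"
      by (auto simp: indicator_def ennreal_mult'[symmetric] intro!: ennreal_leI simp del: ennreal_numeral)
  qed
  also have "\<dots> = ennreal 2 * ennreal ((Y / x) powr (2 - \<alpha>) / (2 - \<alpha>))"
    using nn_integral_powr_Ioo[of "1 - \<alpha>" "Y / x"] \<alpha> Y x by (subst nn_integral_cmult) auto
  also have "\<dots> = ennreal r" unfolding r_def by (rule ennreal_mult'[symmetric]) simp
  finally have R: "(\<integral>\<^sup>+s. ?v s \<partial>lborel) \<le> ennreal r" .
  have scale: "(x * s) powr (- \<alpha>) = x powr (- \<alpha>) * s powr (- \<alpha>)" if "s > 0" for s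
    using that x by (simp add: powr_mult)
  have pos_int: "pos_int \<nu> x = (\<integral>\<^sup>+s. ennreal (\<psi> s) * indicator {0<..} s * ennreal (?m s) \<partial>lborel)"
    by (simp add: pos_int_def \<psi>_def)
  have "pos_int \<nu> x \<le> (\<integral>\<^sup>+s. ennreal (?p * (c + e)) * (?w s) + ennreal (?p * Y powr \<alpha>) * (?v s) \<partial>lborel)"
    unfolding pos_int
  proof (intro nn_integral_mono)
    fix s :: real
    consider "s \<le> 0" | "s > 0" "x * s < Y" | "s > 0" "x * s \<ge> Y" by linarith
    thus "ennreal (\<psi> s) * indicator {0<..} s * ennreal (?m s)
      \<le> ennreal (?p * (c + e)) * (?w s) + ennreal (?p * Y powr \<alpha>) * (?v s)"
    proof cases
      case 2
      have "1 = (x * s) powr \<alpha> * (x * s) powr (- \<alpha>)" using 2 x by (simp add: powr_minus field_simps)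
      also have "\<dots> \<le> Y powr \<alpha> * (x * s) powr (- \<alpha>)"
        using 2 x \<alpha> by (intro mult_right_mono powr_mono2) auto
      finally have "?m s \<le> Y powr \<alpha> * (x * s) powr (- \<alpha>)"
        using KP.prob_le_1[of x "{x + x * s<..}"] by linarith
      hence "\<psi> s * ?m s \<le> \<psi> s * (Y powr \<alpha> * (x * s) powr (- \<alpha>))"
        by (intro mult_left_mono \<psi>)
      also have "\<dots> = ?p * Y powr \<alpha> * (?u s)"
        using scale[OF 2(1)] by simp
      finally have "ennreal (\<psi> s * ?m s) \<le> ennreal (?p * Y powr \<alpha> * (?u s))"
        by (rule ennreal_leI)
      moreover have "s < Y / x" using 2 x by (simp add: field_simps)
      ultimately show ?thesis using 2(1) \<psi>
        by (simp add: ennreal_mult'[symmetric] ennreal_mult[symmetric] add_increasing)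
    next
      case 3
      have "\<psi> s * ?m s \<le> \<psi> s * ((c + e) * (x * s) powr (- \<alpha>))"
        using Y(2)[OF 3(2)] by (intro mult_left_mono \<psi>)
      also have "\<dots> = ?p * (c + e) * (?u s)"
        using scale[OF 3(1)] by simp
      finally have "ennreal (\<psi> s * ?m s) \<le> ennreal (?p * (c + e) * (?u s))"
        by (rule ennreal_leI)
      moreover have "ennreal (?p * (c + e) * (?u s)) = ennreal (?p * (c + e)) * ennreal (?u s)"
        using c e by (intro ennreal_mult') auto
      moreover have "ennreal (\<psi> s * ?m s) = ennreal (\<psi> s) * ennreal (?m s)"
        using \<psi> by (intro ennreal_mult') auto
      ultimately show ?thesis using 3(1)
        by (intro order.trans[OF _ add_increasing2[OF _ order.refl]]) auto
    qed auto
  qed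
  also have "\<dots> = ennreal (?p * (c + e)) * ennreal ?J
      + ennreal (?p * Y powr \<alpha>) * (\<integral>\<^sup>+s. ?v s \<partial>lborel)"
    by (subst nn_integral_add, measurable) (simp add: nn_integral_cmult J)
  also have "\<dots> \<le> ennreal (?p * (c + e)) * ennreal ?J + ennreal (?p * Y powr \<alpha>) * ennreal r"
    by (intro add_left_mono mult_left_mono R) auto
  also have "\<dots> = ennreal (?p * ((c + e) * ?J + Y powr \<alpha> * r))"
  proof -
    have "ennreal (?p * (c + e)) * ennreal ?J + ennreal (?p * Y powr \<alpha>) * ennreal r
      = ennreal (?p * (c + e) * ?J) + ennreal (?p * Y powr \<alpha> * r)"
      using c e J0 r by (subst (1 2) ennreal_mult[symmetric]) auto
    also have "\<dots> = ennreal (?p * (c + e) * ?J + ?p * Y powr \<alpha> * r)"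
      using c e J0 r by (intro ennreal_plus[symmetric]) auto
    finally show ?thesis by (simp add: algebra_simps)
  qed
  finally show "pos_int \<nu> x \<le> ennreal (?p * ((c + e) * ?J + Y powr \<alpha> * r))" .
  have "ennreal (?p * (c - e)) * ennreal ?J
      = (\<integral>\<^sup>+s. ennreal (?p * (c - e)) * (?w s) \<partial>lborel)"
    by (subst nn_integral_cmult) (auto simp: J)
  also have "\<dots> \<le> (\<integral>\<^sup>+s. ennreal (\<psi> s) * indicator {0<..} s * ennreal (?m s)
      + ennreal (?p * c) * (?v s) \<partial>lborel)"
  proof (intro nn_integral_mono)
    fix s :: real
    have mult: "ennreal (?p * d) * ennreal (?u s) = ennreal (?p * d * (?u s))"
      if "d \<ge> 0" for d
      using that by (intro ennreal_mult'[symmetric]) auto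
    consider "s \<le> 0" | "s > 0" "x * s < Y" | "s > 0" "x * s \<ge> Y" by linarith
    thus "ennreal (?p * (c - e)) * (?w s)
      \<le> ennreal (\<psi> s) * indicator {0<..} s * ennreal (?m s)
      + ennreal (?p * c) * (?v s)"
    proof cases
      case 2
      have "?p * (c - e) * (?u s) \<le> ?p * c * (?u s)"
        using e \<psi> by (intro mult_right_mono mult_left_mono) auto
      hence "ennreal (?p * (c - e)) * ennreal (?u s) \<le> ennreal (?p * c) * ennreal (?u s)"
        using e c by (simp only: mult) (simp add: ennreal_leI mult)
      moreover have "s < Y / x" using 2 x by (simp add: field_simps)
      ultimately show ?thesis using 2(1) by (intro order.trans[OF _ add_increasing[OF _ order.refl]]) auto
    next
      case 3
      have "?p * (c - e) * (?u s) = \<psi> s * ((c - e) * (x * s) powr (- \<alpha>))"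
        using scale[OF 3(1)] by simp
      also have "\<dots> \<le> \<psi> s * ?m s"
        using Y(3)[OF 3(2)] by (intro mult_left_mono \<psi>)
      finally have "ennreal (?p * (c - e) * (?u s)) \<le> ennreal (\<psi> s * ?m s)"
        by (rule ennreal_leI)
      moreover have "ennreal (\<psi> s * ?m s) = ennreal (\<psi> s) * ennreal (?m s)"
        using \<psi> by (intro ennreal_mult') auto
      moreover have "c - e \<ge> 0" using e by simp
      note mult[OF this]
      ultimately show ?thesis using 3(1)
        by (intro order.trans[OF _ add_increasing2[OF _ order.refl]]) auto
    qed auto
  qed
  also have "\<dots> = pos_int \<nu> x
      + ennreal (?p * c) * (\<integral>\<^sup>+s. ?v s \<partial>lborel)"
    unfolding pos_int
  proof (subst nn_integral_add)
    \<comment> \<open>Measurability in s follows from monotonicity of the tail.\<close>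
    have "(\<lambda>s. ?m s) \<in> borel_measurable borel"
    proof -
      have "mono (\<lambda>s. - ?m s)"
      proof (rule monoI)
        fix s t :: real assume "s \<le> t"
        hence "x * s \<le> x * t" using x by (intro mult_left_mono) auto
        thus "- ?m s \<le> - measure (K x) {x + x * t<..}"
          by (auto intro!: KP.finite_measure_mono)
      qed
      hence "(\<lambda>s. - ?m s) \<in> borel_measurable borel"
        by (rule borel_measurable_mono)
      thus ?thesis by simp
    qed
    thus "(\<lambda>s. ennreal (\<psi> s) * indicator {0<..} s * ennreal (?m s)) \<in> borel_measurable lborel"
      by measurable
  qed (auto simp: nn_integral_cmult)
  also have "\<dots> \<le> pos_int \<nu> x + ennreal (?p * c) * ennreal r"
    by (intro add_left_mono mult_left_mono R) auto
  finally show "ennreal (?p * ((c - e) * ?J)) \<le> pos_int \<nu> x + ennreal (?p * (c * r))"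
    using e c J0 r by (simp add: ennreal_mult'[symmetric] ennreal_mult[symmetric] mult.assoc)
qed

lemma pos_int_asymp:
  assumes \<nu>: "0 < \<nu>" "\<nu> < \<alpha>" and \<epsilon>: "0 < \<epsilon>"
  shows "\<exists>X>0. \<forall>x\<in>S. x \<ge> x0 \<longrightarrow> x \<ge> X \<longrightarrow> pos_int \<nu> x \<noteq> top \<and>
    \<bar>enn2real (pos_int \<nu> x) - c * incr_int \<nu> * x powr (- \<alpha>)\<bar> \<le> \<epsilon> * x powr (- \<alpha>)"
proof -
  define J where "J = incr_int \<nu>"
  have J: "J \<ge> 0" unfolding J_def by (rule incr_int_nonneg[OF \<nu>])
  \<comment> \<open>The bound e \<le> c keeps c - e nonnegative, and J + 1 in place of J covers J =
    0, which occurs at \<nu> = 1.\<close>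
  define e where "e = min c (\<epsilon> / (2 * (J + 1)))"
  have e: "e > 0" "e \<le> c" using \<epsilon> c J by (auto simp: e_def)
  have eJ: "e * J \<le> \<epsilon> / 2"
  proof -
    have "e * J \<le> \<epsilon> / (2 * (J + 1)) * (J + 1)" using e J \<epsilon> by (intro mult_mono) (auto simp: e_def)
    also have "\<dots> = \<epsilon> / 2" using J by (simp add: field_simps)
    finally show ?thesis .
  qed
  obtain Y where Y: "Y > 0"
    "\<And>y x. y \<ge> Y \<Longrightarrow> x \<in> S \<Longrightarrow> x \<ge> x0 \<Longrightarrow> upper x y \<le> (c + e) * y powr (- \<alpha>)"
    "\<And>y x. y \<ge> Y \<Longrightarrow> x \<in> S \<Longrightarrow> x \<ge> x0 \<Longrightarrow> (c - e) * y powr (- \<alpha>) \<le> upper x y"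
    using tail_bounds[OF e(1)] by metis
  define r where "r x = 2 * ((Y / x) powr (2 - \<alpha>) / (2 - \<alpha>))" for x
  have "((\<lambda>x. (Y powr \<alpha> + c) * r x) \<longlongrightarrow> (Y powr \<alpha> + c) * (2 * (0 / (2 - \<alpha>)))) at_top"
    unfolding r_def
  proof (intro tendsto_mult tendsto_divide tendsto_const)
    have "((\<lambda>x. Y / x) \<longlongrightarrow> 0) at_top"
      by (rule real_tendsto_divide_at_top[OF tendsto_const filterlim_ident])
    thus "((\<lambda>x. (Y / x) powr (2 - \<alpha>)) \<longlongrightarrow> 0) at_top"
      using \<alpha> Y(1) by (intro tendsto_zero_powrI[where b = "2 - \<alpha>"] tendsto_const)
        (auto intro!: eventually_mono[OF eventually_ge_at_top[of 0]])
  qed (use \<alpha> in auto)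
  hence "eventually (\<lambda>x. (Y powr \<alpha> + c) * r x < \<epsilon> / 2) at_top"
    using \<epsilon> by (intro order_tendstoD(2)) auto
  then obtain X where X: "\<And>x. x \<ge> X \<Longrightarrow> (Y powr \<alpha> + c) * r x < \<epsilon> / 2"
    unfolding eventually_at_top_linorder by blast
  show ?thesis
  proof (intro exI[of _ "max 1 X"] conjI[of "max 1 X > 0"] ballI impI)
    fix x assume x: "x \<in> S" "x \<ge> x0" "x \<ge> max 1 X"
    have r: "r x \<ge> 0" using \<alpha> by (simp add: r_def)
    have rX: "Y powr \<alpha> * r x + c * r x < \<epsilon> / 2" using X[of x] x by (simp add: algebra_simps)
    have nn: "0 \<le> Y powr \<alpha> * r x" "0 \<le> c * r x" using r c by auto
    have up: "pos_int \<nu> x \<le> ennreal (x powr (- \<alpha>) * ((c + e) * J + Y powr \<alpha> * r x))"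
      and low: "ennreal (x powr (- \<alpha>) * ((c - e) * J)) \<le> pos_int \<nu> x + ennreal (x powr (- \<alpha>) * (c * r x))"
      unfolding r_def J_def using x by (intro pos_int_bounds[OF \<nu> e Y(1) Y(2) Y(3)]; simp)+
    obtain i where i: "pos_int \<nu> x = ennreal i" "i \<ge> 0"
      using up by (cases "pos_int \<nu> x") (auto simp: top_unique)
    have up': "i \<le> x powr (- \<alpha>) * ((c + e) * J + Y powr \<alpha> * r x)"
      using up e c J nn unfolding i by (subst (asm) ennreal_le_iff) auto
    have low': "x powr (- \<alpha>) * ((c - e) * J) \<le> i + x powr (- \<alpha>) * (c * r x)"
      using low e c J nn i(2) unfolding i(1) by (subst (asm) ennreal_plus[symmetric]) (auto simp del: ennreal_plus)
    have "x powr (- \<alpha>) * ((c + e) * J + Y powr \<alpha> * r x) \<le> x powr (- \<alpha>) * (c * J + \<epsilon>)"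
      using eJ rX nn \<epsilon> by (intro mult_left_mono) (auto simp: algebra_simps)
    moreover have "x powr (- \<alpha>) * (c * J - \<epsilon>) \<le> x powr (- \<alpha>) * ((c - e) * J - c * r x)"
      using eJ rX nn \<epsilon> by (intro mult_left_mono) (auto simp: algebra_simps)
    ultimately have "\<bar>i - c * J * x powr (- \<alpha>)\<bar> \<le> \<epsilon> * x powr (- \<alpha>)"
      using up' low' by (simp add: abs_le_iff algebra_simps)
    thus "pos_int \<nu> x \<noteq> top \<and> \<bar>enn2real (pos_int \<nu> x) - c * incr_int \<nu> * x powr (- \<alpha>)\<bar> \<le> \<epsilon> * x powr (- \<alpha>)"
      using i by (simp add: J_def)
  qed auto
qed


text \<open>The remainder is the integral of its derivative up to the relative jump, so the layer
  cake formula gives an exact identity, with the sign of \<nu> - 1 restored.\<close>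

lemma integral_positive_part:
  assumes x: "x > 0" and \<nu>: "0 < \<nu>" and fin: "pos_int \<nu> x \<noteq> top"
  defines "P \<equiv> \<lambda>y. (1 + max 0 ((y - x) / x)) powr \<nu> - 1 - \<nu> * max 0 ((y - x) / x)"
  shows "integrable (K x) P" and "(\<integral>y. P y \<partial>K x) = sgn (\<nu> - 1) * enn2real (pos_int \<nu> x)"
proof -
  define F where "F u = sgn (\<nu> - 1) * ((1 + u) powr \<nu> - 1 - \<nu> * u)" for u
  have F: "F u \<ge> 0" "(\<integral>\<^sup>+s. ennreal (\<nu> * \<bar>(1 + s) powr (\<nu> - 1) - 1\<bar>) * indicator {0<..<u} s \<partial>lborel) = ennreal (F u)"
    "(1 + u) powr \<nu> - 1 - \<nu> * u = sgn (\<nu> - 1) * F u" if "u \<ge> 0" for u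
    using power_remainder_nonneg[OF \<nu> that] by (auto simp: F_def)
  have [measurable]: "F \<in> borel_measurable borel" unfolding F_def by measurable
  have eq: "(\<integral>\<^sup>+s. ennreal (\<nu> * \<bar>(1 + s) powr (\<nu> - 1) - 1\<bar>) * indicator {0<..<t} s \<partial>lborel) = ennreal (F (max 0 t))" for t
  proof (cases "t \<ge> 0")
    case False
    thus ?thesis by (simp add: F_def)
  qed (simp add: F(2))
  have nn: "(\<integral>\<^sup>+y. ennreal (F (max 0 ((y - x) / x))) \<partial>K x) = pos_int \<nu> x"
    unfolding eq[symmetric] pos_int_def by (rule nn_integral_layer_K[OF x]) measurable
  have intF: "integrable (K x) (\<lambda>y. F (max 0 ((y - x) / x)))"
    using F(1) fin nn by (intro integrableI_nonneg) (auto simp: top.not_eq_extremum)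
  have P: "P = (\<lambda>y. sgn (\<nu> - 1) * F (max 0 ((y - x) / x)))"
    unfolding P_def by (intro ext F(3)) auto
  show "integrable (K x) P" unfolding P using intF by simp
  have "(\<integral>y. F (max 0 ((y - x) / x)) \<partial>K x) = enn2real (pos_int \<nu> x)"
    unfolding nn[symmetric] using F(1) by (intro integral_eq_nn_integral) auto
  thus "(\<integral>y. P y \<partial>K x) = sgn (\<nu> - 1) * enn2real (pos_int \<nu> x)" unfolding P by simp
qed

text \<open>Downward jumps have a moment of order \<beta> > \<alpha>, and the Taylor remainder is at
  best quadratic. The relative contribution has order \<open>x powr (- min \<beta> 2)\<close>, which
  is smaller than \<open>x powr (- \<alpha>)\<close>.\<close>

lemma integral_negative_part:
  assumes \<nu>: "0 < \<nu>" "\<nu> < \<alpha>"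
  defines "N \<equiv> \<lambda>x y. (1 + min 0 ((y - x) / x)) powr \<nu> - 1 - \<nu> * min 0 ((y - x) / x)"
  shows "\<exists>C\<ge>0. \<forall>x\<in>S. x \<ge> x0 \<longrightarrow> x > 0 \<longrightarrow> integrable (K x) (N x) \<and> \<bar>\<integral>y. N x y \<partial>K x\<bar> \<le> C * x powr (- min \<beta> 2)"
proof -
  obtain CL where CL: "\<And>x. x \<in> S \<Longrightarrow> x \<ge> x0 \<Longrightarrow> left_moment x \<le> ennreal CL"
    using left by blast
  define \<eta> where "\<eta> = min \<beta> 2"
  have \<eta>: "1 \<le> \<eta>" "\<eta> \<le> 2" "\<nu> \<le> \<eta>" "\<eta> \<le> \<beta>" using \<alpha> \<beta> \<nu> by (auto simp: \<eta>_def)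
  show ?thesis
  proof (intro exI[of _ "28 * (1 + \<bar>CL\<bar>)"] conjI[of "28 * (1 + \<bar>CL\<bar>) \<ge> 0"] ballI impI)
    fix x assume x: "x \<in> S" "x \<ge> x0" "x > 0"
    let ?C = "28 * (1 + \<bar>CL\<bar>) * x powr (- \<eta>)"
    have [measurable]: "N x \<in> borel_measurable borel" unfolding N_def by measurable
    have [measurable]: "negpart \<in> borel_measurable borel" unfolding negpart_def[abs_def] by measurable
    have bound: "AE y in K x. ennreal (norm (N x y)) \<le> ennreal (28 * x powr (- \<eta>)) * (1 + ennreal (negpart (y - x) powr \<beta>))"
      using AE_K[OF x(1)]
    proof eventually_elim
      case (elim y)
      define u where "u = negpart (y - x)"
      have u: "u \<ge> 0" by (simp add: u_def negpart_def)
      have y: "y \<ge> 0" using elim S_nonneg by auto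
      have t: "min 0 ((y - x) / x) \<ge> -1" using x y by (simp add: field_simps min_def)
      have abs: "\<bar>min 0 ((y - x) / x)\<bar> = u / x"
        using x by (auto simp: u_def negpart_def min_def field_simps)
      have u_le: "u powr \<eta> \<le> 1 + u powr \<beta>"
        using u \<eta> by (intro powr_le_one_plus_powr) auto
      have "norm (N x y) \<le> 28 * \<bar>min 0 ((y - x) / x)\<bar> powr \<eta>"
        unfolding N_def real_norm_def using \<nu> \<eta> t by (intro powr_first_order_remainder) auto
      also have "\<dots> = 28 * x powr (- \<eta>) * u powr \<eta>"
        unfolding abs using x u by (simp add: powr_divide powr_minus_divide)
      also have "\<dots> \<le> 28 * x powr (- \<eta>) * (1 + u powr \<beta>)"
        using u_le by (intro mult_left_mono) auto
      finally have "norm (N x y) \<le> 28 * x powr (- \<eta>) * (1 + u powr \<beta>)" .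
      hence "ennreal (norm (N x y)) \<le> ennreal (28 * x powr (- \<eta>) * (1 + u powr \<beta>))"
        by (rule ennreal_leI)
      also have "\<dots> = ennreal (28 * x powr (- \<eta>)) * (1 + ennreal (u powr \<beta>))"
        by (subst ennreal_mult') auto
      finally show ?case by (simp add: u_def)
    qed
    have "(\<integral>\<^sup>+y. ennreal (norm (N x y)) \<partial>K x) \<le> (\<integral>\<^sup>+y. ennreal (28 * x powr (- \<eta>)) * (1 + ennreal (negpart (y - x) powr \<beta>)) \<partial>K x)"
      by (rule nn_integral_mono_AE[OF bound])
    also have "\<dots> = ennreal (28 * x powr (- \<eta>)) * (1 + left_moment x)"
      by (simp add: nn_integral_cmult nn_integral_add)
    also have "\<dots> \<le> ennreal (28 * x powr (- \<eta>)) * (1 + ennreal \<bar>CL\<bar>)"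
      using CL[OF x(1,2)] by (intro mult_left_mono add_left_mono) (auto elim!: order_trans intro!: ennreal_leI)
    also have "\<dots> = ennreal ?C"
    proof -
      have "1 + ennreal \<bar>CL\<bar> = ennreal (1 + \<bar>CL\<bar>)" by simp
      thus ?thesis by (simp only: ennreal_mult'[symmetric] mult_nonneg_nonneg powr_ge_zero zero_le_numeral mult_ac)
    qed
    finally have nn: "(\<integral>\<^sup>+y. ennreal (norm (N x y)) \<partial>K x) \<le> ennreal ?C" .
    have int: "integrable (K x) (N x)"
      using nn by (intro integrableI_bounded) (auto simp: le_less_trans)
    have "ennreal (norm (\<integral>y. N x y \<partial>K x)) \<le> (\<integral>\<^sup>+y. ennreal (norm (N x y)) \<partial>K x)"
      by (rule integral_norm_bound_ennreal[OF int])
    also note nn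
    finally have "\<bar>\<integral>y. N x y \<partial>K x\<bar> \<le> ?C" by (subst (asm) ennreal_le_iff) auto
    thus "integrable (K x) (N x) \<and> \<bar>\<integral>y. N x y \<partial>K x\<bar> \<le> 28 * (1 + \<bar>CL\<bar>) * x powr (- min \<beta> 2)"
      using int by (simp add: \<eta>_def)
  qed auto
qed

text \<open>At order \<open>x powr (\<nu> - \<alpha>)\<close> only upward jumps remain once the
  linear term is removed: their tail constant enters through \<open>incr_int\<close>, and downward
  jumps fall into the error.\<close>

lemma drift_power_sharp:
  assumes \<nu>: "0 < \<nu>" "\<nu> < \<alpha>" and \<epsilon>: "\<epsilon> > 0"
  shows "\<exists>X>0. \<forall>x\<in>S. x \<ge> x0 \<longrightarrow> x \<ge> X \<longrightarrow> finite_moment \<nu> x \<and>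
    \<bar>moment \<nu> x - x powr \<nu> - \<nu> * x powr (\<nu> - 1) * mean x - sgn (\<nu> - 1) * (c * incr_int \<nu>) * x powr (\<nu> - \<alpha>)\<bar>
      \<le> \<epsilon> * x powr (\<nu> - \<alpha>)"
proof -
  obtain X1 where X1: "X1 > 0" "\<And>x. x \<in> S \<Longrightarrow> x \<ge> x0 \<Longrightarrow> x \<ge> X1 \<Longrightarrow> pos_int \<nu> x \<noteq> top \<and>
    \<bar>enn2real (pos_int \<nu> x) - c * incr_int \<nu> * x powr (- \<alpha>)\<bar> \<le> \<epsilon> / 2 * x powr (- \<alpha>)"
    using pos_int_asymp[OF \<nu>, of "\<epsilon> / 2"] \<epsilon> by auto
  define \<phi> where "\<phi> t = (1 + t) powr \<nu> - 1 - \<nu> * t" for t :: real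
  obtain C where C: "C \<ge> 0" "\<And>x. x \<in> S \<Longrightarrow> x \<ge> x0 \<Longrightarrow> x > 0 \<Longrightarrow>
    integrable (K x) (\<lambda>y. \<phi> (min 0 ((y - x) / x))) \<and> \<bar>\<integral>y. \<phi> (min 0 ((y - x) / x)) \<partial>K x\<bar> \<le> C * x powr (- min \<beta> 2)"
    using integral_negative_part[OF \<nu>] unfolding \<phi>_def by blast
  obtain C' where C': "\<And>x. x \<in> S \<Longrightarrow> x \<ge> x0 \<Longrightarrow> x > 0 \<Longrightarrow> finite_moment \<nu> x"
    using drift_power_coarse[of \<nu> "max 1 \<nu>"] \<nu> \<alpha> by auto
  obtain X2 where X2: "X2 > 0" "\<And>x. x \<ge> X2 \<Longrightarrow> C * x powr (- (min \<beta> 2 - \<alpha>)) \<le> \<epsilon> / 2"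
    using powr_small[of "min \<beta> 2 - \<alpha>" "\<epsilon> / 2" C] \<alpha> \<beta> \<epsilon> by auto
  show ?thesis
  proof (intro exI[of _ "max X1 X2"] conjI[of "max X1 X2 > 0"] ballI impI)
    fix x assume x: "x \<in> S" "x \<ge> x0" "x \<ge> max X1 X2"
    have xpos: "x > 0" using x X1 by auto
    define P where "P y = \<phi> (max 0 ((y - x) / x))" for y
    define N where "N y = \<phi> (min 0 ((y - x) / x))" for y
    have fin: "pos_int \<nu> x \<noteq> top"
      and asym: "\<bar>enn2real (pos_int \<nu> x) - c * incr_int \<nu> * x powr (- \<alpha>)\<bar> \<le> \<epsilon> / 2 * x powr (- \<alpha>)"
      using X1(2)[OF x(1,2)] x by auto
    have P: "integrable (K x) P" "(\<integral>y. P y \<partial>K x) = sgn (\<nu> - 1) * enn2real (pos_int \<nu> x)"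
      using integral_positive_part[OF xpos \<nu>(1) fin] by (auto simp: P_def[abs_def] \<phi>_def)
    have N: "integrable (K x) N" "\<bar>\<integral>y. N y \<partial>K x\<bar> \<le> C * x powr (- min \<beta> 2)"
      using C(2)[OF x(1,2) xpos] by (auto simp: N_def[abs_def])
    have int: "finite_moment \<nu> x" by (rule C'[OF x(1,2) xpos])
    have "moment \<nu> x - x powr \<nu> - \<nu> * x powr (\<nu> - 1) * mean x
        = (\<integral>y. y powr \<nu> - x powr \<nu> - \<nu> * x powr (\<nu> - 1) * (y - x) \<partial>K x)"
      by (rule integral_power_remainder[symmetric, OF x(1,2) int])
    also have "\<dots> = (\<integral>y. x powr \<nu> * (P y + N y) \<partial>K x)"
    proof (rule integral_cong_AE)
      show "AE y in K x. y powr \<nu> - x powr \<nu> - \<nu> * x powr (\<nu> - 1) * (y - x) = x powr \<nu> * (P y + N y)"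
        using AE_K[OF x(1)]
      proof eventually_elim
        case (elim y)
        hence "y \<ge> 0" using S_nonneg by auto
        \<comment> \<open>The remainder vanishes at 0, so it splits into its values at the positive
          and the negative part of the relative increment.\<close>
        moreover have "\<phi> ((y - x) / x) = P y + N y"
          by (cases "(y - x) / x \<ge> 0") (auto simp: P_def N_def \<phi>_def max_def min_def)
        ultimately show ?case using power_expansion[OF xpos, of y \<nu>] by (simp add: \<phi>_def)
      qed
    qed (auto simp: P_def[abs_def] N_def[abs_def] \<phi>_def)
    also have "\<dots> = x powr \<nu> * (\<integral>y. P y + N y \<partial>K x)" by simp
    also have "(\<integral>y. P y + N y \<partial>K x) = (\<integral>y. P y \<partial>K x) + (\<integral>y. N y \<partial>K x)"
      by (rule Bochner_Integration.integral_add[OF P(1) N(1)])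
    finally have eq: "moment \<nu> x - x powr \<nu> - \<nu> * x powr (\<nu> - 1) * mean x
      = x powr \<nu> * (sgn (\<nu> - 1) * enn2real (pos_int \<nu> x) + (\<integral>y. N y \<partial>K x))"
      by (simp only: P(2))
    have pa: "x powr (\<nu> - \<alpha>) = x powr \<nu> * x powr (- \<alpha>)" by (simp add: powr_add[symmetric])
    have "moment \<nu> x - x powr \<nu> - \<nu> * x powr (\<nu> - 1) * mean x - sgn (\<nu> - 1) * (c * incr_int \<nu>) * x powr (\<nu> - \<alpha>)
      = x powr \<nu> * (sgn (\<nu> - 1) * (enn2real (pos_int \<nu> x) - c * incr_int \<nu> * x powr (- \<alpha>)) + (\<integral>y. N y \<partial>K x))"
      unfolding eq pa by (simp add: algebra_simps)
    also have "\<bar>\<dots>\<bar> \<le> x powr \<nu> * (\<epsilon> / 2 * x powr (- \<alpha>) + \<epsilon> / 2 * x powr (- \<alpha>))"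
    proof -
      have 1: "\<bar>sgn (\<nu> - 1) * (enn2real (pos_int \<nu> x) - c * incr_int \<nu> * x powr (- \<alpha>))\<bar> \<le> 1 * (\<epsilon> / 2 * x powr (- \<alpha>))"
        unfolding abs_mult using asym by (intro mult_mono) (auto simp: sgn_if)
      have "C * x powr (- min \<beta> 2) = C * x powr (- (min \<beta> 2 - \<alpha>)) * x powr (- \<alpha>)"
        by (simp add: mult.assoc powr_add[symmetric])
      also have "\<dots> \<le> \<epsilon> / 2 * x powr (- \<alpha>)"
        using X2(2)[of x] x by (intro mult_right_mono) auto
      finally have 2: "\<bar>\<integral>y. N y \<partial>K x\<bar> \<le> \<epsilon> / 2 * x powr (- \<alpha>)" using N(2) by linarith
      have "\<bar>x powr \<nu> * z\<bar> = x powr \<nu> * \<bar>z\<bar>" for z by (simp add: abs_mult)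
      moreover have "x powr \<nu> * \<bar>z + w\<bar> \<le> x powr \<nu> * (e + f)" if "\<bar>z\<bar> \<le> 1 * e" "\<bar>w\<bar> \<le> f" for z w e f
        using that by (intro mult_left_mono) auto
      ultimately show ?thesis using 1 2 by (simp only:)
    qed
    also have "\<dots> = \<epsilon> * x powr (\<nu> - \<alpha>)" unfolding pa by (simp add: algebra_simps)
    finally show "finite_moment \<nu> x \<and>
      \<bar>moment \<nu> x - x powr \<nu> - \<nu> * x powr (\<nu> - 1) * mean x - sgn (\<nu> - 1) * (c * incr_int \<nu>) * x powr (\<nu> - \<alpha>)\<bar>
      \<le> \<epsilon> * x powr (\<nu> - \<alpha>)" using int by simp
  qed (use X1 in auto)
qed

text \<open>The recursion Gamma (2 - \<alpha>) = (1 - \<alpha>) Gamma (1 - \<alpha>) cancels the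
  factor \<alpha> - 1. The jump contribution thereby becomes the right side of the equation for
  \<open>\<nu>\<^sup>\<star>\<close>, up to the factor - c \<nu>.\<close>

lemma incr_int_nu_gamma:
  "0 < \<nu> \<Longrightarrow> sgn (\<nu> - 1) * (c * incr_int \<nu>) = - (c * \<nu> * (Gamma (1 - \<alpha>) * nu_gamma \<alpha> \<nu>))"
proof -
  assume "0 < \<nu>"
  have "sgn (\<nu> - 1) * \<bar>\<nu> - 1\<bar> = \<nu> - 1" by (simp add: sgn_mult_abs)
  hence "sgn (\<nu> - 1) * (c * incr_int \<nu>) = c * \<nu> * (\<nu> - 1) / (\<alpha> - 1) * (Gamma (2 - \<alpha>) * Gamma (\<alpha> - \<nu>) / Gamma (2 - \<nu>))"
    unfolding incr_int_def by (simp add: mult_ac)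
  also have "Gamma (2 - \<alpha>) = - ((\<alpha> - 1) * Gamma (1 - \<alpha>))"
    using Gamma_one_minus_neg(2)[OF \<alpha>] by (simp add: algebra_simps)
  finally have eq: "sgn (\<nu> - 1) * (c * incr_int \<nu>)
    = c * \<nu> * (\<nu> - 1) / (\<alpha> - 1) * (- ((\<alpha> - 1) * Gamma (1 - \<alpha>)) * Gamma (\<alpha> - \<nu>) / Gamma (2 - \<nu>))" .
  have "k / d * (- (d * g) * A / B) = - (k * g * (A / B))" if "d \<noteq> 0" for k d g A B :: real
    using that by simp
  from this[of "\<alpha> - 1"] show ?thesis using \<alpha> unfolding eq nu_gamma_def by (simp add: mult_ac)
qed

text \<open>The excursion above level \<open>a\<close> lasts for time \<open>n\<close> as soon as the first jump is of
  order \<open>n powr (1 / \<rho>)\<close>.\<close>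

lemma stay_series_jump:
  assumes \<rho>: "1 \<le> \<rho>" "\<rho> < \<alpha>" and mean: "\<And>x. x \<in> S \<Longrightarrow> x \<ge> x1 \<Longrightarrow> \<bar>mean x\<bar> \<le> B * x powr (1 - \<rho>)"
    and a: "a > 0" and x: "x \<in> S" "x > a" "x \<ge> x0" and q: "q \<ge> \<alpha> / \<rho>"
  shows "series a q x = top"
proof (rule ccontr)
  assume fin: "series a q x \<noteq> top"
  let ?E = "S \<inter> {a<..}"
  obtain \<delta> z0 where \<delta>: "\<delta> > 0" and z0: "z0 > 0" and
    stay: "\<And>a y n. y \<in> S \<Longrightarrow> y \<ge> 2 * a \<Longrightarrow> y \<ge> z0 \<Longrightarrow> real n \<le> \<delta> * y powr \<rho> \<Longrightarrow>
      ennreal (1 / 4) \<le> stay K (S \<inter> {a<..}) n y"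
    using stay_ge_quarter[OF \<rho> mean] by metis
  obtain Y where Y: "Y > 0" "\<And>y. y \<ge> Y \<Longrightarrow> (c - c / 2) * y powr (- \<alpha>) \<le> upper x y"
    using tail_bounds[of "c / 2"] c x by (metis half_gt_zero)
  define h where "h n = (real n / \<delta>) powr (1 / \<rho>)" for n
  \<comment> \<open>The factor c / 8 is half the tail constant times the survival probability 1/4;
    the power of \<delta> converts the level \<open>h n\<close> back into n.\<close>
  define C where "C = c / 8 * \<delta> powr (\<alpha> / \<rho>)"
  have C: "C > 0" using c \<delta> by (simp add: C_def)
  define H where "H = 2 * a + z0 + Y + x"
  have H: "H > 0" using a z0 Y x by (simp add: H_def)
  define n0 where "n0 = nat \<lceil>\<delta> * H powr \<rho>\<rceil>"
  have n0: "h n \<ge> 2 * a + z0 + Y + x" if "n \<ge> n0" for n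
  proof -
    have "\<delta> * H powr \<rho> \<le> real n" using that unfolding n0_def by linarith
    hence "H powr \<rho> \<le> real n / \<delta>" using \<delta> by (simp add: field_simps)
    hence "(H powr \<rho>) powr (1 / \<rho>) \<le> h n"
      unfolding h_def using \<rho> by (intro powr_mono2) auto
    thus ?thesis using \<rho> H by (simp add: powr_powr H_def)
  qed
  have lower: "ennreal (C * real (Suc n) powr (- \<alpha> / \<rho>)) \<le> stay K ?E (Suc n) x" if n: "n \<ge> n0" "n > 0" for n
  proof -
    have hn: "h n \<ge> 2 * a" "h n \<ge> z0" "h n - x \<ge> Y" "h n > 0" "x > 0"
      using n0[OF n(1)] a z0 Y x by auto
    have "C * real (Suc n) powr (- \<alpha> / \<rho>) \<le> C * real n powr (- \<alpha> / \<rho>)"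
      using C n \<alpha> \<rho> by (intro mult_left_mono powr_mono2') auto
    also have "\<dots> = c / 8 * h n powr (- \<alpha>)"
      using \<delta> n by (simp add: C_def h_def powr_powr powr_divide powr_minus_divide field_simps)
    also have "\<dots> \<le> c / 8 * (h n - x) powr (- \<alpha>)"
      using hn Y(1) c \<alpha> by (intro mult_left_mono powr_mono2') auto
    also have "\<dots> \<le> 1 / 4 * measure (K x) {h n<..}"
      using Y(2)[OF hn(3)] by simp
    finally have "ennreal (C * real (Suc n) powr (- \<alpha> / \<rho>)) \<le> ennreal (1 / 4 * measure (K x) {h n<..})"
      by (rule ennreal_leI)
    also have "\<dots> = ennreal (1 / 4) * ennreal (measure (K x) {h n<..})"
      by (rule ennreal_mult') simp
    also have "\<dots> = (\<integral>\<^sup>+y. ennreal (1 / 4) * indicator {h n<..} y \<partial>K x)"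
      by (subst nn_integral_cmult) (auto simp: KP.emeasure_eq_measure)
    also have "\<dots> \<le> (\<integral>\<^sup>+y. stay K ?E n y \<partial>K x)"
    proof (rule nn_integral_mono_AE)
      show "AE y in K x. ennreal (1 / 4) * indicator {h n<..} y \<le> stay K ?E n y"
        using AE_K[OF x(1)]
      proof eventually_elim
        case (elim y)
        show ?case
        proof (cases "y > h n")
          case True
          have "real n = \<delta> * h n powr \<rho>" using \<delta> n \<rho> by (simp add: h_def powr_powr)
          also have "\<dots> \<le> \<delta> * y powr \<rho>"
            using True hn \<delta> \<rho> by (intro mult_left_mono powr_mono2) auto
          finally have "ennreal (1 / 4) \<le> stay K ?E n y"
            using True hn elim by (intro stay) auto
          thus ?thesis using True by (simp del: ennreal_divide_numeral)
        qed simp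
      qed
    qed
    also have "\<dots> = stay K ?E (Suc n) x" using x by (simp add: stay_Suc killed_in)
    finally show ?thesis .
  qed
  \<comment> \<open>The shift by two makes the predecessor of n + m both positive and at least
    n0.\<close>
  define m where "m = Suc (Suc n0)"
  define t where "t n = ennreal (real (Suc n) powr (q - 1)) * stay K ?E n x" for n
  have "ennreal (C * (1 / real (n + m + 1))) \<le> t (n + m)" for n
  proof -
    obtain k where k: "n + m = Suc k" "k \<ge> n0" "k > 0" by (auto simp: m_def intro: that[of "Suc (n + n0)"])
    have "C * (1 / real (n + m + 1)) = C * real (Suc (Suc k)) powr (-1)"
      unfolding k(1) by (simp add: powr_minus_divide)
    \<comment> \<open>Here q \<ge> \<alpha> / \<rho> keeps the exponent at or above -1, so the
      comparison with the harmonic series includes the boundary value of q.\<close>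
    also have "\<dots> \<le> C * real (Suc (Suc k)) powr (q - 1 - \<alpha> / \<rho>)"
      using C q by (intro mult_left_mono powr_mono) auto
    also have "\<dots> = real (Suc (Suc k)) powr (q - 1) * (C * real (Suc (Suc k)) powr (- \<alpha> / \<rho>))"
      by (simp add: powr_add[symmetric])
    also have "\<dots> \<le> real (Suc (Suc k)) powr (q - 1) * (C * real (Suc k) powr (- \<alpha> / \<rho>))"
      using C \<alpha> \<rho> by (intro mult_left_mono powr_mono2') auto
    finally have "ennreal (C * (1 / real (n + m + 1))) \<le> ennreal (real (Suc (Suc k)) powr (q - 1)) * ennreal (C * real (Suc k) powr (- \<alpha> / \<rho>))"
      using C by (subst ennreal_mult'[symmetric]) (auto intro: ennreal_leI)
    also have "\<dots> \<le> t (n + m)" unfolding t_def k(1) using lower[OF k(2,3)] by (intro mult_left_mono) auto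
    finally show ?thesis .
  qed
  hence "(\<Sum>n. ennreal (C * (1 / real (n + m + 1)))) \<le> (\<Sum>n. t (n + m))"
    by (intro suminf_le) auto
  also have "\<dots> \<le> (\<Sum>n. t n)"
  proof (rule suminf_le_const)
    fix N
    have "(\<Sum>n<N. t (n + m)) = (\<Sum>n\<in>(\<lambda>n. n + m) ` {..<N}. t n)"
      by (subst sum.reindex) auto
    also have "\<dots> \<le> (\<Sum>n. t n)" by (intro sum_le_suminf) auto
    finally show "(\<Sum>n<N. t (n + m)) \<le> (\<Sum>n. t n)" .
  qed auto
  also have "\<dots> < top" using fin by (simp add: t_def stay_series_def top.not_eq_extremum)
  finally have "summable (\<lambda>n. C * (1 / real (n + m + 1)))"
    using C by (intro summable_suminf_not_top) auto
  hence "summable (\<lambda>n. 1 / C * (C * (1 / real (n + m + 1))))" by (rule summable_mult)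
  also have "(\<lambda>n. 1 / C * (C * (1 / real (n + m + 1)))) = (\<lambda>n. 1 / real (n + (m + 1)))"
    using C by (simp add: fun_eq_iff add.assoc)
  finally have "summable (\<lambda>n. 1 / real (n + (m + 1)))" .
  hence "summable (\<lambda>n. 1 / real n)" by (subst (asm) summable_iff_shift)
  thus False using not_summable_harmonic[where 'a = real] by (simp add: inverse_eq_divide)
qed

section \<open>Finite and infinite moments\<close>


text \<open>The drift condition indexed by \<rho> = \<gamma> + 1, the exponent relating time to
  height, in place of \<gamma>.\<close>

definition mean_limit :: "real \<Rightarrow> real \<Rightarrow> bool" where
  "mean_limit \<rho> b \<longleftrightarrow> (\<forall>e>0. \<exists>X. \<forall>x\<in>S. x \<ge> X \<longrightarrow> \<bar>x powr (\<rho> - 1) * mean x - b\<bar> \<le> e)"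

lemma mean_limitD:
  "mean_limit \<rho> b \<Longrightarrow> e > 0 \<Longrightarrow> \<exists>X. \<forall>x\<in>S. x \<ge> X \<longrightarrow> \<bar>x powr (\<rho> - 1) * mean x - b\<bar> \<le> e"
  by (simp add: mean_limit_def)

text \<open>Decay at scale \<sigma> is weakened to a smaller \<rho>. At the critical scale \<sigma>
  = \<alpha> this reaches the range \<rho> < \<alpha> in which the bound for 1 / x works.\<close>

lemma abs_mean_le:
  assumes "\<bar>x powr (\<sigma> - 1) * mean x - b\<bar> \<le> 1" "x \<ge> 1" "\<rho> \<le> \<sigma>"
  shows "\<bar>mean x\<bar> \<le> (\<bar>b\<bar> + 1) * x powr (1 - \<rho>)"
proof -
  have "x powr (\<sigma> - 1) * \<bar>mean x\<bar> \<le> \<bar>b\<bar> + 1"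
    using assms abs_mult[of "x powr (\<sigma> - 1)" "mean x"] by simp
  hence "x powr (1 - \<sigma>) * (x powr (\<sigma> - 1) * \<bar>mean x\<bar>) \<le> x powr (1 - \<sigma>) * (\<bar>b\<bar> + 1)"
    by (intro mult_left_mono) auto
  also have "x powr (1 - \<sigma>) * (x powr (\<sigma> - 1) * \<bar>mean x\<bar>) = \<bar>mean x\<bar>"
    using assms by (simp add: mult.assoc[symmetric] powr_add[symmetric])
  also have "x powr (1 - \<sigma>) * (\<bar>b\<bar> + 1) \<le> x powr (1 - \<rho>) * (\<bar>b\<bar> + 1)"
    using assms by (intro mult_right_mono powr_mono) auto
  finally show ?thesis by (simp add: mult.commute)
qed

lemma nn_integral_powr_eq:
  "finite_moment \<nu> x \<Longrightarrow> nn_moment \<nu> x = ennreal (moment \<nu> x)"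
  by (intro nn_integral_eq_integral) auto

lemma nn_drift_leI:
  assumes "finite_moment \<nu> x" "0 \<le> d" "moment \<nu> x + d \<le> x powr \<nu>"
  shows "nn_moment \<nu> x + ennreal d \<le> ennreal (x powr \<nu>)"
  using assms by (simp add: nn_integral_powr_eq ennreal_plus[symmetric] ennreal_leI del: ennreal_plus)

text \<open>Killing would destroy the submartingale property of \<open>x powr \<nu>\<close> itself.
  Subtracting \<open>a powr \<nu>\<close> makes the function nonpositive on the states at or below
  a, so discarding them only increases the mean.\<close>

lemma submartingale_excess:
  assumes x: "x \<in> S" "x > a" and a: "a > 0" and \<nu>: "\<nu> > 0"
    and int: "finite_moment \<nu> x" and le: "x powr \<nu> \<le> moment \<nu> x"
  defines "f \<equiv> \<lambda>y. ennreal (y powr \<nu> - a powr \<nu>) * indicator (S \<inter> {a<..}) y"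
  shows "f x \<le> killed K (S \<inter> {a<..}) f x"
proof -
  have "(\<integral>y. y powr \<nu> - a powr \<nu> \<partial>K x) = moment \<nu> x - (\<integral>y. a powr \<nu> \<partial>K x)"
    using int by (intro Bochner_Integration.integral_diff) auto
  hence eq: "(\<integral>y. y powr \<nu> - a powr \<nu> \<partial>K x) = moment \<nu> x - a powr \<nu>"
    by (simp only: lebesgue_integral_const KP.prob_space scaleR_one)
  have int': "integrable (K x) (\<lambda>y. y powr \<nu> - a powr \<nu>)" using int by auto
  have "f x = ennreal (x powr \<nu> - a powr \<nu>)" using x by (simp add: f_def)
  also have "\<dots> \<le> ennreal (\<integral>y. y powr \<nu> - a powr \<nu> \<partial>K x)"
    using le unfolding eq by (intro ennreal_leI) simp
  also have "\<dots> \<le> ennreal (\<integral>y. max 0 (y powr \<nu> - a powr \<nu>) \<partial>K x)"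
    using int' by (intro ennreal_leI integral_mono) auto
  also have "\<dots> = (\<integral>\<^sup>+y. ennreal (max 0 (y powr \<nu> - a powr \<nu>)) \<partial>K x)"
    using int' by (intro nn_integral_eq_integral[symmetric]) auto
  also have "\<dots> \<le> (\<integral>\<^sup>+y. f y \<partial>K x)"
  proof (rule nn_integral_mono_AE)
    show "AE y in K x. ennreal (max 0 (y powr \<nu> - a powr \<nu>)) \<le> f y"
      using AE_K[OF x(1)]
    proof eventually_elim
      case (elim y)
      show ?case
      proof (cases "y > a")
        case True
        hence "a powr \<nu> \<le> y powr \<nu>" using a \<nu> by (intro powr_mono2) auto
        thus ?thesis using True elim by (simp add: f_def)
      next
        case False
        hence "y powr \<nu> \<le> a powr \<nu>" using elim S_nonneg \<nu> by (intro powr_mono2) auto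
        thus ?thesis by simp
      qed
    qed
  qed
  finally show ?thesis using x by (simp add: killed_in)
qed

text \<open>At \<rho> = \<alpha> the mean increment and the jumps contribute at the same order,
  \<nu> b and \<open>L\<close>. Their sum is written as G so that its sign follows from comparing b
  / c with the equation for \<open>\<nu>\<^sup>\<star>\<close>.\<close>

lemma drift_critical:
  assumes mean: "mean_limit \<alpha> b"
    and \<nu>: "0 < \<nu>" "\<nu> < \<alpha>" and \<epsilon>: "\<epsilon> > 0"
  defines "G \<equiv> \<nu> * c * (b / c - Gamma (1 - \<alpha>) * nu_gamma \<alpha> \<nu>)"
  shows "\<exists>X>0. \<forall>x\<in>S. x \<ge> X \<longrightarrow> finite_moment \<nu> x \<and>
    \<bar>moment \<nu> x - x powr \<nu> - G * x powr (\<nu> - \<alpha>)\<bar> \<le> \<epsilon> * x powr (\<nu> - \<alpha>)"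
proof -
  define L where "L = sgn (\<nu> - 1) * (c * incr_int \<nu>)"
  have G: "G = \<nu> * b + L"
    unfolding G_def L_def incr_int_nu_gamma[OF \<nu>(1)] using c by (simp add: algebra_simps)
  obtain X1 where X1: "\<And>x. x \<in> S \<Longrightarrow> x \<ge> X1 \<Longrightarrow> \<bar>x powr (\<alpha> - 1) * mean x - b\<bar> \<le> \<epsilon> / (2 * \<nu>)"
    using mean_limitD[OF mean, of "\<epsilon> / (2 * \<nu>)"] \<epsilon> \<nu> by auto
  obtain X2 where X2: "X2 > 0" "\<And>x. x \<in> S \<Longrightarrow> x \<ge> x0 \<Longrightarrow> x \<ge> X2 \<Longrightarrow> finite_moment \<nu> x \<and>
    \<bar>moment \<nu> x - x powr \<nu> - \<nu> * x powr (\<nu> - 1) * mean x - L * x powr (\<nu> - \<alpha>)\<bar> \<le> \<epsilon> / 2 * x powr (\<nu> - \<alpha>)"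
    using drift_power_sharp[OF \<nu>, of "\<epsilon> / 2"] \<epsilon> unfolding L_def by auto
  show ?thesis
  proof (intro exI[of _ "max x0 (max X1 X2)"] conjI[of "_ > (0::real)"] ballI impI)
    fix x assume x: "x \<in> S" "x \<ge> max x0 (max X1 X2)"
    have xpos: "x > 0" using x X2 by auto
    define m where "m = x powr (\<alpha> - 1) * mean x"
    have "x powr (\<nu> - 1) * mean x = x powr (\<nu> - \<alpha>) * m"
      unfolding m_def by (simp add: mult.assoc[symmetric] powr_add[symmetric])
    hence mm: "\<nu> * x powr (\<nu> - 1) * mean x = x powr (\<nu> - \<alpha>) * (\<nu> * m)" by simp
    have "\<nu> * \<bar>m - b\<bar> \<le> \<nu> * (\<epsilon> / (2 * \<nu>))"
      using X1[of x] x \<nu> unfolding m_def by (intro mult_left_mono) auto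
    hence m: "\<bar>\<nu> * m - \<nu> * b\<bar> \<le> \<epsilon> / 2"
      using \<nu> by (simp add: right_diff_distrib[symmetric] abs_mult)
    have "\<bar>x powr (\<nu> - \<alpha>) * (\<nu> * m - \<nu> * b)\<bar> \<le> x powr (\<nu> - \<alpha>) * (\<epsilon> / 2)"
      unfolding abs_mult using m by (intro mult_mono) auto
    moreover have "\<bar>moment \<nu> x - x powr \<nu> - x powr (\<nu> - \<alpha>) * (\<nu> * m) - L * x powr (\<nu> - \<alpha>)\<bar> \<le> \<epsilon> / 2 * x powr (\<nu> - \<alpha>)"
      using X2(2)[of x] x unfolding mm by auto
    moreover have "moment \<nu> x - x powr \<nu> - G * x powr (\<nu> - \<alpha>)
      = (moment \<nu> x - x powr \<nu> - x powr (\<nu> - \<alpha>) * (\<nu> * m) - L * x powr (\<nu> - \<alpha>)) + x powr (\<nu> - \<alpha>) * (\<nu> * m - \<nu> * b)"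
      by (simp add: G algebra_simps)
    moreover have "x powr (\<nu> - \<alpha>) * (\<epsilon> / 2) + \<epsilon> / 2 * x powr (\<nu> - \<alpha>) = \<epsilon> * x powr (\<nu> - \<alpha>)"
      by (simp add: mult.commute)
    moreover have "\<bar>A + B\<bar> \<le> e" if "\<bar>B\<bar> \<le> f" "\<bar>A\<bar> \<le> g" "f + g = e" for A B e f g :: real
      using that by linarith
    ultimately have "\<bar>moment \<nu> x - x powr \<nu> - G * x powr (\<nu> - \<alpha>)\<bar> \<le> \<epsilon> * x powr (\<nu> - \<alpha>)"
      by (simp only:)
    thus "finite_moment \<nu> x \<and>
      \<bar>moment \<nu> x - x powr \<nu> - G * x powr (\<nu> - \<alpha>)\<bar> \<le> \<epsilon> * x powr (\<nu> - \<alpha>)"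
      using X2(2)[of x] x by auto
  qed (use X2 in auto)
qed

text \<open>An exponent \<nu> halfway between q \<alpha> and \<nu>' has negative drift and still
  gives the tail exponent \<nu> / \<alpha> > q. Half of the drift absorbs the asymptotic
  error.\<close>

lemma critical_finite:
  assumes mean: "mean_limit \<alpha> b"
    and star: "nu_star_eq \<alpha> b c \<nu>'" and q: "0 < q" "q < \<nu>' / \<alpha>"
  shows "\<exists>a0. \<forall>a\<ge>a0. \<forall>x\<in>S. x > a \<longrightarrow> series a q x < top"
proof -
  note star' = star[unfolded nu_star_eq_iff]
  define w where "w = q * \<alpha>"
  define \<nu> where "\<nu> = (w + \<nu>') / 2"
  have "w < \<nu>'" using q \<alpha> by (simp add: w_def field_simps)
  moreover have "0 < w" using q \<alpha> by (simp add: w_def)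
  ultimately have \<nu>: "0 < \<nu>" "\<nu> < \<alpha>" "w < \<nu>" "\<nu> < \<nu>'" using star' by (auto simp: \<nu>_def)
  have q\<nu>: "q < \<nu> / \<alpha>" using \<nu>(3) \<alpha> by (simp add: w_def pos_less_divide_eq)
  define G where "G = \<nu> * c * (b / c - Gamma (1 - \<alpha>) * nu_gamma \<alpha> \<nu>)"
  have "nu_gamma \<alpha> \<nu> < nu_gamma \<alpha> \<nu>'" using star' \<nu> by (intro nu_gamma_strict_mono[OF \<alpha>]) auto
  hence "Gamma (1 - \<alpha>) * nu_gamma \<alpha> \<nu>' < Gamma (1 - \<alpha>) * nu_gamma \<alpha> \<nu>"
    using Gamma_one_minus_neg(1)[OF \<alpha>] by (intro mult_strict_left_mono_neg)
  hence G: "G < 0" unfolding G_def using \<nu> c star' by (intro mult_pos_neg mult_pos_pos) auto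
  obtain X where X: "X > 0" "\<And>x. x \<in> S \<Longrightarrow> x \<ge> X \<Longrightarrow> finite_moment \<nu> x \<and>
    \<bar>moment \<nu> x - x powr \<nu> - G * x powr (\<nu> - \<alpha>)\<bar> \<le> (- G / 2) * x powr (\<nu> - \<alpha>)"
    using drift_critical[OF mean \<nu>(1,2), of "- G / 2"] G unfolding G_def by auto
  show ?thesis
  proof (intro exI[of _ X] allI ballI impI)
    fix a x assume a: "a \<ge> X"
    have "\<exists>C\<ge>0. \<forall>x. series a q x \<le> ennreal (C * x powr \<nu>)"
    proof (rule stay_series_le_powr[where \<rho> = \<alpha> and e = "- G / 2"])
      fix x assume x: "x \<in> S \<inter> {a<..}"
      hence *: "finite_moment \<nu> x"
        "\<bar>moment \<nu> x - x powr \<nu> - G * x powr (\<nu> - \<alpha>)\<bar> \<le> (- G / 2) * x powr (\<nu> - \<alpha>)"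
        using X(2)[of x] a by auto
      show "nn_moment \<nu> x + ennreal (- G / 2 * x powr (\<nu> - \<alpha>)) \<le> ennreal (x powr \<nu>)"
        using * G by (intro nn_drift_leI) (auto simp: abs_le_iff)
    qed (use q\<nu> \<nu> \<alpha> G X a in auto)
    thus "series a q x < top"
      by (auto intro: le_less_trans)
  qed
qed

text \<open>For \<nu> above \<nu>' and below both \<alpha> and q \<alpha> the drift of the power is
  nonnegative at high levels, so its excess over a is a submartingale of the killed kernel. The
  series dominates that excess because \<rho> q' = \<nu>, and this forces divergence.\<close>

lemma critical_infinite:
  assumes mean: "mean_limit \<alpha> b"
    and star: "nu_star_eq \<alpha> b c \<nu>'" and q: "0 < q" "q > \<nu>' / \<alpha>"
  shows "\<exists>a0. \<forall>a\<ge>a0. \<forall>x\<in>S. x > a \<longrightarrow> series a q x = top"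
proof -
  note star' = star[unfolded nu_star_eq_iff]
  define w where "w = q * \<alpha>"
  define \<nu> where "\<nu> = (\<nu>' + min \<alpha> w) / 2"
  have "\<nu>' < w" using q \<alpha> by (simp add: w_def field_simps)
  hence \<nu>: "0 < \<nu>" "\<nu> < \<alpha>" "\<nu> < q * \<alpha>" "\<nu>' < \<nu>" using star' by (auto simp: \<nu>_def w_def[symmetric] min_def)
  \<comment> \<open>The series increases with q, so q may be lowered. The resulting scale \<rho> =
    \<nu> / q' lies in [1, \<alpha>): it is 1 when q' = \<nu>, and otherwise below \<alpha> because
    \<nu> < q \<alpha>.\<close>
  define q' where "q' = min q \<nu>"
  define \<rho> where "\<rho> = \<nu> / q'"
  have q': "0 < q'" "q' \<le> q" "\<rho> * q' = \<nu>" using q \<nu> by (auto simp: q'_def \<rho>_def)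
  have \<rho>: "1 \<le> \<rho>" "\<rho> < \<alpha>"
    using q' \<nu> \<alpha> q by (auto simp: q'_def \<rho>_def field_simps min_def)
  define G where "G = \<nu> * c * (b / c - Gamma (1 - \<alpha>) * nu_gamma \<alpha> \<nu>)"
  have "nu_gamma \<alpha> \<nu>' < nu_gamma \<alpha> \<nu>" using star' \<nu> by (intro nu_gamma_strict_mono[OF \<alpha>]) auto
  hence "Gamma (1 - \<alpha>) * nu_gamma \<alpha> \<nu> < Gamma (1 - \<alpha>) * nu_gamma \<alpha> \<nu>'"
    using Gamma_one_minus_neg(1)[OF \<alpha>] by (intro mult_strict_left_mono_neg)
  hence G: "G > 0" unfolding G_def using \<nu> c star' by (intro mult_pos_pos) auto
  obtain X where X: "X > 0" "\<And>x. x \<in> S \<Longrightarrow> x \<ge> X \<Longrightarrow> finite_moment \<nu> x \<and>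
    \<bar>moment \<nu> x - x powr \<nu> - G * x powr (\<nu> - \<alpha>)\<bar> \<le> G * x powr (\<nu> - \<alpha>)"
    using drift_critical[OF mean \<nu>(1,2), of G] G unfolding G_def by auto
  obtain X1 where X1: "\<And>x. x \<in> S \<Longrightarrow> x \<ge> X1 \<Longrightarrow> \<bar>x powr (\<alpha> - 1) * mean x - b\<bar> \<le> 1"
    using mean_limitD[OF mean, of 1] by auto
  have mean_bound: "\<bar>mean x\<bar> \<le> (\<bar>b\<bar> + 1) * x powr (1 - \<rho>)" if x: "x \<in> S" "x \<ge> max 1 X1" for x
    using X1[of x] x \<rho> by (intro abs_mean_le) auto
  show ?thesis
  proof (intro exI[of _ X] allI ballI impI)
    fix a x assume a: "a \<ge> X" and x: "x \<in> S" "x > a"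
    let ?E = "S \<inter> {a<..}"
    have apos: "a > 0" using a X by simp
    define f where "f y = ennreal (y powr \<nu> - a powr \<nu>) * indicator ?E y" for y
    obtain d where d: "d > 0" "\<And>y. y \<in> ?E \<Longrightarrow> ennreal (d * y powr (\<rho> * q')) \<le> series a q' y"
      using stay_series_ge_powr[OF \<rho> mean_bound q'(1) apos] by blast
    have "series a q' x = top"
    proof (rule stay_series_eq_top[where f = f and c = d])
      show "f \<in> borel_measurable borel" unfolding f_def by measurable
      show "f y \<le> killed K ?E f y" for y
      proof (cases "y \<in> ?E")
        case True
        have *: "finite_moment \<nu> y"
          "\<bar>moment \<nu> y - y powr \<nu> - G * y powr (\<nu> - \<alpha>)\<bar> \<le> G * y powr (\<nu> - \<alpha>)"
          using X(2)[of y] True a by auto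
        hence "y powr \<nu> \<le> moment \<nu> y" by (auto simp: abs_le_iff)
        thus ?thesis unfolding f_def[abs_def]
          using True apos \<nu> * by (intro submartingale_excess) auto
      qed (simp add: f_def)
      show "ennreal d * f y \<le> series a q' y" for y
      proof (cases "y \<in> ?E")
        case True
        have "ennreal d * f y = ennreal (d * (y powr \<nu> - a powr \<nu>))"
          using True d by (simp add: f_def ennreal_mult')
        also have "\<dots> \<le> ennreal (d * y powr (\<rho> * q'))"
          using d q' by (intro ennreal_leI mult_left_mono) auto
        finally show ?thesis using d(2)[OF True] by simp
      qed (simp add: f_def)
      have "a powr \<nu> < x powr \<nu>" using x apos \<nu> by (intro powr_less_mono2) auto
      thus "f x > 0" using x by (simp add: f_def)
    qed (use d q' in auto)
    moreover have "series a q' x \<le> series a q x"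
      unfolding stay_series_def using q'
      by (intro suminf_le mult_right_mono ennreal_leI powr_mono) auto
    ultimately show "series a q x = top" by (simp add: top_unique)
  qed
qed

text \<open>With \<eta> between \<rho> and \<alpha> the Taylor error is of smaller order than the
  linear term. Replacing the limit b by b / 2 and spending another quarter on the error leaves the
  constant - \<nu> b / 4.\<close>

lemma drift_subcritical:
  assumes mean: "mean_limit \<rho> b"
    and \<rho>: "1 \<le> \<rho>" "\<rho> < \<alpha>" and b: "b < 0" and \<nu>: "0 < \<nu>" "\<nu> < \<alpha>"
  shows "\<exists>X>0. \<forall>x\<in>S. x \<ge> X \<longrightarrow>
    nn_moment \<nu> x + ennreal ((- \<nu> * b / 4) * x powr (\<nu> - \<rho>)) \<le> ennreal (x powr \<nu>)"
proof -
  define \<eta> where "\<eta> = (max \<rho> \<nu> + \<alpha>) / 2"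
  have \<eta>: "1 \<le> \<eta>" "\<eta> < \<alpha>" "\<nu> \<le> \<eta>" "\<rho> < \<eta>" using \<rho> \<nu> by (auto simp: \<eta>_def)
  obtain C where C: "C \<ge> 0" "\<And>x. x \<in> S \<Longrightarrow> x \<ge> x0 \<Longrightarrow> x > 0 \<Longrightarrow> finite_moment \<nu> x \<and>
    \<bar>moment \<nu> x - x powr \<nu> - \<nu> * x powr (\<nu> - 1) * mean x\<bar> \<le> C * x powr (\<nu> - \<eta>)"
    using drift_power_coarse[OF \<nu>(1) \<eta>(3,1,2)] by auto
  obtain X1 where X1: "\<And>x. x \<in> S \<Longrightarrow> x \<ge> X1 \<Longrightarrow> \<bar>x powr (\<rho> - 1) * mean x - b\<bar> \<le> - b / 2"
    using mean_limitD[OF mean, of "- b / 2"] b by auto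
  obtain X2 where X2: "X2 > 0" "\<And>x. x \<ge> X2 \<Longrightarrow> C * x powr (- (\<eta> - \<rho>)) \<le> - \<nu> * b / 4"
    using powr_small[of "\<eta> - \<rho>" "- \<nu> * b / 4" C] \<eta> b \<nu> by (auto simp: mult_pos_neg)
  show ?thesis
  proof (intro exI[of _ "max x0 (max X1 X2)"] conjI[of "_ > (0::real)"] ballI impI)
    fix x assume x: "x \<in> S" "x \<ge> max x0 (max X1 X2)"
    have xpos: "x > 0" using x X2 by auto
    define m where "m = x powr (\<rho> - 1) * mean x"
    have int: "finite_moment \<nu> x"
      and bd: "\<bar>moment \<nu> x - x powr \<nu> - \<nu> * x powr (\<nu> - 1) * mean x\<bar> \<le> C * x powr (\<nu> - \<eta>)"
      using C(2)[of x] x xpos by auto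
    have "x powr (\<nu> - 1) * mean x = x powr (\<nu> - \<rho>) * m"
      unfolding m_def by (simp add: mult.assoc[symmetric] powr_add[symmetric])
    hence mm: "\<nu> * x powr (\<nu> - 1) * mean x = x powr (\<nu> - \<rho>) * (\<nu> * m)" by simp
    have "m \<le> b / 2" using X1[of x] x by (auto simp: m_def abs_le_iff)
    hence "\<nu> * m \<le> \<nu> * (b / 2)" using \<nu> by (intro mult_left_mono) auto
    hence 1: "x powr (\<nu> - \<rho>) * (\<nu> * m) \<le> x powr (\<nu> - \<rho>) * (\<nu> * (b / 2))"
      by (rule mult_left_mono) simp
    have "C * x powr (\<nu> - \<eta>) = (C * x powr (- (\<eta> - \<rho>))) * x powr (\<nu> - \<rho>)"
      by (simp add: mult.assoc powr_add[symmetric])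
    also have "\<dots> \<le> (- \<nu> * b / 4) * x powr (\<nu> - \<rho>)"
      using X2(2)[of x] x by (intro mult_right_mono) auto
    finally have 2: "C * x powr (\<nu> - \<eta>) \<le> (- \<nu> * b / 4) * x powr (\<nu> - \<rho>)" .
    have "moment \<nu> x \<le> x powr \<nu> + x powr (\<nu> - \<rho>) * (\<nu> * m) + C * x powr (\<nu> - \<eta>)"
      using bd unfolding mm by linarith
    also have "\<dots> \<le> x powr \<nu> + x powr (\<nu> - \<rho>) * (\<nu> * (b / 2)) + (- \<nu> * b / 4) * x powr (\<nu> - \<rho>)"
      using 1 2 by linarith
    also have "\<dots> = x powr \<nu> - (- \<nu> * b / 4) * x powr (\<nu> - \<rho>)"
      by (simp add: algebra_simps)
    finally have "moment \<nu> x + (- \<nu> * b / 4) * x powr (\<nu> - \<rho>) \<le> x powr \<nu>" by simp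
    thus "nn_moment \<nu> x + ennreal ((- \<nu> * b / 4) * x powr (\<nu> - \<rho>)) \<le> ennreal (x powr \<nu>)"
      using \<nu> b int by (intro nn_drift_leI) (auto simp: mult_nonneg_nonpos2 mult_nonneg_nonpos)
  qed (use X2 in auto)
qed

text \<open>The direct tail bound needs \<nu> \<le> \<rho> and reaches only q < 1. Larger q are
  lowered once by 1: the series for q - 1 has size \<open>y powr (\<nu> - \<rho>)\<close>, which is
  exactly the drift loss of the \<nu>-th power. One reduction is enough because \<alpha> / \<rho> <
  2.\<close>

lemma subcritical_finite:
  assumes mean: "mean_limit \<rho> b"
    and \<rho>: "1 \<le> \<rho>" "\<rho> < \<alpha>" and b: "b < 0" and q: "0 < q" "q < \<alpha> / \<rho>"
  shows "\<exists>a0. \<forall>a\<ge>a0. \<forall>x\<in>S. x > a \<longrightarrow> series a q x < top"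
proof -
  have series_le: "\<exists>X>0. \<forall>a\<ge>X. \<exists>C\<ge>0. \<forall>x. series a p x \<le> ennreal (C * x powr \<nu>)"
    if \<nu>: "0 < \<nu>" "\<nu> \<le> \<rho>" and p: "p < \<nu> / \<rho>" for p \<nu>
  proof -
    obtain X where X: "X > 0" "\<And>x. x \<in> S \<Longrightarrow> x \<ge> X \<Longrightarrow>
      nn_moment \<nu> x + ennreal ((- \<nu> * b / 4) * x powr (\<nu> - \<rho>)) \<le> ennreal (x powr \<nu>)"
      using drift_subcritical[OF mean \<rho> b, of \<nu>] \<nu> \<rho> by auto
    show ?thesis
    proof (rule exI[of _ X], intro conjI X(1) allI impI)
      fix a assume a: "a \<ge> X"
      show "\<exists>C\<ge>0. \<forall>x. series a p x \<le> ennreal (C * x powr \<nu>)"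
      proof (rule stay_series_le_powr[where \<rho> = \<rho> and e = "- \<nu> * b / 4"])
        show "- \<nu> * b / 4 > 0" using \<nu> b by (simp add: mult_pos_neg)
        fix x assume "x \<in> S \<inter> {a<..}"
        thus "nn_moment \<nu> x + ennreal ((- \<nu> * b / 4) * x powr (\<nu> - \<rho>)) \<le> ennreal (x powr \<nu>)" "0 < x"
          using X a by auto
      qed (use \<nu> p in auto)
    qed
  qed
  show ?thesis
  proof (cases "q < 1")
    case True
    then obtain X where "\<And>a. a \<ge> X \<Longrightarrow> \<exists>C\<ge>0. \<forall>x. series a q x \<le> ennreal (C * x powr \<rho>)"
      using series_le[of \<rho> q] \<rho> by auto
    thus ?thesis by (intro exI[of _ X] allI ballI impI) (meson ennreal_less_top le_less_trans)
  next
    case False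
    \<comment> \<open>Now \<nu> lies strictly between q \<rho> and \<alpha>. Hence q - 1 < (\<nu> -
      \<rho>) / \<rho>, and \<nu> - \<rho> < 1 \<le> \<rho> brings the exponent \<nu> - \<rho> back
      into the range of the direct bound.\<close>
    define w where "w = q * \<rho>"
    define \<nu> where "\<nu> = (w + \<alpha>) / 2"
    have "w < \<alpha>" using q \<rho> by (simp add: w_def field_simps)
    moreover have "w \<ge> 1 * \<rho>" unfolding w_def using False \<rho> by (intro mult_right_mono) auto
    ultimately have "0 < \<nu>" "\<nu> < \<alpha>" "w < \<nu>" "\<rho> < \<nu>" using \<rho> by (auto simp: \<nu>_def)
    hence \<nu>: "0 < \<nu>" "\<nu> < \<alpha>" "q * \<rho> < \<nu>" "\<rho> < \<nu>" by (simp_all add: w_def)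
    have "\<alpha> / \<rho> \<le> \<alpha> / 1" using \<rho> \<alpha> by (intro divide_left_mono) auto
    hence q2: "q \<le> 2" using q \<alpha> by simp
    obtain X1 where X1: "X1 > 0" "\<And>a. a \<ge> X1 \<Longrightarrow> \<exists>C\<ge>0. \<forall>x. series a (q - 1) x \<le> ennreal (C * x powr (\<nu> - \<rho>))"
      using series_le[of "\<nu> - \<rho>" "q - 1"] \<nu> \<rho> \<alpha> by (auto simp: field_simps)
    define e where "e = - \<nu> * b / 4"
    have e: "e > 0" using \<nu> b by (simp add: e_def mult_pos_neg)
    obtain X2 where X2: "X2 > 0" "\<And>x. x \<in> S \<Longrightarrow> x \<ge> X2 \<Longrightarrow>
      nn_moment \<nu> x + ennreal (e * x powr (\<nu> - \<rho>)) \<le> ennreal (x powr \<nu>)"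
      using drift_subcritical[OF mean \<rho> b \<nu>(1,2)] unfolding e_def by auto
    show ?thesis
    proof (intro exI[of _ "max X1 X2"] allI ballI impI)
      fix a x assume a: "a \<ge> max X1 X2"
      obtain C where C: "C \<ge> 0" "\<And>x. series a (q - 1) x \<le> ennreal (C * x powr (\<nu> - \<rho>))"
        using X1(2)[of a] a by auto
      have "series a q x \<le> ennreal (C / e) * ennreal (x powr \<nu>)"
      proof (rule stay_series_le_drift[where r = "\<lambda>x. ennreal (e * x powr (\<nu> - \<rho>))"])
        fix y assume y: "y \<in> S \<inter> {a<..}"
        show "series a (q - 1) y \<le> ennreal (C / e) * ennreal (e * y powr (\<nu> - \<rho>))"
          using C e by (simp add: ennreal_mult'[symmetric])
        show "ennreal (e * y powr (\<nu> - \<rho>)) + (\<integral>\<^sup>+z. ennreal (z powr \<nu>) \<partial>K y) \<le> ennreal (y powr \<nu>)"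
          using X2(2)[of y] y a by (auto simp: add.commute)
      qed (use q2 in auto)
      also have "\<dots> < top" by (simp add: ennreal_mult_less_top)
      finally show "series a q x < top" .
    qed
  qed
qed

lemma subcritical_infinite:
  assumes mean: "mean_limit \<rho> b"
    and \<rho>: "1 \<le> \<rho>" "\<rho> < \<alpha>" and q: "q \<ge> \<alpha> / \<rho>"
  shows "\<exists>a0. \<forall>a\<ge>a0. \<forall>x\<in>S. x > a \<longrightarrow> series a q x = top"
proof -
  obtain X1 where X1: "\<And>x. x \<in> S \<Longrightarrow> x \<ge> X1 \<Longrightarrow> \<bar>x powr (\<rho> - 1) * mean x - b\<bar> \<le> 1"
    using mean_limitD[OF mean, of 1] by auto
  have mean_bound: "\<bar>mean x\<bar> \<le> (\<bar>b\<bar> + 1) * x powr (1 - \<rho>)" if x: "x \<in> S" "x \<ge> max 1 X1" for x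
    using X1[of x] x \<rho> by (intro abs_mean_le) auto
  show ?thesis
  proof (intro exI[of _ "max 1 x0"] allI ballI impI)
    fix a x assume ax: "a \<ge> max 1 x0" "x \<in> S" "x > a"
    show "series a q x = top"
      by (rule stay_series_jump[OF \<rho>, of "max 1 X1", OF mean_bound]) (use ax q in auto)
  qed
qed

end

section \<open>Transfer of the hypotheses to the kernel, and the case distinction\<close>

lemma (in borel_kernel) distr_first_step:
  assumes mc: "markov_chain_from S K M X x"
  shows "distr M borel (X 1) = K x"
proof (rule measure_eqI)
  have X [measurable]: "X n \<in> borel_measurable M" for n
    using mc by (simp add: markov_chain_from_def)
  fix B assume "B \<in> sets (distr M borel (X 1))"
  hence [measurable]: "B \<in> sets borel" by simp
  have "emeasure (distr M borel (X 1)) B = (\<integral>\<^sup>+y. indicator B y \<partial>distr M borel (X 1))" by simp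
  also have "\<dots> = (\<integral>\<^sup>+w. indicator B (X 1 w) \<partial>M)" by (subst nn_integral_distr) auto
  also have "\<dots> = (\<integral>\<^sup>+y. indicator B y \<partial>K x)" by (rule nn_integral_first_step[OF mc]) auto
  finally show "emeasure (distr M borel (X 1)) B = emeasure (K x) B" by simp
qed simp

text \<open>The start \<open>X 0\<close> equals x only almost surely, so each quantity is first
  changed on a null set and then pushed forward to \<open>K x\<close>. The tail identity is
  restricted to y \<ge> 0, since the event on the left is the whole space for negative y.\<close>

lemma (in borel_kernel) first_increment:
  assumes mc: "markov_chain_from S K M X x"
  shows "(\<integral>w. X 1 w - X 0 w \<partial>M) = (\<integral>y. y - x \<partial>K x)"
    and "(\<integral>\<^sup>+w. ennreal (negpart (X 1 w - X 0 w) powr \<beta>) \<partial>M) = (\<integral>\<^sup>+y. ennreal (negpart (y - x) powr \<beta>) \<partial>K x)"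
    and "y \<ge> 0 \<Longrightarrow> measure M {w\<in>space M. pospart (X 1 w - X 0 w) > y} = measure (K x) {x + y<..}"
proof -
  have X [measurable]: "X n \<in> borel_measurable M" for n
    using mc by (simp add: markov_chain_from_def)
  have start: "AE w in M. X 0 w = x" using mc by (simp add: markov_chain_from_def)
  have [measurable]: "negpart \<in> borel_measurable borel" "pospart \<in> borel_measurable borel"
    unfolding negpart_def[abs_def] pospart_def[abs_def] by measurable
  note K = distr_first_step[OF mc, symmetric]
  have "(\<integral>w. X 1 w - X 0 w \<partial>M) = (\<integral>w. X 1 w - x \<partial>M)"
    using start by (intro integral_cong_AE) auto
  also have "\<dots> = (\<integral>y. y - x \<partial>K x)" unfolding K by (subst integral_distr) auto
  finally show "(\<integral>w. X 1 w - X 0 w \<partial>M) = (\<integral>y. y - x \<partial>K x)" .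
  have "(\<integral>\<^sup>+w. ennreal (negpart (X 1 w - X 0 w) powr \<beta>) \<partial>M) = (\<integral>\<^sup>+w. ennreal (negpart (X 1 w - x) powr \<beta>) \<partial>M)"
    using start by (intro nn_integral_cong_AE) auto
  also have "\<dots> = (\<integral>\<^sup>+y. ennreal (negpart (y - x) powr \<beta>) \<partial>K x)"
    unfolding K by (subst nn_integral_distr) auto
  finally show "(\<integral>\<^sup>+w. ennreal (negpart (X 1 w - X 0 w) powr \<beta>) \<partial>M) = (\<integral>\<^sup>+y. ennreal (negpart (y - x) powr \<beta>) \<partial>K x)" .
  assume y: "y \<ge> 0"
  have "measure M {w\<in>space M. pospart (X 1 w - X 0 w) > y} = measure M (X 1 -` {x + y<..} \<inter> space M)"
  proof (rule measure_eq_AE)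
    show "AE w in M. (w \<in> {w\<in>space M. pospart (X 1 w - X 0 w) > y}) = (w \<in> X 1 -` {x + y<..} \<inter> space M)"
      using start by eventually_elim (use y in \<open>auto simp: pospart_def\<close>)
  qed auto
  also have "\<dots> = measure (K x) {x + y<..}" unfolding K by (subst measure_distr) auto
  finally show "measure M {w\<in>space M. pospart (X 1 w - X 0 w) > y} = measure (K x) {x + y<..}" .
qed

theorem theorem2p2:
  fixes S :: "real set" and K :: "real \<Rightarrow> real measure"
    and M :: "real \<Rightarrow> 'w measure" and X :: "nat \<Rightarrow> 'w \<Rightarrow> real"
    and \<alpha> \<beta> c \<gamma> b q :: real
  assumes S_sub: "S \<subseteq> {0..}" and S_meas: "S \<in> sets borel" and S_unb: "\<not> bdd_above S"
    and kernel: "transition_kernel_on S K"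
    and chain: "\<forall>x\<in>S. markov_chain_from S K (M x) X x"
    and T: "cond_T S M X \<alpha> \<beta> c"
    and D: "cond_D S M X \<gamma> b"
    and q: "q > 0"
  shows "\<exists>a0. \<forall>a\<ge>a0. \<forall>x\<in>S. x > a \<longrightarrow>
     (\<gamma> > \<alpha> - 1 \<longrightarrow>
        (q < 1 / \<alpha> \<longrightarrow> tau_moment (M x) X a q < top) \<and>
        (q > 1 / \<alpha> \<longrightarrow> tau_moment (M x) X a q = top)) \<and>
     (\<gamma> = \<alpha> - 1 \<and> b < c * pi * \<bar>1 / sin (pi * \<alpha>)\<bar> \<longrightarrow>
        (\<exists>!\<nu>. nu_star_eq \<alpha> b c \<nu>) \<and>
        (\<forall>\<nu>. nu_star_eq \<alpha> b c \<nu> \<longrightarrow>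
           (q < \<nu> / \<alpha> \<longrightarrow> tau_moment (M x) X a q < top) \<and>
           (q > \<nu> / \<alpha> \<longrightarrow> tau_moment (M x) X a q = top))) \<and>
     (\<gamma> < \<alpha> - 1 \<and> b < 0 \<longrightarrow>
        (q < \<alpha> / (\<gamma> + 1) \<longrightarrow> tau_moment (M x) X a q < top) \<and>
        (q \<ge> \<alpha> / (\<gamma> + 1) \<longrightarrow> tau_moment (M x) X a q = top))"
proof -
  let ?T = "\<lambda>a x. tau_moment (M x) X a q"
  have kernel': "\<And>x. prob_space (K x)" "\<And>x. sets (K x) = sets borel"
    "\<And>x. x \<in> S \<Longrightarrow> emeasure (K x) S = 1"
    "\<And>B. B \<in> sets borel \<Longrightarrow> (\<lambda>x. measure (K x) B) \<in> borel_measurable borel"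
    using kernel unfolding transition_kernel_on_def by blast+
  interpret borel_kernel K by (rule borel_kernel.intro) (rule kernel'; assumption?)+
  have chain': "markov_chain_from S K (M x) X x" if "x \<in> S" for x using chain that by blast
  have \<alpha>: "1 < \<alpha>" "\<alpha> < 2" and \<beta>: "\<beta> > \<alpha>" and c: "c > 0" using T by (auto simp: cond_T_def)
  obtain x0 C where
    tail0: "\<And>\<epsilon>. \<epsilon> > 0 \<Longrightarrow> \<exists>Y. \<forall>y\<ge>Y. \<forall>x\<in>S. x \<ge> x0 \<longrightarrow>
       \<bar>y powr \<alpha> * measure (M x) {w\<in>space (M x). pospart (X 1 w - X 0 w) > y} - c\<bar> \<le> \<epsilon>"
    and left0: "\<And>x. x \<in> S \<Longrightarrow> x \<ge> x0 \<Longrightarrow> (\<integral>\<^sup>+ w. ennreal (negpart (X 1 w - X 0 w) powr \<beta>) \<partial>M x) \<le> ennreal C"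
    using T unfolding cond_T_def by blast
  interpret heavy_kernel K S \<alpha> \<beta> c x0
  proof unfold_locales
    fix \<epsilon> :: real assume "\<epsilon> > 0"
    then obtain Y where Y: "\<And>y x. y \<ge> Y \<Longrightarrow> x \<in> S \<Longrightarrow> x \<ge> x0 \<Longrightarrow>
       \<bar>y powr \<alpha> * measure (M x) {w\<in>space (M x). pospart (X 1 w - X 0 w) > y} - c\<bar> \<le> \<epsilon>"
      using tail0 by blast
    show "\<exists>Y. \<forall>y\<ge>Y. \<forall>x\<in>S. x \<ge> x0 \<longrightarrow> \<bar>y powr \<alpha> * measure (K x) {x + y<..} - c\<bar> \<le> \<epsilon>"
    proof (intro exI[of _ "max 0 Y"] allI ballI impI)
      fix y x assume "y \<ge> max 0 Y" "x \<in> S" "x \<ge> x0"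
      thus "\<bar>y powr \<alpha> * measure (K x) {x + y<..} - c\<bar> \<le> \<epsilon>"
        using Y[of y x] first_increment(3)[OF chain', of x y] by simp
    qed
  next
    show "\<exists>C. \<forall>x\<in>S. x \<ge> x0 \<longrightarrow> (\<integral>\<^sup>+y. ennreal (negpart (y - x) powr \<beta>) \<partial>K x) \<le> ennreal C"
      using left0 first_increment(2)[OF chain'] by (intro exI[of _ C]) auto
  qed (fact S_sub S_meas kernel'(3) \<alpha> \<beta> c)+
  have mean: "drift M X x = mean x" if "x \<in> S" for x
    using first_increment(1)[OF chain'[OF that]] by (simp add: drift_def mean_def)
  have \<gamma>: "\<gamma> \<ge> 0" using D by (simp add: cond_D_def)
  have mean_lim: "mean_limit (\<gamma> + 1) b"
    unfolding mean_limit_def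
  proof (intro allI impI)
    fix \<epsilon> :: real assume "\<epsilon> > 0"
    have "eventually (\<lambda>x. dist (x powr \<gamma> * drift M X x) b < \<epsilon>) (inf at_top (principal S))"
      using D \<open>\<epsilon> > 0\<close> by (auto simp: cond_D_def intro: tendstoD)
    then obtain N where "\<And>x. x \<ge> N \<Longrightarrow> x \<in> S \<Longrightarrow> dist (x powr \<gamma> * drift M X x) b < \<epsilon>"
      unfolding eventually_inf_principal eventually_at_top_linorder by blast
    thus "\<exists>X. \<forall>x\<in>S. x \<ge> X \<longrightarrow> \<bar>x powr (\<gamma> + 1 - 1) * mean x - b\<bar> \<le> \<epsilon>"
      by (intro exI[of _ N]) (auto simp: mean dist_real_def intro: less_imp_le)
  qed
  have tau_fin: "?T a x < top" if "x \<in> S" "series a q x < top" for x a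
  proof -
    have "ennreal (max 1 q) * series a q x < top"
      using that(2) by (simp add: ennreal_mult_less_top)
    thus ?thesis using tau_moment_bounds(1)[OF chain'[OF that(1)] S_meas q, of a] by (rule le_less_trans[rotated])
  qed
  have tau_inf: "?T a x = top" if "x \<in> S" "series a q x = top" for x a
  proof (rule ccontr)
    assume "?T a x \<noteq> top"
    hence "ennreal (max 1 (1 / q)) * ?T a x < top"
      by (simp add: ennreal_mult_less_top top.not_eq_extremum)
    thus False using tau_moment_bounds(2)[OF chain'[OF that(1)] S_meas q, of a] that(2)
      by (simp add: top_unique)
  qed
  \<comment> \<open>The drift constant b' is left free: it is b in the critical case and 0 when
    \<gamma> > \<alpha> - 1. Nothing is claimed at q = \<nu> / \<alpha>, so that case is
    vacuous.\<close>
  have critical: "\<exists>a0. \<forall>a\<ge>a0. \<forall>x\<in>S. x > a \<longrightarrow>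
      (q < \<nu> / \<alpha> \<longrightarrow> ?T a x < top) \<and> (q > \<nu> / \<alpha> \<longrightarrow> ?T a x = top)"
    if lim: "mean_limit \<alpha> b'" and star: "nu_star_eq \<alpha> b' c \<nu>" for b' \<nu>
  proof -
    consider "q < \<nu> / \<alpha>" | "q = \<nu> / \<alpha>" | "q > \<nu> / \<alpha>" by linarith
    thus ?thesis
    proof cases
      case 1
      thus ?thesis using critical_finite[OF lim star q 1] tau_fin by (meson less_asym)
    next
      case 3
      thus ?thesis using critical_infinite[OF lim star q 3] tau_inf by (meson less_asym)
    qed auto
  qed
  consider "\<gamma> > \<alpha> - 1" | "\<gamma> = \<alpha> - 1" | "\<gamma> < \<alpha> - 1" by linarith
  thus ?thesis
  proof cases
    case 1
    have lim: "mean_limit \<alpha> 0"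
      unfolding mean_limit_def
    proof (intro allI impI)
      fix \<epsilon> :: real assume \<epsilon>: "\<epsilon> > 0"
      obtain X1 where X1: "\<And>x. x \<in> S \<Longrightarrow> x \<ge> X1 \<Longrightarrow> \<bar>x powr \<gamma> * mean x - b\<bar> \<le> 1"
        using mean_limitD[OF mean_lim, of 1] by auto
      obtain X2 where X2: "X2 > 0" "\<And>x. x \<ge> X2 \<Longrightarrow> (\<bar>b\<bar> + 1) * x powr (- (\<gamma> - (\<alpha> - 1))) \<le> \<epsilon>"
        using powr_small[of "\<gamma> - (\<alpha> - 1)" \<epsilon> "\<bar>b\<bar> + 1"] 1 \<epsilon> by auto
      show "\<exists>X. \<forall>x\<in>S. x \<ge> X \<longrightarrow> \<bar>x powr (\<alpha> - 1) * mean x - 0\<bar> \<le> \<epsilon>"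
      proof (intro exI[of _ "max X1 X2"] ballI impI)
        fix x assume x: "x \<in> S" "x \<ge> max X1 X2"
        have "x powr (\<alpha> - 1) * mean x = (x powr \<gamma> * mean x) * x powr (- (\<gamma> - (\<alpha> - 1)))"
          by (simp add: mult_ac powr_add[symmetric])
        hence "\<bar>x powr (\<alpha> - 1) * mean x\<bar> = \<bar>x powr \<gamma> * mean x\<bar> * x powr (- (\<gamma> - (\<alpha> - 1)))"
          by (simp only: abs_mult) simp
        also have "\<dots> \<le> (\<bar>b\<bar> + 1) * x powr (- (\<gamma> - (\<alpha> - 1)))"
          using X1[of x] x by (intro mult_right_mono) auto
        also have "\<dots> \<le> \<epsilon>" using X2(2)[of x] x by simp
        finally show "\<bar>x powr (\<alpha> - 1) * mean x - 0\<bar> \<le> \<epsilon>" by simp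
      qed
    qed
    \<comment> \<open>For b = 0 the factor \<nu> - 1 vanishes at \<nu> = 1, which makes 1 / \<alpha>
      the critical moment order.\<close>
    have "nu_star_eq \<alpha> 0 c 1" using \<alpha> by (simp add: nu_star_eq_def)
    then obtain a0 where a0: "\<And>a x. a \<ge> a0 \<Longrightarrow> x \<in> S \<Longrightarrow> x > a \<Longrightarrow>
      (q < 1 / \<alpha> \<longrightarrow> ?T a x < top) \<and> (q > 1 / \<alpha> \<longrightarrow> ?T a x = top)"
      using critical[OF lim] by blast
    show ?thesis by (intro exI[of _ a0]) (use 1 a0 in auto)
  next
    case 2
    show ?thesis
    proof (cases "b < c * pi * \<bar>1 / sin (pi * \<alpha>)\<bar>")
      case True
      have ex1: "\<exists>!\<nu>. nu_star_eq \<alpha> b c \<nu>" by (rule ex1_nu_star[OF \<alpha> c True])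
      then obtain \<nu> where \<nu>: "nu_star_eq \<alpha> b c \<nu>" "\<And>\<nu>'. nu_star_eq \<alpha> b c \<nu>' \<Longrightarrow> \<nu>' = \<nu>" by blast
      obtain a0 where a0: "\<And>a x. a \<ge> a0 \<Longrightarrow> x \<in> S \<Longrightarrow> x > a \<Longrightarrow>
        (q < \<nu> / \<alpha> \<longrightarrow> ?T a x < top) \<and> (q > \<nu> / \<alpha> \<longrightarrow> ?T a x = top)"
        using critical[OF _ \<nu>(1)] mean_lim 2 by auto
      show ?thesis
        by (intro exI[of _ a0]) (use 2 ex1 \<nu>(2) a0 in auto)
    qed (use 2 in auto)
  next
    case 3
    show ?thesis
    proof (cases "b < 0")
      case True
      define \<rho> where "\<rho> = \<gamma> + 1"
      have \<rho>: "1 \<le> \<rho>" "\<rho> < \<alpha>" and lim: "mean_limit \<rho> b" using 3 \<gamma> mean_lim by (auto simp: \<rho>_def)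
      show ?thesis
      proof (cases "q < \<alpha> / \<rho>")
        case less: True
        obtain a0 where a0: "\<And>a x. a \<ge> a0 \<Longrightarrow> x \<in> S \<Longrightarrow> x > a \<Longrightarrow> series a q x < top"
          using subcritical_finite[OF lim \<rho> True q less] by blast
        show ?thesis
          by (intro exI[of _ a0]) (use 3 less a0 tau_fin in \<open>auto simp: \<rho>_def\<close>)
      next
        case ge: False
        obtain a0 where a0: "\<And>a x. a \<ge> a0 \<Longrightarrow> x \<in> S \<Longrightarrow> x > a \<Longrightarrow> series a q x = top"
          using subcritical_infinite[OF lim \<rho>, of q] ge by (auto simp: not_less)
        show ?thesis
          by (intro exI[of _ a0]) (use 3 ge a0 tau_inf in \<open>auto simp: \<rho>_def\<close>)
      qed
    qed (use 3 in auto)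
  qed
qed

end
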